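(* Suppose that $f(X_1,\dots,X_d)\in L^p$ for every $p<\infty$, and that $\mu>0$. Then, for both choices of sign $\pm$, as $x\to\infty$, the limits $$\frac{N_\pm(x)}{x^{1/d}}\longrightarrow\Bigl(\frac{d!}{\mu}\Bigr)^{1/d}\ \text{a.s.}\qquad\text{and}\qquad\frac{N_\pm(x)-(d!/\mu)^{1/d}x^{1/d}}{x^{1/(2d)}}\ \overset{\mathrm d}{\longrightarrow}\ N\Bigl(0,(d!/\mu)^{2+1/d}d^{-2}\sigma^2\Bigr)$$ hold with convergence of all moments and absolute moments (i.e., every moment of positive integer order and every absolute moment of positive real order of the left-hand side converges to the corresponding moment of the limit). In particular, as $x\to\infty$, $$\mathbb EN_\pm(x)\sim\Bigl(\frac{d!}{\mu}\Bigr)^{1/d}x^{1/d},\qquad\operatorname{Var}N_\pm(x)\sim(d!/\mu)^{2+1/d}d^{-2}\sigma^2x^{1/d}.$$ Here $$\sigma^2:=\sum_{i,j=1}^d\frac{(i+j-2)!\,(2d-i-j)!}{(i-1)!\,(j-1)!\,(d-i)!\,(d-j)!\,(2d-1)!}\,\sigma_{ij}.$$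
   Context: $X,X_1,X_2,\dots$ is an i.i.d. sequence of random variables with values in an arbitrary measurable space $(S,\mathcal S)$; $d\ge1$ is a fixed integer and $f:S^d\to\mathbb R$ is measurable (no symmetry assumed). $U_n:=\sum_{1\le i_1<\dots<i_d\le n}f(X_{i_1},\dots,X_{i_d})$ for $n\ge0$ (so $U_n=0$ for $n<d$), $\mu:=\mathbb Ef(X_1,\dots,X_d)$; for $i=1,\dots,d$, $f_i(x):=\mathbb Ef(X_1,\dots,X_{i-1},x,X_{i+1},\dots,X_d)-\mu$, and $\sigma_{ij}:=\operatorname{Cov}(f_i(X),f_j(X))$. For $x>0$, $N_-(x):=\sup\{n\ge0:U_n\le x\}$ and $N_+(x):=\inf\{n\ge0:U_n>x\}$. $N(0,0)$ is the point mass at $0$. The notation $a(x)\sim c\,b(x)$, with $c$ a constant and $b(x)>0$, means $a(x)/b(x)\to c$ (also when $c=0$). *)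

theory Defs
  imports "HOL-Probability.Probability"
begin

text \<open>
  The iid family is \<open>X 0, X 1, X 2, \<dots>\<close>: the variable \<open>X 0\<close> is the generic copy, written \<open>X\<close>
  without index on paper, and \<open>X 1, X 2, \<dots>\<close> is the sequence from which \<open>U\<^sub>n\<close> is formed.
  Points of \<open>S\<^sup>d\<close> are extensional functions on \<open>{1..d}\<close>.
\<close>

definition iid :: "'a measure \<Rightarrow> 's measure \<Rightarrow> (nat \<Rightarrow> 'a \<Rightarrow> 's) \<Rightarrow> bool" where
  "iid M S X \<longleftrightarrow>
     prob_space.indep_vars M (\<lambda>_. S) X UNIV \<and>
     (\<forall>n. distr M S (X n) = distr M S (X 0))"

definition Ustat :: "nat \<Rightarrow> ((nat \<Rightarrow> 's) \<Rightarrow> real) \<Rightarrow> (nat \<Rightarrow> 'a \<Rightarrow> 's) \<Rightarrow> nat \<Rightarrow> 'a \<Rightarrow> real" where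
  "Ustat d f X n \<omega> =
     (\<Sum>i\<in>{i \<in> {1..d} \<rightarrow>\<^sub>E {1..n}. strict_mono_on {1..d} i}. f (\<lambda>k\<in>{1..d}. X (i k) \<omega>))"

definition Umean :: "'a measure \<Rightarrow> nat \<Rightarrow> ((nat \<Rightarrow> 's) \<Rightarrow> real) \<Rightarrow> (nat \<Rightarrow> 'a \<Rightarrow> 's) \<Rightarrow> real" where
  "Umean M d f X = (\<integral>\<omega>. f (\<lambda>k\<in>{1..d}. X k \<omega>) \<partial>M)"

definition Uproj ::
  "'a measure \<Rightarrow> nat \<Rightarrow> ((nat \<Rightarrow> 's) \<Rightarrow> real) \<Rightarrow> (nat \<Rightarrow> 'a \<Rightarrow> 's) \<Rightarrow> nat \<Rightarrow> 's \<Rightarrow> real" where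
  "Uproj M d f X i x =
     (\<integral>\<omega>. f (\<lambda>k\<in>{1..d}. if k = i then x else X k \<omega>) \<partial>M) - Umean M d f X"

definition covar :: "'a measure \<Rightarrow> ('a \<Rightarrow> real) \<Rightarrow> ('a \<Rightarrow> real) \<Rightarrow> real" where
  "covar M Y Z = (\<integral>\<omega>. (Y \<omega> - (\<integral>\<omega>'. Y \<omega>' \<partial>M)) * (Z \<omega> - (\<integral>\<omega>'. Z \<omega>' \<partial>M)) \<partial>M)"

definition Ucov ::
  "'a measure \<Rightarrow> nat \<Rightarrow> ((nat \<Rightarrow> 's) \<Rightarrow> real) \<Rightarrow> (nat \<Rightarrow> 'a \<Rightarrow> 's) \<Rightarrow> nat \<Rightarrow> nat \<Rightarrow> real" where
  "Ucov M d f X i j =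
     covar M (\<lambda>\<omega>. Uproj M d f X i (X 0 \<omega>)) (\<lambda>\<omega>. Uproj M d f X j (X 0 \<omega>))"

definition Usigma2 :: "'a measure \<Rightarrow> nat \<Rightarrow> ((nat \<Rightarrow> 's) \<Rightarrow> real) \<Rightarrow> (nat \<Rightarrow> 'a \<Rightarrow> 's) \<Rightarrow> real" where
  "Usigma2 M d f X =
     (\<Sum>i=1..d. \<Sum>j=1..d.
        fact (i + j - 2) * fact (2 * d - i - j) /
        (fact (i - 1) * fact (j - 1) * fact (d - i) * fact (d - j) * fact (2 * d - 1)) *
        Ucov M d f X i j)"

text \<open>
  The passage times may be infinite on a null set, so they are extended reals.
  The infimum over the empty set is \<open>\<infinity>\<close>.
\<close>

definition N_minus ::
  "nat \<Rightarrow> ((nat \<Rightarrow> 's) \<Rightarrow> real) \<Rightarrow> (nat \<Rightarrow> 'a \<Rightarrow> 's) \<Rightarrow> real \<Rightarrow> 'a \<Rightarrow> ereal" where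
  "N_minus d f X x \<omega> = (SUP n\<in>{n. Ustat d f X n \<omega> \<le> x}. ereal (real n))"

definition N_plus ::
  "nat \<Rightarrow> ((nat \<Rightarrow> 's) \<Rightarrow> real) \<Rightarrow> (nat \<Rightarrow> 'a \<Rightarrow> 's) \<Rightarrow> real \<Rightarrow> 'a \<Rightarrow> ereal" where
  "N_plus d f X x \<omega> = (INF n\<in>{n. Ustat d f X n \<omega> > x}. ereal (real n))"

text \<open>
  The normal law with given mean and variance. In the library \<open>normal_density m 0\<close> is the zero
  function, so the degenerate case has to be set to a point mass explicitly.
\<close>

definition normal_law :: "real \<Rightarrow> real \<Rightarrow> real measure" where
  "normal_law m v =
     (if v = 0 then return borel m else density lborel (\<lambda>y. ennreal (normal_density m (sqrt v) y)))"

text \<open>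
  The same condition as in the library's \<open>weak_conv_m\<close>, for a real parameter tending to infinity
  in place of a sequence index.
\<close>

definition conv_in_distr :: "'a measure \<Rightarrow> (real \<Rightarrow> 'a \<Rightarrow> real) \<Rightarrow> real measure \<Rightarrow> bool" where
  "conv_in_distr M Y L \<longleftrightarrow>
     (\<forall>y. isCont (cdf L) y \<longrightarrow> ((\<lambda>x. cdf (distr M borel (Y x)) y) \<longlongrightarrow> cdf L y) at_top)"

text \<open>
  The Bochner integral of a non-integrable function is \<open>0\<close>, so the existence of the moments is
  part of the definition.
\<close>

definition conv_moments :: "'a measure \<Rightarrow> (real \<Rightarrow> 'a \<Rightarrow> real) \<Rightarrow> real measure \<Rightarrow> bool" where
  "conv_moments M Y L \<longleftrightarrow>
     (\<forall>k::nat. 1 \<le> k \<longrightarrow>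
        integrable L (\<lambda>y. y ^ k) \<and>
        (\<forall>\<^sub>F x in at_top. integrable M (\<lambda>\<omega>. Y x \<omega> ^ k)) \<and>
        ((\<lambda>x. \<integral>\<omega>. Y x \<omega> ^ k \<partial>M) \<longlongrightarrow> (\<integral>y. y ^ k \<partial>L)) at_top) \<and>
     (\<forall>r::real. 0 < r \<longrightarrow>
        integrable L (\<lambda>y. \<bar>y\<bar> powr r) \<and>
        (\<forall>\<^sub>F x in at_top. integrable M (\<lambda>\<omega>. \<bar>Y x \<omega>\<bar> powr r)) \<and>
        ((\<lambda>x. \<integral>\<omega>. \<bar>Y x \<omega>\<bar> powr r \<partial>M) \<longlongrightarrow> (\<integral>y. \<bar>y\<bar> powr r \<partial>L)) at_top)"

end

theory Submission
  imports Defs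
begin

text \<open>
  Write \<open>Z\<^sub>n = U\<^sub>n - (n choose d) \<mu>\<close>. Splitting \<open>f = g + h\<close>, where \<open>g\<close> averages \<open>f\<close> over its last
  coordinate, writes \<open>Z\<^sub>n\<close> as a sum of the analogous quantities of order \<open>d - 1\<close> for \<open>g\<close>, plus a
  martingale. Induction on \<open>d\<close> gives \<open>E \<bar>Z\<^sub>m - Z\<^sub>n\<bar>^(2q) = O((m - n)^q m^(2q(d - 1)))\<close>, and the same
  recursion shows that \<open>Z\<^sub>n\<close> is within \<open>O(n^(d - 1))\<close> in \<open>L\<^sup>2\<close> of a weighted sum of the \<open>f\<^sub>j(X\<^sub>k)\<close>, for which
  Lyapunov's central limit theorem holds.

  As all moments are finite, summing over all \<open>k\<close> yields one random factor \<open>a\<close>, with moments bounded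
  uniformly in \<open>n\<close>, such that \<open>\<bar>Z\<^sub>k - Z\<^sub>n\<bar> \<le> a \<bar>k - n\<bar>^(3/4) max(k,n)^(d - 1)\<close> for every \<open>k\<close>; no sharp maximal
  inequality is needed. Both passage times equal \<open>m\<close> or \<open>m + 1\<close> for an index with \<open>U\<^sub>m \<le> x < U\<^sub>m\<^sub>+\<^sub>1\<close>. With
  \<open>\<beta> = \<mu>/d!\<close> and \<open>n = \<lfloor>c x^(1/d)\<rfloor>\<close>, comparing \<open>U\<^sub>m\<close> with \<open>\<beta> m^d\<close> gives, pointwise,
  \<open>(m - n)/\<surd>n = - Z\<^sub>n/(\<beta> d n^(d - 1/2)) + O(n^(-1/8))\<close> with a constant polynomial in \<open>a\<close> and
  \<open>\<bar>Z\<^sub>n\<bar>/n^(d - 1/2)\<close>. The error therefore vanishes in every \<open>L\<^sup>p\<close>, which gives the limit law and the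
  convergence of all moments simultaneously.
\<close>

text \<open>Conditioning on the variable X_k of largest index replaces f by the random kernel f(.,
  X_k) of order d - 1, so the induction on d cannot run for one fixed f. The moment bounds are
  therefore proved for all kernels of an order at once, with a constant depending only on the order
  and the exponent and with the moment of the kernel as a linear factor; integrating over X_k
  returns the moment of f. Moments take values in \<open>ennreal\<close>, since single sections may
  have infinite ones.

  The exponent 3/4 is a convenient number strictly between 1/2 and 1. Above 1/2: the moment of order
  4r of Z_k - Z_n grows like |k - n|^(2r), and the weight |k - n|^(3r) leaves the summable factor |k
  - n|^(-r). Below 1: an inequality s <= A + B s^(3/4) for s = |m - n| can be closed. At distance s
  = O(root n) the increment is O(n^(3/8)) relative to n^(d-1), and division by root n produces the
  rate n^(-1/8).\<close>

abbreviation (in prob_space) abs_moment :: "nat \<Rightarrow> ('a \<Rightarrow> real) \<Rightarrow> ennreal" where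
  "abs_moment p Y \<equiv> \<integral>\<^sup>+\<omega>. ennreal (\<bar>Y \<omega>\<bar> ^ p) \<partial>M"

section \<open>Inequalities for powers and martingale moments\<close>

text \<open>The first two terms of the binomial expansion stay exact, because the linear one will
  have mean zero. Every later term x^(2q-k) y^k, k >= 2, is at most x^(2q-2) y^2 if |y| <= |x| and
  at most y^(2q) otherwise, and the binomial coefficients add up to 2^(2q).\<close>

lemma power_add_upper_bound:
  fixes x y :: real
  assumes "1 \<le> q"
  shows "(x + y) ^ (2 * q) \<le> x ^ (2 * q) + 2 * real q * x ^ (2 * q - 1) * y
    + 2 ^ (2 * q) * (x ^ (2 * q - 2) * y\<^sup>2 + y ^ (2 * q))"
proof -
  let ?B = "x ^ (2 * q - 2) * y\<^sup>2 + y ^ (2 * q)"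
  have B: "0 \<le> ?B"
    by (simp add: power_mult mult_nonneg_nonneg zero_le_even_power)
  have le: "x ^ (2 * q - k) * y ^ k \<le> ?B" if k: "2 \<le> k" "k \<le> 2 * q" for k
  proof -
    have "x ^ (2 * q - k) * y ^ k \<le> \<bar>x\<bar> ^ (2 * q - k) * \<bar>y\<bar> ^ k"
      by (metis abs_ge_self abs_mult power_abs)
    also have "\<dots> \<le> ?B"
    proof (cases "\<bar>y\<bar> \<le> \<bar>x\<bar>")
      case True
      have "\<bar>x\<bar> ^ (2 * q - k) * \<bar>y\<bar> ^ k = \<bar>x\<bar> ^ (2 * q - k) * \<bar>y\<bar> ^ (k - 2) * \<bar>y\<bar>\<^sup>2"
        using k by (metis le_add_diff_inverse2 mult.assoc power_add)
      also have "\<dots> \<le> \<bar>x\<bar> ^ (2 * q - k) * \<bar>x\<bar> ^ (k - 2) * \<bar>y\<bar>\<^sup>2"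
        using True by (intro mult_right_mono mult_left_mono power_mono) auto
      also have "\<dots> = \<bar>x\<bar> ^ (2 * q - 2) * y\<^sup>2"
        using k by (simp add: power_add[symmetric])
      also have "\<dots> = x ^ (2 * q - 2) * y\<^sup>2"
        by (simp add: power_even_abs)
      also have "\<dots> \<le> ?B" by (simp add: zero_le_even_power)
      finally show ?thesis .
    next
      case False
      then have "\<bar>x\<bar> ^ (2 * q - k) * \<bar>y\<bar> ^ k \<le> \<bar>y\<bar> ^ (2 * q - k) * \<bar>y\<bar> ^ k"
        by (intro mult_right_mono power_mono) auto
      also have "\<dots> = y ^ (2 * q)"
        using k by (simp add: power_add[symmetric] power_even_abs)
      also have "\<dots> \<le> ?B" by (simp add: zero_le_even_power)
      finally show ?thesis .
    qed
    finally show ?thesis .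
  qed
  have split: "{..2 * q} = {0, 1} \<union> {2..2 * q}"
    using assms by auto
  have "(x + y) ^ (2 * q) = (\<Sum>k\<le>2 * q. real (2 * q choose k) * x ^ (2 * q - k) * y ^ k)"
    by (subst add.commute) (simp add: binomial_ring mult_ac)
  also have "\<dots> = x ^ (2 * q) + 2 * real q * x ^ (2 * q - 1) * y
      + (\<Sum>k=2..2 * q. real (2 * q choose k) * (x ^ (2 * q - k) * y ^ k))"
    unfolding split by (subst sum.union_disjoint) (auto simp: mult_ac)
  also have "(\<Sum>k=2..2 * q. real (2 * q choose k) * (x ^ (2 * q - k) * y ^ k))
      \<le> (\<Sum>k=2..2 * q. real (2 * q choose k) * ?B)"
    using le by (intro sum_mono mult_left_mono) auto
  also have "\<dots> \<le> (\<Sum>k\<le>2 * q. real (2 * q choose k) * ?B)"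
    using B by (intro sum_mono2) auto
  also have "\<dots> = 2 ^ (2 * q) * ?B"
    unfolding sum_distrib_right[symmetric] choose_row_sum[of "2 * q", symmetric] of_nat_sum[symmetric]
    by (simp add: choose_row_sum)
  finally show ?thesis by simp
qed

text \<open>A weighted Young inequality. The weight 1/N is small enough for N successive uses;
  splitting at N y^2 = x^2 avoids fractional exponents.\<close>

lemma power_mult_square_le:
  fixes x y :: real
  assumes "1 \<le> q" "1 \<le> N"
  shows "x ^ (2 * q - 2) * y\<^sup>2 \<le> x ^ (2 * q) / real N + real N ^ (q - 1) * y ^ (2 * q)"
proof -
  have e: "x ^ (2 * q - 2) = (x\<^sup>2) ^ (q - 1)"
    by (simp add: power_mult[symmetric] right_diff_distrib')
  have e2: "x ^ (2 * q) = (x\<^sup>2) ^ (q - 1) * x\<^sup>2" for x :: real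
    using assms unfolding power_mult by (cases q) (simp_all add: mult.commute)
  have N: "0 < real N" using assms by simp
  show ?thesis
  proof (cases "real N * y\<^sup>2 \<le> x\<^sup>2")
    case True
    then have "x ^ (2 * q - 2) * y\<^sup>2 \<le> x ^ (2 * q - 2) * (x\<^sup>2 / real N)"
      using N by (intro mult_left_mono) (auto simp: field_simps zero_le_even_power)
    also have "\<dots> = x ^ (2 * q) / real N"
      using e e2[of x] by simp
    finally show ?thesis using N by (simp add: zero_le_even_power add_increasing2)
  next
    case False
    then have "x ^ (2 * q - 2) * y\<^sup>2 \<le> (real N * y\<^sup>2) ^ (q - 1) * y\<^sup>2"
      unfolding e by (intro mult_right_mono power_mono) auto
    also have "\<dots> = real N ^ (q - 1) * y ^ (2 * q)"
      using e2[of y] by (simp add: power_mult_distrib mult.assoc)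
    finally show ?thesis using N by (simp add: zero_le_even_power add_increasing)
  qed
qed

text \<open>
  Over \<open>N\<close> steps the factor of the first term accumulates only to
  \<open>(1 + 2^(2q)/N)^N \<le> exp (2^(2q))\<close>, while the last term contributes the required \<open>N^q\<close>.
\<close>

lemma power_add_weighted_bound:
  fixes x y :: real
  assumes "1 \<le> q" "1 \<le> N"
  shows "(x + y) ^ (2 * q) \<le> (1 + 2 ^ (2 * q) / real N) * x ^ (2 * q)
    + 2 * real q * (x ^ (2 * q - 1) * y) + 2 * 2 ^ (2 * q) * real N ^ (q - 1) * y ^ (2 * q)"
proof -
  have "1 * y ^ (2 * q) \<le> real N ^ (q - 1) * y ^ (2 * q)"
    using assms by (intro mult_right_mono one_le_power) (auto simp: zero_le_even_power)
  with power_mult_square_le[OF assms, of x y]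
  have "x ^ (2 * q - 2) * y\<^sup>2 + y ^ (2 * q) \<le> x ^ (2 * q) / real N + 2 * (real N ^ (q - 1) * y ^ (2 * q))"
    by linarith
  then have "2 ^ (2 * q) * (x ^ (2 * q - 2) * y\<^sup>2 + y ^ (2 * q))
      \<le> 2 ^ (2 * q) * (x ^ (2 * q) / real N + 2 * (real N ^ (q - 1) * y ^ (2 * q)))"
    by (intro mult_left_mono) auto
  with power_add_upper_bound[OF assms(1), of x y] show ?thesis
    by (simp add: algebra_simps)
qed

text \<open>Makes the mixed term of the martingale recursion integrable as soon as the two pure
  moments are finite.\<close>

lemma abs_power_mult_le:
  fixes x y :: real
  assumes "1 \<le> q"
  shows "\<bar>x ^ (2 * q - 1) * y\<bar> \<le> x ^ (2 * q) + y ^ (2 * q)"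
proof -
  define m where "m = max \<bar>x\<bar> \<bar>y\<bar>"
  have "\<bar>x ^ (2 * q - 1) * y\<bar> = \<bar>x\<bar> ^ (2 * q - 1) * \<bar>y\<bar>"
    by (simp add: abs_mult power_abs)
  also have "\<dots> \<le> m ^ (2 * q - 1) * m"
    by (intro mult_mono power_mono) (auto simp: m_def)
  also have "\<dots> = m ^ (2 * q)"
    using assms by (simp add: power_Suc2[symmetric])
  also have "\<dots> \<le> \<bar>x\<bar> ^ (2 * q) + \<bar>y\<bar> ^ (2 * q)"
    by (auto simp: m_def max_def)
  finally show ?thesis by (simp add: power_even_abs)
qed

text \<open>An elementary substitute for Burkholder's inequality. Since \<open>orth\<close> removes
  the mixed term, the moments u_l of the partial sums satisfy u_(l+1) <= \<rho> u_l + B, hence u_l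
  <= \<rho>^l l B. Integrability may be a premise of \<open>orth\<close> because the induction
  itself provides it.\<close>

lemma (in prob_space) martingale_moment_bound:
  fixes D :: "nat \<Rightarrow> 'a \<Rightarrow> real"
  assumes q: "1 \<le> q" and \<delta>: "0 \<le> \<delta>"
    and [measurable]: "\<And>l. D l \<in> borel_measurable M"
    and D: "\<And>l. l < N \<Longrightarrow> (\<integral>\<^sup>+\<omega>. ennreal (D l \<omega> ^ (2 * q)) \<partial>M) \<le> ennreal \<delta>"
    and orth: "\<And>l. l < N \<Longrightarrow> integrable M (\<lambda>\<omega>. (\<Sum>j<l. D j \<omega>) ^ (2 * q - 1) * D l \<omega>) \<Longrightarrow>
      (\<integral>\<omega>. (\<Sum>j<l. D j \<omega>) ^ (2 * q - 1) * D l \<omega> \<partial>M) = 0"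
  shows "(\<integral>\<^sup>+\<omega>. ennreal ((\<Sum>j<N. D j \<omega>) ^ (2 * q)) \<partial>M)
    \<le> ennreal (exp (2 ^ (2 * q)) * 2 * 2 ^ (2 * q) * real N ^ q * \<delta>)"
proof (cases "N = 0")
  case True
  then show ?thesis using q by (simp add: power_0_left)
next
  case False
  define s where "s l \<omega> = (\<Sum>j<l. D j \<omega>)" for l \<omega>
  define \<rho> where "\<rho> = 1 + 2 ^ (2 * q) / real N"
  define B where "B = 2 * 2 ^ (2 * q) * real N ^ (q - 1) * \<delta>"
  have B0: "0 \<le> B" using \<delta> by (simp add: B_def)
  have \<rho>1: "1 \<le> \<rho>" by (simp add: \<rho>_def)
  have [measurable]: "s l \<in> borel_measurable M" for l
    unfolding s_def by measurable
  have Dint: "integrable M (\<lambda>\<omega>. D l \<omega> ^ (2 * q))" if "l < N" for l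
    using D[OF that] by (intro integrableI_nonneg) (auto simp: zero_le_even_power intro: le_less_trans)
  have Dle: "(\<integral>\<omega>. D l \<omega> ^ (2 * q) \<partial>M) \<le> \<delta>" if "l < N" for l
    using D[OF that] nn_integral_eq_integral[OF Dint[OF that]] \<delta>
    by (simp add: zero_le_even_power)
  have *: "integrable M (\<lambda>\<omega>. s l \<omega> ^ (2 * q)) \<and> (\<integral>\<omega>. s l \<omega> ^ (2 * q) \<partial>M) \<le> \<rho> ^ l * (real l * B)"
    if "l \<le> N" for l
    using that
  proof (induction l)
    case 0
    then show ?case using q by (simp add: s_def power_0_left)
  next
    case (Suc l)
    then have l: "l < N" and IH1: "integrable M (\<lambda>\<omega>. s l \<omega> ^ (2 * q))"
      and IH2: "(\<integral>\<omega>. s l \<omega> ^ (2 * q) \<partial>M) \<le> \<rho> ^ l * (real l * B)" by auto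
    have int: "integrable M (\<lambda>\<omega>. s l \<omega> ^ (2 * q - 1) * D l \<omega>)"
    proof (rule Bochner_Integration.integrable_bound)
      show "integrable M (\<lambda>\<omega>. s l \<omega> ^ (2 * q) + D l \<omega> ^ (2 * q))"
        using IH1 Dint[OF l] by simp
      show "AE \<omega> in M. norm (s l \<omega> ^ (2 * q - 1) * D l \<omega>) \<le> norm (s l \<omega> ^ (2 * q) + D l \<omega> ^ (2 * q))"
      proof (rule AE_I2)
        fix \<omega>
        show "norm (s l \<omega> ^ (2 * q - 1) * D l \<omega>) \<le> norm (s l \<omega> ^ (2 * q) + D l \<omega> ^ (2 * q))"
          unfolding real_norm_def
          by (rule order_trans[OF abs_power_mult_le[OF q] abs_ge_self])
      qed
    qed simp
    have zero: "(\<integral>\<omega>. s l \<omega> ^ (2 * q - 1) * D l \<omega> \<partial>M) = 0"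
      using orth[OF l] int by (simp add: s_def)
    let ?R = "\<lambda>\<omega>. \<rho> * s l \<omega> ^ (2 * q) + 2 * real q * (s l \<omega> ^ (2 * q - 1) * D l \<omega>)
      + 2 * 2 ^ (2 * q) * real N ^ (q - 1) * D l \<omega> ^ (2 * q)"
    have R: "integrable M ?R"
      using IH1 int Dint[OF l] by simp
    have le: "s (Suc l) \<omega> ^ (2 * q) \<le> ?R \<omega>" for \<omega>
      using power_add_weighted_bound[OF q, of N "s l \<omega>" "D l \<omega>"] False
      by (simp add: s_def \<rho>_def)
    have 1: "integrable M (\<lambda>\<omega>. s (Suc l) \<omega> ^ (2 * q))"
      by (rule Bochner_Integration.integrable_bound[OF R])
         (auto intro!: AE_I2 order_trans[OF le] simp: abs_of_nonneg zero_le_even_power)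
    have "(\<integral>\<omega>. s (Suc l) \<omega> ^ (2 * q) \<partial>M) \<le> (\<integral>\<omega>. ?R \<omega> \<partial>M)"
      using le by (intro integral_mono 1 R)
    also have "\<dots> = \<rho> * (\<integral>\<omega>. s l \<omega> ^ (2 * q) \<partial>M)
        + 2 * 2 ^ (2 * q) * real N ^ (q - 1) * (\<integral>\<omega>. D l \<omega> ^ (2 * q) \<partial>M)"
      using IH1 int Dint[OF l] by (simp add: zero del: One_nat_def)
    also have "\<dots> \<le> \<rho> * (\<rho> ^ l * (real l * B)) + B"
      unfolding B_def using IH2 Dle[OF l] \<rho>1
      by (intro add_mono mult_left_mono) (auto simp: B_def)
    also have "\<dots> \<le> \<rho> * (\<rho> ^ l * (real l * B)) + \<rho> ^ Suc l * B"
      using mult_right_mono[OF one_le_power[OF \<rho>1, of "Suc l"] B0] by simp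
    also have "\<dots> = \<rho> ^ Suc l * (real (Suc l) * B)"
      by (simp add: algebra_simps)
    finally show ?case using 1 by simp
  qed
  have "(1 + 2 ^ (2 * q) / real N) ^ N \<le> exp (2 ^ (2 * q))"
    using exp_ge_one_plus_x_over_n_power_n[of N "2 ^ (2 * q)"] False
      order_trans[of "- real N" 0 "2 ^ (2 * q)"] by simp
  then have "\<rho> ^ N * (real N * B) \<le> exp (2 ^ (2 * q)) * (real N * B)"
    using B0 by (intro mult_right_mono) (auto simp: \<rho>_def)
  also have "\<dots> = exp (2 ^ (2 * q)) * 2 * 2 ^ (2 * q) * real N ^ q * \<delta>"
    using q by (cases q) (auto simp: B_def)
  finally have "(\<integral>\<omega>. s N \<omega> ^ (2 * q) \<partial>M) \<le> exp (2 ^ (2 * q)) * 2 * 2 ^ (2 * q) * real N ^ q * \<delta>"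
    using *[of N] by simp
  moreover have "(\<integral>\<^sup>+\<omega>. ennreal (s N \<omega> ^ (2 * q)) \<partial>M) = ennreal (\<integral>\<omega>. s N \<omega> ^ (2 * q) \<partial>M)"
    using *[of N] by (intro nn_integral_eq_integral) (auto simp: zero_le_even_power)
  ultimately show ?thesis by (simp add: s_def ennreal_leI)
qed

text \<open>Holds for every measurable Y: a nonintegrable Y has Bochner integral 0, and 0^p = 0 as p
  >= 1, while an infinite right-hand side is trivial.\<close>

lemma (in prob_space) jensen_power:
  assumes [measurable]: "Y \<in> borel_measurable M" and p: "1 \<le> p"
  shows "ennreal (\<bar>\<integral>\<omega>. Y \<omega> \<partial>M\<bar> ^ p) \<le> abs_moment p Y"
proof (cases "integrable M Y \<and> abs_moment p Y < \<infinity>")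
  case False
  then show ?thesis
    using p by (auto simp: not_integrable_integral_eq power_0_left not_less top_unique)
next
  case True
  have int: "integrable M (\<lambda>\<omega>. \<bar>Y \<omega>\<bar> ^ p)"
    using True by (intro integrableI_nonneg) auto
  have conv: "convex_on UNIV (\<lambda>x::real. \<bar>x\<bar> ^ p)"
  proof (rule convex_onI)
    fix t x y :: real assume t: "0 < t" "t < 1"
    have "\<bar>(1 - t) * x + t * y\<bar> \<le> (1 - t) * \<bar>x\<bar> + t * \<bar>y\<bar>"
      using t abs_triangle_ineq[of "(1 - t) * x" "t * y"] by (simp add: abs_mult)
    then have "\<bar>(1 - t) * x + t * y\<bar> ^ p \<le> ((1 - t) * \<bar>x\<bar> + t * \<bar>y\<bar>) ^ p"
      by (intro power_mono) auto
    also have "\<dots> \<le> (1 - t) * \<bar>x\<bar> ^ p + t * \<bar>y\<bar> ^ p"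
      using convex_onD[OF convex_on_subset[OF convex_power_even[of p], of "{0..}"], of t "\<bar>x\<bar>" "\<bar>y\<bar>"]
        convex_onD[OF convex_power_odd[of p], of t "\<bar>x\<bar>" "\<bar>y\<bar>"] t
      by (cases "even p") (auto simp: convex_on_subset)
    finally show "\<bar>(1 - t) *\<^sub>R x + t *\<^sub>R y\<bar> ^ p \<le> (1 - t) * \<bar>x\<bar> ^ p + t * \<bar>y\<bar> ^ p"
      by simp
  qed simp
  have "\<bar>\<integral>\<omega>. Y \<omega> \<partial>M\<bar> ^ p \<le> (\<integral>\<omega>. \<bar>Y \<omega>\<bar> ^ p \<partial>M)"
    using jensens_inequality[of Y UNIV _ _ "\<lambda>x. \<bar>x\<bar> ^ p"] True int conv by simp
  then show ?thesis
    using int by (subst nn_integral_eq_integral) (auto intro: ennreal_leI)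
qed

section \<open>Characteristic functions and convergence of moments\<close>

text \<open>Factoring out exp(itG) leaves |exp(it(Y - G)) - 1| <= |t| |Y - G|, and Jensen's
  inequality passes from the first to the second moment.\<close>

lemma (in prob_space) char_diff_le:
  assumes [measurable]: "Y \<in> borel_measurable M" "G \<in> borel_measurable M"
    and fin: "abs_moment 2 (\<lambda>\<omega>. Y \<omega> - G \<omega>) \<le> ennreal (\<epsilon>\<^sup>2)" and \<epsilon>: "0 \<le> \<epsilon>"
  shows "norm (char (distr M borel Y) t - char (distr M borel G) t) \<le> \<bar>t\<bar> * \<epsilon>"
proof -
  let ?Z = "\<lambda>\<omega>. \<bar>Y \<omega> - G \<omega>\<bar>"
  have "integrable M (\<lambda>\<omega>. ?Z \<omega> ^ 2)"
    using le_less_trans[OF fin ennreal_less_top] by (intro integrableI_nonneg) auto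
  then have Z: "integrable M ?Z"
    by (rule square_integrable_imp_integrable[rotated]) measurable
  have "ennreal (\<bar>\<integral>\<omega>. ?Z \<omega> \<partial>M\<bar>\<^sup>2) \<le> ennreal (\<epsilon>\<^sup>2)"
    by (rule order_trans[OF jensen_power]) (use fin in auto)
  then have "\<bar>\<integral>\<omega>. ?Z \<omega> \<partial>M\<bar>\<^sup>2 \<le> \<epsilon>\<^sup>2" by simp
  then have EZ: "(\<integral>\<omega>. ?Z \<omega> \<partial>M) \<le> \<epsilon>"
    using power2_le_imp_le[of "\<bar>\<integral>\<omega>. ?Z \<omega> \<partial>M\<bar>" \<epsilon>] \<epsilon> by linarith
  have int: "integrable M (\<lambda>\<omega>. iexp (t * W \<omega>))" if [measurable]: "W \<in> borel_measurable M" for W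
    by (rule integrable_const_bound[where B=1]) auto
  have "char (distr M borel Y) t - char (distr M borel G) t = (\<integral>\<omega>. iexp (t * Y \<omega>) - iexp (t * G \<omega>) \<partial>M)"
    by (simp add: char_def integral_distr int del: of_real_mult)
  also have "norm \<dots> \<le> (\<integral>\<omega>. norm (iexp (t * Y \<omega>) - iexp (t * G \<omega>)) \<partial>M)"
    by (rule integral_norm_bound)
  also have "\<dots> \<le> (\<integral>\<omega>. \<bar>t\<bar> * ?Z \<omega> \<partial>M)"
  proof (rule integral_mono)
    show "integrable M (\<lambda>\<omega>. norm (iexp (t * Y \<omega>) - iexp (t * G \<omega>)))"
      by (intro integrable_norm Bochner_Integration.integrable_diff int) auto
    show "integrable M (\<lambda>\<omega>. \<bar>t\<bar> * ?Z \<omega>)" using Z by simp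
    fix \<omega>
    have "norm (iexp (t * Y \<omega>) - iexp (t * G \<omega>)) = norm (iexp (t * G \<omega>) * (iexp (t * (Y \<omega> - G \<omega>)) - 1))"
    proof -
      have "iexp (t * Y \<omega>) = iexp (t * G \<omega>) * iexp (t * (Y \<omega> - G \<omega>))"
        unfolding exp_add[symmetric] by (rule arg_cong[where f=exp]) (simp add: algebra_simps)
      moreover have "A - B = B * (C - 1)" if "A = B * C" for A B C :: complex
        using that by (simp add: algebra_simps)
      ultimately show ?thesis by metis
    qed
    also have "\<dots> = norm (iexp (t * (Y \<omega> - G \<omega>)) - 1)"
      by (simp add: norm_mult del: of_real_mult of_real_diff)
    also have "\<dots> \<le> \<bar>t * (Y \<omega> - G \<omega>)\<bar>"
      using iexp_approx1[of "t * (Y \<omega> - G \<omega>)" 0] by simp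
    finally show "norm (iexp (t * Y \<omega>) - iexp (t * G \<omega>)) \<le> \<bar>t\<bar> * ?Z \<omega>"
      by (simp add: abs_mult)
  qed
  also have "\<dots> \<le> \<bar>t\<bar> * \<epsilon>"
    using EZ by (simp add: mult_left_mono)
  finally show ?thesis .
qed

text \<open>A Slutsky theorem for L^2-approximations, over an arbitrary filter because it is used
  both along integers n and along real x. The bound e carries no sign condition, hence the absolute
  value under the root in the proof.\<close>

lemma (in prob_space) char_slutsky:
  assumes meas: "\<And>x. Y x \<in> borel_measurable M" "\<And>x. G x \<in> borel_measurable M"
    and lim: "((\<lambda>x. char (distr M borel (G x)) t) \<longlongrightarrow> c) F"
    and e: "(e \<longlongrightarrow> 0) F" "\<forall>\<^sub>F x in F. abs_moment 2 (\<lambda>\<omega>. Y x \<omega> - G x \<omega>) \<le> ennreal (e x)"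
  shows "((\<lambda>x. char (distr M borel (Y x)) t) \<longlongrightarrow> c) F"
proof (rule Lim_transform[OF lim], rule Lim_null_comparison)
  show "\<forall>\<^sub>F x in F. norm (char (distr M borel (Y x)) t - char (distr M borel (G x)) t) \<le> \<bar>t\<bar> * sqrt \<bar>e x\<bar>"
    using e(2)
  proof eventually_elim
    case (elim x)
    also have "ennreal (e x) \<le> ennreal ((sqrt \<bar>e x\<bar>)\<^sup>2)"
      by (intro ennreal_leI) simp
    finally show ?case by (intro char_diff_le meas) auto
  qed
  have "((\<lambda>x. \<bar>t\<bar> * sqrt \<bar>e x\<bar>) \<longlongrightarrow> \<bar>t\<bar> * sqrt \<bar>0\<bar>) F"
    by (intro tendsto_intros e)
  then show "((\<lambda>x. \<bar>t\<bar> * sqrt \<bar>e x\<bar>) \<longlongrightarrow> 0) F" by simp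
qed

section \<open>A central limit theorem for triangular arrays\<close>

lemma abs_exp_minus_linear_le:
  fixes u :: real
  assumes "0 \<le> u"
  shows "\<bar>exp (- u) - (1 - u)\<bar> \<le> u\<^sup>2"
proof -
  have "1 - u \<le> exp (- u)" using exp_ge_add_one_self[of "- u"] by simp
  moreover have "exp (- u) \<le> 1 - u + u\<^sup>2"
  proof -
    have "1 + u \<le> exp u" by (rule exp_ge_add_one_self)
    then have "exp (- u) \<le> inverse (1 + u)"
      using assms by (simp add: exp_minus le_imp_inverse_le)
    also have "1 \<le> (1 - u + u\<^sup>2) * (1 + u)"
      using assms by (simp add: algebra_simps power2_eq_square)
    then have "inverse (1 + u) \<le> 1 - u + u\<^sup>2"
      using assms by (simp add: inverse_eq_divide pos_divide_le_eq)
    finally show ?thesis .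
  qed
  ultimately show ?thesis by simp
qed

text \<open>Each factor of the characteristic function is compared with exp(-t^2 s/(2n)), where s is
  the variance of the entry: the third moment gives an error of order n^(-3/2), replacing 1 - u by
  exp(-u) one of order n^(-2). All factors have modulus at most 1, so the n errors merely add up.
  Normalising by root n and not by the standard deviation admits v = 0.\<close>

lemma (in prob_space) triangular_clt:
  fixes \<xi> :: "nat \<Rightarrow> nat \<Rightarrow> 'a \<Rightarrow> real"
  assumes indep: "\<And>n. indep_vars (\<lambda>_. borel) (\<xi> n) {1..n}"
    and int3: "\<And>n k. k \<in> {1..n} \<Longrightarrow> integrable M (\<lambda>\<omega>. \<bar>\<xi> n k \<omega>\<bar> ^ 3)"
    and B3: "\<And>n k. k \<in> {1..n} \<Longrightarrow> (\<integral>\<omega>. \<bar>\<xi> n k \<omega>\<bar> ^ 3 \<partial>M) \<le> B3"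
    and int2: "\<And>n k. k \<in> {1..n} \<Longrightarrow> integrable M (\<lambda>\<omega>. (\<xi> n k \<omega>)\<^sup>2)"
    and B2: "\<And>n k. k \<in> {1..n} \<Longrightarrow> (\<integral>\<omega>. (\<xi> n k \<omega>)\<^sup>2 \<partial>M) \<le> B2"
    and mean: "\<And>n k. k \<in> {1..n} \<Longrightarrow> (\<integral>\<omega>. \<xi> n k \<omega> \<partial>M) = 0"
    and var: "(\<lambda>n. (\<Sum>k=1..n. \<integral>\<omega>. (\<xi> n k \<omega>)\<^sup>2 \<partial>M) / real n) \<longlonglongrightarrow> v"
  shows "(\<lambda>n. char (distr M borel (\<lambda>\<omega>. (\<Sum>k=1..n. \<xi> n k \<omega>) / sqrt (real n))) t) \<longlonglongrightarrow> exp (- (t\<^sup>2 * v / 2))"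
proof -
  define s where "s n k = (\<integral>\<omega>. (\<xi> n k \<omega>)\<^sup>2 \<partial>M)" for n k
  define \<eta> where "\<eta> n k \<omega> = \<xi> n k \<omega> / sqrt (real n)" for n k \<omega>
  have meas: "\<xi> n k \<in> borel_measurable M" if "k \<in> {1..n}" for n k
    using indep[of n] that by (auto simp: indep_vars_def2)
  have s0: "0 \<le> s n k" for n k by (simp add: s_def)
  have char_eq: "char (distr M borel (\<lambda>\<omega>. (\<Sum>k=1..n. \<xi> n k \<omega>) / sqrt (real n))) t
      = (\<Prod>k=1..n. char (distr M borel (\<eta> n k)) t)" for n
  proof -
    have "indep_vars (\<lambda>_. borel) (\<lambda>k \<omega>. \<xi> n k \<omega> / sqrt (real n)) {1..n}"
      by (rule indep_vars_compose2[OF indep]) simp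
    then show ?thesis
      unfolding \<eta>_def[abs_def] sum_divide_distrib by (rule char_distr_sum)
  qed
  have close: "norm (char (distr M borel (\<eta> n k)) t - exp (- (t\<^sup>2 * s n k / (2 * real n))))
      \<le> \<bar>t\<bar> ^ 3 * B3 / (6 * (real n * sqrt (real n))) + (t\<^sup>2 * B2 / (2 * real n))\<^sup>2"
    if k: "k \<in> {1..n}" for n k
  proof -
    note [measurable] = meas[OF k]
    have n: "0 < real n" using k by simp
    have [measurable]: "\<eta> n k \<in> borel_measurable M" unfolding \<eta>_def[abs_def] by measurable
    have i1: "integrable M (\<eta> n k)" unfolding \<eta>_def
      using square_integrable_imp_integrable[OF meas[OF k] int2[OF k]] by (simp add: \<eta>_def[abs_def])
    have i2: "integrable M (\<lambda>\<omega>. (\<eta> n k \<omega>)\<^sup>2)"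
      using int2[OF k] by (simp add: \<eta>_def power_divide)
    have m: "(\<integral>\<omega>. \<eta> n k \<omega> \<partial>M) = 0" using mean[OF k] by (simp add: \<eta>_def)
    have v: "(\<integral>\<omega>. (\<eta> n k \<omega>)\<^sup>2 \<partial>M) = s n k / real n"
      using n by (simp add: \<eta>_def power_divide s_def)
    have var: "variance (\<eta> n k) = s n k / real n"
      unfolding m using v by simp
    have le3: "\<bar>t\<bar> * \<bar>\<eta> n k \<omega>\<bar> ^ 3 = \<bar>t\<bar> / (real n * sqrt (real n)) * \<bar>\<xi> n k \<omega>\<bar> ^ 3" for \<omega>
      using n by (simp add: \<eta>_def power_divide power3_eq_cube)
    have "norm (char (distr M borel (\<eta> n k)) t - (1 - t\<^sup>2 * (s n k / real n) / 2))
      \<le> (t\<^sup>2 / 6) * (\<integral>\<omega>. min (6 * (\<eta> n k \<omega>)\<^sup>2) (\<bar>t\<bar> * \<bar>\<eta> n k \<omega>\<bar> ^ 3) \<partial>M)"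
      using char_approx3'[OF _ i1 i2 m var refl, of t] by simp
    also have "\<dots> \<le> (t\<^sup>2 / 6) * (\<integral>\<omega>. \<bar>t\<bar> / (real n * sqrt (real n)) * \<bar>\<xi> n k \<omega>\<bar> ^ 3 \<partial>M)"
    proof (intro mult_left_mono integral_mono)
      show "integrable M (\<lambda>\<omega>. \<bar>t\<bar> / (real n * sqrt (real n)) * \<bar>\<xi> n k \<omega>\<bar> ^ 3)"
        using int3[OF k] by simp
      show "integrable M (\<lambda>\<omega>. min (6 * (\<eta> n k \<omega>)\<^sup>2) (\<bar>t\<bar> * \<bar>\<eta> n k \<omega>\<bar> ^ 3))"
        using i2 by (intro Bochner_Integration.integrable_bound[OF integrable_mult_right[OF i2, of 6]]) auto
      show "min (6 * (\<eta> n k \<omega>)\<^sup>2) (\<bar>t\<bar> * \<bar>\<eta> n k \<omega>\<bar> ^ 3) \<le> \<bar>t\<bar> / (real n * sqrt (real n)) * \<bar>\<xi> n k \<omega>\<bar> ^ 3" for \<omega>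
        unfolding le3[symmetric] by simp
    qed auto
    also have "\<dots> = (t\<^sup>2 / 6) * (\<bar>t\<bar> / (real n * sqrt (real n)) * (\<integral>\<omega>. \<bar>\<xi> n k \<omega>\<bar> ^ 3 \<partial>M))"
      by simp
    also have "\<dots> \<le> (t\<^sup>2 / 6) * (\<bar>t\<bar> / (real n * sqrt (real n)) * B3)"
      by (intro mult_left_mono B3[OF k]) auto
    also have "\<dots> = \<bar>t\<bar> ^ 3 * B3 / (6 * (real n * sqrt (real n)))"
      by (simp add: power3_eq_cube power2_eq_square abs_mult_self_eq)
    finally have 1: "norm (char (distr M borel (\<eta> n k)) t - (1 - t\<^sup>2 * (s n k / real n) / 2))
      \<le> \<bar>t\<bar> ^ 3 * B3 / (6 * (real n * sqrt (real n)))" .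
    let ?u = "t\<^sup>2 * s n k / (2 * real n)"
    have u0: "0 \<le> ?u" using s0 by simp
    have "\<bar>exp (- ?u) - (1 - ?u)\<bar> \<le> ?u\<^sup>2"
      by (rule abs_exp_minus_linear_le[OF u0])
    also have "\<dots> \<le> (t\<^sup>2 * B2 / (2 * real n))\<^sup>2"
      using u0 B2[OF k] by (intro power_mono divide_right_mono mult_left_mono) (auto simp: s_def)
    finally have "norm (complex_of_real (1 - ?u) - complex_of_real (exp (- ?u))) \<le> (t\<^sup>2 * B2 / (2 * real n))\<^sup>2"
      unfolding of_real_diff[symmetric] norm_of_real by (simp add: abs_minus_commute)
    with 1 have "norm ((char (distr M borel (\<eta> n k)) t - complex_of_real (1 - ?u)) + (complex_of_real (1 - ?u) - complex_of_real (exp (- ?u))))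
      \<le> \<bar>t\<bar> ^ 3 * B3 / (6 * (real n * sqrt (real n))) + (t\<^sup>2 * B2 / (2 * real n))\<^sup>2"
      by (intro norm_triangle_le add_mono) (auto simp: field_simps)
    then show ?thesis by (simp add: exp_of_real)
  qed
  have "(\<lambda>n. (\<Prod>k=1..n. char (distr M borel (\<eta> n k)) t) - (\<Prod>k=1..n. complex_of_real (exp (- (t\<^sup>2 * s n k / (2 * real n)))))) \<longlonglongrightarrow> 0"
  proof (rule Lim_null_comparison)
    show "\<forall>\<^sub>F n in sequentially. norm ((\<Prod>k=1..n. char (distr M borel (\<eta> n k)) t) - (\<Prod>k=1..n. complex_of_real (exp (- (t\<^sup>2 * s n k / (2 * real n))))))
      \<le> \<bar>t\<bar> ^ 3 * B3 / 6 * (1 / sqrt (real n)) + (t\<^sup>2 * B2 / 2)\<^sup>2 * (1 / real n)"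
      using eventually_gt_at_top[of 0]
    proof eventually_elim
      case (elim n)
      have "norm ((\<Prod>k=1..n. char (distr M borel (\<eta> n k)) t) - (\<Prod>k=1..n. complex_of_real (exp (- (t\<^sup>2 * s n k / (2 * real n))))))
        \<le> (\<Sum>k=1..n. norm (char (distr M borel (\<eta> n k)) t - complex_of_real (exp (- (t\<^sup>2 * s n k / (2 * real n))))))"
      proof (rule norm_prod_diff)
        fix k assume k: "k \<in> {1..n}"
        have "\<eta> n k \<in> borel_measurable M"
          using meas[OF k] by (simp add: \<eta>_def[abs_def])
        then show "norm (char (distr M borel (\<eta> n k)) t) \<le> 1"
          by (rule real_distribution.cmod_char_le_1[OF real_distribution_distr])
        show "norm (complex_of_real (exp (- (t\<^sup>2 * s n k / (2 * real n))))) \<le> 1"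
          using s0 by simp
      qed
      also have "\<dots> \<le> (\<Sum>k=1..n. \<bar>t\<bar> ^ 3 * B3 / (6 * (real n * sqrt (real n))) + (t\<^sup>2 * B2 / (2 * real n))\<^sup>2)"
        using close by (intro sum_mono) (simp add: exp_of_real)
      also have "\<dots> = \<bar>t\<bar> ^ 3 * B3 / 6 * (1 / sqrt (real n)) + (t\<^sup>2 * B2 / 2)\<^sup>2 * (1 / real n)"
        using elim by (simp add: field_simps power2_eq_square)
      finally show ?case .
    qed
    have "(\<lambda>n. 1 / sqrt (real n)) \<longlonglongrightarrow> 0"
      by (intro tendsto_divide_0[OF tendsto_const] filterlim_at_top_imp_at_infinity
          filterlim_compose[OF sqrt_at_top filterlim_real_sequentially])
    moreover have "(\<lambda>n. 1 / real n) \<longlonglongrightarrow> 0"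
      using lim_const_over_n[of 1] by simp
    ultimately have "(\<lambda>n. \<bar>t\<bar> ^ 3 * B3 / 6 * (1 / sqrt (real n)) + (t\<^sup>2 * B2 / 2)\<^sup>2 * (1 / real n)) \<longlonglongrightarrow>
        \<bar>t\<bar> ^ 3 * B3 / 6 * 0 + (t\<^sup>2 * B2 / 2)\<^sup>2 * 0"
      by (intro tendsto_intros)
    then show "(\<lambda>n. \<bar>t\<bar> ^ 3 * B3 / 6 * (1 / sqrt (real n)) + (t\<^sup>2 * B2 / 2)\<^sup>2 * (1 / real n)) \<longlonglongrightarrow> 0"
      by simp
  qed
  moreover have "(\<Prod>k=1..n. complex_of_real (exp (- (t\<^sup>2 * s n k / (2 * real n)))))
      = complex_of_real (exp (- (t\<^sup>2 * ((\<Sum>k=1..n. s n k) / real n) / 2)))" for n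
  proof -
    have "(\<Sum>k=1..n. - (t\<^sup>2 * s n k / (2 * real n))) = - (t\<^sup>2 * ((\<Sum>k=1..n. s n k) / real n) / 2)"
      by (simp add: sum_negf sum_distrib_left sum_divide_distrib mult_ac)
    then show ?thesis by (simp only: of_real_prod[symmetric] exp_sum[symmetric] finite_atLeastAtMost)
  qed
  moreover have "(\<lambda>n. complex_of_real (exp (- (t\<^sup>2 * ((\<Sum>k=1..n. s n k) / real n) / 2)))) \<longlonglongrightarrow> complex_of_real (exp (- (t\<^sup>2 * v / 2)))"
    using var unfolding s_def by (intro tendsto_intros)  auto
  ultimately show ?thesis
    unfolding char_eq by (simp only:) (drule (1) tendsto_add, simp)
qed

section \<open>From weak convergence to convergence of moments\<close>

lemma abs_truncate_diff_le:
  fixes u K :: real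
  assumes "0 < K"
  shows "\<bar>u - max (- K) (min K u)\<bar> \<le> u\<^sup>2 / K"
proof (cases "\<bar>u\<bar> \<le> K")
  case True
  then have "max (- K) (min K u) = u" by (auto simp: abs_le_iff)
  then show ?thesis using assms by simp
next
  case False
  then have "\<bar>u - max (- K) (min K u)\<bar> \<le> \<bar>u\<bar>" using assms by (auto simp: abs_if split: if_splits)
  also have "\<bar>u\<bar> \<le> u\<^sup>2 / K"
    using False assms mult_right_mono[of K "\<bar>u\<bar>" "\<bar>u\<bar>"]
    by (simp add: pos_le_divide_eq power2_eq_square abs_mult_self_eq mult.commute)
  finally show ?thesis .
qed

text \<open>The bound on the integrals of h^2 gives uniform integrability: truncating h at level K
  changes every integral by at most B/K, uniformly in n, and the truncated function is bounded and
  continuous. The limit law inherits the bound by applying weak convergence to min(K, h^2) and then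
  Fatou's lemma as K grows.\<close>

lemma weak_conv_integral_square_bounded:
  fixes \<mu> :: "nat \<Rightarrow> real measure" and h :: "real \<Rightarrow> real"
  assumes \<mu>: "\<And>n. real_distribution (\<mu> n)" and L: "real_distribution L" and wc: "weak_conv_m \<mu> L"
    and h: "\<And>y. isCont h y" and B: "0 \<le> B"
    and bound: "\<forall>\<^sub>F n in sequentially. (\<integral>\<^sup>+y. ennreal ((h y)\<^sup>2) \<partial>\<mu> n) \<le> ennreal B"
  shows "integrable L h" and "(\<lambda>n. \<integral>y. h y \<partial>\<mu> n) \<longlonglongrightarrow> (\<integral>y. h y \<partial>L)"
proof -
  interpret \<mu>: real_distribution "\<mu> n" for n by (rule \<mu>)
  interpret L: real_distribution L by (rule L)
  have [measurable]: "h \<in> borel_measurable borel"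
    using h by (intro borel_measurable_continuous_onI continuous_at_imp_continuous_on) auto
  have sq: "integrable N (\<lambda>y. (h y)\<^sup>2) \<and> (\<integral>y. (h y)\<^sup>2 \<partial>N) \<le> B"
    if N: "sets N = sets borel" and le: "(\<integral>\<^sup>+y. ennreal ((h y)\<^sup>2) \<partial>N) \<le> ennreal B" for N
  proof
    have [measurable]: "h \<in> borel_measurable N" by (simp cong: measurable_cong_sets add: N)
    show 1: "integrable N (\<lambda>y. (h y)\<^sup>2)"
      using le_less_trans[OF le ennreal_less_top] by (intro integrableI_nonneg) auto
    show "(\<integral>y. (h y)\<^sup>2 \<partial>N) \<le> B"
      using le nn_integral_eq_integral[OF 1] B by simp
  qed
  have trunc: "\<bar>(\<integral>y. h y \<partial>N) - (\<integral>y. max (- K) (min K (h y)) \<partial>N)\<bar> \<le> B / K"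
    if N: "prob_space N" "sets N = sets borel" and le: "(\<integral>\<^sup>+y. ennreal ((h y)\<^sup>2) \<partial>N) \<le> ennreal B" and K: "0 < K" for N K
  proof -
    interpret N: prob_space N by (rule N)
    have [measurable]: "h \<in> borel_measurable N" by (simp cong: measurable_cong_sets add: N)
    note s = sq[OF N(2) le]
    have i1: "integrable N h"
      by (rule N.square_integrable_imp_integrable) (use s in auto)
    have i2: "integrable N (\<lambda>y. max (- K) (min K (h y)))"
      by (rule N.integrable_const_bound[where B=K]) (use K in auto)
    have "\<bar>(\<integral>y. h y \<partial>N) - (\<integral>y. max (- K) (min K (h y)) \<partial>N)\<bar> = \<bar>\<integral>y. h y - max (- K) (min K (h y)) \<partial>N\<bar>"
      using i1 i2 by simp
    also have "\<dots> \<le> (\<integral>y. \<bar>h y - max (- K) (min K (h y))\<bar> \<partial>N)"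
      using integral_norm_bound[of N "\<lambda>y. h y - max (- K) (min K (h y))"] by simp
    also have "\<dots> \<le> (\<integral>y. (h y)\<^sup>2 / K \<partial>N)"
      using i1 i2 s by (intro integral_mono integrable_abs Bochner_Integration.integrable_diff abs_truncate_diff_le K) auto
    also have "\<dots> \<le> B / K" using s K by (simp add: divide_right_mono)
    finally show ?thesis .
  qed
  have conv: "(\<lambda>n. \<integral>y. g y \<partial>\<mu> n) \<longlonglongrightarrow> (\<integral>y. g y \<partial>L)"
    if "\<And>y. isCont g y" "\<And>y. norm (g y) \<le> C" for g :: "real \<Rightarrow> real" and C
    by (rule weak_conv_imp_integral_bdd_continuous_conv[OF \<mu> L wc that])
  have L_bound: "(\<integral>\<^sup>+y. ennreal ((h y)\<^sup>2) \<partial>L) \<le> ennreal B"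
  proof -
    have le: "(\<integral>\<^sup>+y. ennreal (min (real K) ((h y)\<^sup>2)) \<partial>L) \<le> ennreal B" for K :: nat
    proof -
      have int: "integrable N (\<lambda>y. min (real K) ((h y)\<^sup>2))" if "prob_space N" "sets N = sets borel" for N
      proof -
        interpret N: prob_space N by (rule that)
        show ?thesis
          by (rule N.integrable_const_bound[where B="real K"]) (auto simp: that(2) cong: measurable_cong_sets)
      qed
      have "(\<lambda>n. \<integral>y. min (real K) ((h y)\<^sup>2) \<partial>\<mu> n) \<longlonglongrightarrow> (\<integral>y. min (real K) ((h y)\<^sup>2) \<partial>L)"
        by (rule conv[of "\<lambda>y. min (real K) ((h y)\<^sup>2)" "real K"]) (auto intro!: continuous_intros h)
      moreover have "\<forall>\<^sub>F n in sequentially. (\<integral>y. min (real K) ((h y)\<^sup>2) \<partial>\<mu> n) \<le> B"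
        using bound
      proof eventually_elim
        case (elim n)
        have "(\<integral>y. min (real K) ((h y)\<^sup>2) \<partial>\<mu> n) \<le> (\<integral>y. (h y)\<^sup>2 \<partial>\<mu> n)"
          using sq[OF _ elim] by (intro integral_mono int \<mu>.prob_space_axioms) auto
        with sq[OF _ elim] show ?case by simp
      qed
      ultimately have "(\<integral>y. min (real K) ((h y)\<^sup>2) \<partial>L) \<le> B"
        by (intro tendsto_upperbound) auto
      moreover have "(\<integral>\<^sup>+y. ennreal (min (real K) ((h y)\<^sup>2)) \<partial>L) = ennreal (\<integral>y. min (real K) ((h y)\<^sup>2) \<partial>L)"
        by (intro nn_integral_eq_integral int L.prob_space_axioms) auto
      ultimately show ?thesis by (simp add: ennreal_leI)
    qed
    have "(\<integral>\<^sup>+y. ennreal ((h y)\<^sup>2) \<partial>L) = (\<integral>\<^sup>+y. liminf (\<lambda>K. ennreal (min (real K) ((h y)\<^sup>2))) \<partial>L)"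
    proof (rule nn_integral_cong)
      fix y
      have "(\<lambda>K. ennreal (min (real K) ((h y)\<^sup>2))) \<longlonglongrightarrow> ennreal ((h y)\<^sup>2)"
      proof (rule tendsto_eventually)
        obtain N :: nat where "(h y)\<^sup>2 \<le> real N" using real_arch_simple by blast
        then show "\<forall>\<^sub>F K in sequentially. ennreal (min (real K) ((h y)\<^sup>2)) = ennreal ((h y)\<^sup>2)"
          by (intro eventually_sequentiallyI[of N]) (simp add: min_def)
      qed
      then show "ennreal ((h y)\<^sup>2) = liminf (\<lambda>K. ennreal (min (real K) ((h y)\<^sup>2)))"
        by (rule lim_imp_Liminf[OF trivial_limit_sequentially, symmetric])
    qed
    also have "\<dots> \<le> liminf (\<lambda>K. \<integral>\<^sup>+y. ennreal (min (real K) ((h y)\<^sup>2)) \<partial>L)"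
      by (rule nn_integral_liminf) measurable
    also have "\<dots> \<le> liminf (\<lambda>K. ennreal B)"
      by (intro Liminf_mono) (use le in auto)
    finally show ?thesis by (simp add: Liminf_const)
  qed
  show "integrable L h"
    by (rule L.square_integrable_imp_integrable) (use sq[OF _ L_bound] in auto)
  show "(\<lambda>n. \<integral>y. h y \<partial>\<mu> n) \<longlonglongrightarrow> (\<integral>y. h y \<partial>L)"
  proof (rule LIMSEQ_I)
    fix e :: real assume e: "0 < e"
    \<comment> \<open>Each of the two truncation errors becomes at most e/4, as does the error of
      the truncated integrals; B + 1 keeps K positive when B = 0.\<close>
    define K where "K = 4 * (B + 1) / e"
    have K: "0 < K" using e B by (simp add: K_def)
    have BK: "B / K \<le> e / 4" using e B by (simp add: K_def field_simps)
    have "(\<lambda>n. \<integral>y. max (- K) (min K (h y)) \<partial>\<mu> n) \<longlonglongrightarrow> (\<integral>y. max (- K) (min K (h y)) \<partial>L)"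
      by (rule conv[of "\<lambda>y. max (- K) (min K (h y))" K]) (use K in \<open>auto intro!: continuous_intros h\<close>)
    then have "\<forall>\<^sub>F n in sequentially. dist (\<integral>y. max (- K) (min K (h y)) \<partial>\<mu> n) (\<integral>y. max (- K) (min K (h y)) \<partial>L) < e / 4"
      using e by (intro tendstoD) auto
    then have "\<forall>\<^sub>F n in sequentially. norm ((\<integral>y. h y \<partial>\<mu> n) - (\<integral>y. h y \<partial>L)) < e"
      using bound
    proof eventually_elim
      case (elim n)
      have "\<bar>(\<integral>y. h y \<partial>\<mu> n) - (\<integral>y. max (- K) (min K (h y)) \<partial>\<mu> n)\<bar> \<le> B / K"
        by (rule trunc[OF \<mu>.prob_space_axioms _ elim(2) K]) simp
      moreover have "\<bar>(\<integral>y. h y \<partial>L) - (\<integral>y. max (- K) (min K (h y)) \<partial>L)\<bar> \<le> B / K"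
        by (rule trunc[OF L.prob_space_axioms _ L_bound K]) simp
      ultimately show ?case using elim(1) BK e unfolding dist_real_def real_norm_def by linarith
    qed
    then show "\<exists>no. \<forall>n\<ge>no. norm ((\<integral>y. h y \<partial>\<mu> n) - (\<integral>y. h y \<partial>L)) < e"
      by (simp add: eventually_sequentially)
  qed
qed

lemma isCont_abs_powr:
  fixes y r :: real
  assumes "0 < r"
  shows "isCont (\<lambda>y. \<bar>y\<bar> powr r) y"
  unfolding isCont_def using assms by (intro tendsto_powr' tendsto_intros) auto

lemma powr_le_one_plus_power:
  fixes y :: real
  assumes "0 \<le> y" "0 < r" "r \<le> real k"
  shows "y powr r \<le> 1 + y ^ k"
proof (cases "y \<le> 1")
  case True
  then have "y powr r \<le> 1" using assms by (intro powr_le1) auto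
  then show ?thesis using assms by (simp add: add_increasing2)
next
  case False
  then have "y powr r \<le> y powr real k" using assms by (intro powr_mono) auto
  also have "\<dots> = y ^ k" using False by (simp add: powr_realpow)
  finally show ?thesis by simp
qed

text \<open>Levy's continuity theorem concerns sequences, so each limit along real x is tested on
  arbitrary sequences tending to infinity. Boundedness of the moments of every order turns the weak
  limit into convergence of moments.\<close>

lemma (in prob_space) convergence_from_char:
  fixes Y :: "real \<Rightarrow> 'a \<Rightarrow> real"
  assumes meas [measurable]: "\<And>x. Y x \<in> borel_measurable M" and L: "real_distribution L"
    and char: "\<And>t. ((\<lambda>x. char (distr M borel (Y x)) t) \<longlongrightarrow> char L t) at_top"
    and mom: "\<And>p. \<exists>B. \<forall>\<^sub>F x in at_top. abs_moment p (Y x) \<le> ennreal B"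
  shows "conv_in_distr M Y L" and "conv_moments M Y L"
proof -
  interpret L: real_distribution L by (rule L)
  have rd: "real_distribution (distr M borel (Y x))" for x
    by (rule real_distribution_distr) simp
  have wc: "weak_conv_m (\<lambda>n. distr M borel (Y (s n))) L" if s: "filterlim s at_top sequentially" for s
    using filterlim_compose[OF char s] by (intro levy_continuity rd L)
  show "conv_in_distr M Y L"
    unfolding conv_in_distr_def
  proof (intro allI impI tendsto_at_topI_sequentially)
    fix y and s :: "nat \<Rightarrow> real" assume "isCont (cdf L) y" "filterlim s at_top sequentially"
    then show "(\<lambda>n. cdf (distr M borel (Y (s n))) y) \<longlonglongrightarrow> cdf L y"
      using wc[of s] by (simp add: weak_conv_m_def weak_conv_def)
  qed
  \<comment> \<open>One argument serves both y^k and |y|^r: the square of either is at most 1 +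
    |y|^p for some natural p, so a moment bound of order p gives the required bound on h^2.\<close>
  have main: "integrable L h \<and> (\<forall>\<^sub>F x in at_top. integrable M (\<lambda>\<omega>. h (Y x \<omega>))) \<and>
      ((\<lambda>x. \<integral>\<omega>. h (Y x \<omega>) \<partial>M) \<longlongrightarrow> (\<integral>y. h y \<partial>L)) at_top"
    if h: "\<And>y. isCont h y" and le: "\<And>y. (h y)\<^sup>2 \<le> 1 + \<bar>y\<bar> ^ p" for h :: "real \<Rightarrow> real" and p
  proof -
    have [measurable]: "h \<in> borel_measurable borel"
      using h by (intro borel_measurable_continuous_onI continuous_at_imp_continuous_on) auto
    obtain B0 where B0: "\<forall>\<^sub>F x in at_top. abs_moment p (Y x) \<le> ennreal B0"
      using mom by blast
    define B where "B = 1 + max 0 B0"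
    have ev: "\<forall>\<^sub>F x in at_top. (\<integral>\<^sup>+\<omega>. ennreal ((h (Y x \<omega>))\<^sup>2) \<partial>M) \<le> ennreal B"
      using B0
    proof eventually_elim
      case (elim x)
      have "(\<integral>\<^sup>+\<omega>. ennreal ((h (Y x \<omega>))\<^sup>2) \<partial>M) \<le> (\<integral>\<^sup>+\<omega>. 1 + ennreal (\<bar>Y x \<omega>\<bar> ^ p) \<partial>M)"
        using le by (intro nn_integral_mono) (simp add: ennreal_leI ennreal_1[symmetric] ennreal_plus[symmetric] del: ennreal_1 ennreal_plus)
      also have "\<dots> = 1 + abs_moment p (Y x)"
        by (subst nn_integral_add) (auto simp: emeasure_space_1)
      also have "\<dots> \<le> 1 + ennreal (max 0 B0)"
        using elim by (intro add_left_mono) (auto intro: order_trans ennreal_leI)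
      also have "\<dots> = ennreal B" by (simp add: B_def ennreal_plus)
      finally show ?case .
    qed
    have lim: "integrable L h" "(\<lambda>n. \<integral>\<omega>. h (Y (s n) \<omega>) \<partial>M) \<longlonglongrightarrow> (\<integral>y. h y \<partial>L)"
      if s: "filterlim s at_top sequentially" for s
    proof -
      have "\<forall>\<^sub>F n in sequentially. (\<integral>\<^sup>+y. ennreal ((h y)\<^sup>2) \<partial>distr M borel (Y (s n))) \<le> ennreal B"
        using eventually_compose_filterlim[OF ev s] by (simp add: nn_integral_distr)
      note * = weak_conv_integral_square_bounded[OF rd L wc[OF s] h _ this]
      show "integrable L h" by (rule *) (simp add: B_def)
      have "(\<lambda>n. \<integral>y. h y \<partial>distr M borel (Y (s n))) \<longlonglongrightarrow> (\<integral>y. h y \<partial>L)"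
        by (rule *) (simp add: B_def)
      then show "(\<lambda>n. \<integral>\<omega>. h (Y (s n) \<omega>) \<partial>M) \<longlonglongrightarrow> (\<integral>y. h y \<partial>L)"
        by (simp add: integral_distr)
    qed
    have "\<forall>\<^sub>F x in at_top. integrable M (\<lambda>\<omega>. h (Y x \<omega>))"
      using ev
    proof eventually_elim
      case (elim x)
      have "integrable M (\<lambda>\<omega>. (h (Y x \<omega>))\<^sup>2)"
        using le_less_trans[OF elim ennreal_less_top] by (intro integrableI_nonneg) auto
      then show ?case by (rule square_integrable_imp_integrable[rotated]) simp
    qed
    moreover have "((\<lambda>x. \<integral>\<omega>. h (Y x \<omega>) \<partial>M) \<longlongrightarrow> (\<integral>y. h y \<partial>L)) at_top"
      by (intro tendsto_at_topI_sequentially lim)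
    ultimately show ?thesis
      using lim(1)[OF filterlim_real_sequentially] by blast
  qed
  show "conv_moments M Y L"
    unfolding conv_moments_def
  proof (intro conjI[of "\<forall>k. _ k"] allI impI)
    fix k :: nat assume "1 \<le> k"
    have "(y ^ k)\<^sup>2 \<le> 1 + \<bar>y\<bar> ^ (2 * k)" for y :: real
      by (simp add: power_even_abs power_mult[symmetric] mult.commute)
    then show "integrable L (\<lambda>y. y ^ k) \<and> (\<forall>\<^sub>F x in at_top. integrable M (\<lambda>\<omega>. Y x \<omega> ^ k)) \<and>
        ((\<lambda>x. \<integral>\<omega>. Y x \<omega> ^ k \<partial>M) \<longlongrightarrow> (\<integral>y. y ^ k \<partial>L)) at_top"
      by (intro main[of "\<lambda>y. y ^ k" "2 * k"]) (auto intro!: continuous_intros)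
  next
    fix r :: real assume r: "0 < r"
    have "(\<bar>y\<bar> powr r)\<^sup>2 \<le> 1 + \<bar>y\<bar> ^ nat \<lceil>2 * r\<rceil>" for y :: real
    proof -
      have "(\<bar>y\<bar> powr r)\<^sup>2 = \<bar>y\<bar> powr (2 * r)"
        by (simp add: power2_eq_square powr_add[symmetric])
      also have "\<dots> \<le> 1 + \<bar>y\<bar> ^ nat \<lceil>2 * r\<rceil>"
        using r by (intro powr_le_one_plus_power) (auto simp: real_nat_ceiling_ge)
      finally show ?thesis .
    qed
    then show "integrable L (\<lambda>y. \<bar>y\<bar> powr r) \<and> (\<forall>\<^sub>F x in at_top. integrable M (\<lambda>\<omega>. \<bar>Y x \<omega>\<bar> powr r)) \<and>
        ((\<lambda>x. \<integral>\<omega>. \<bar>Y x \<omega>\<bar> powr r \<partial>M) \<longlongrightarrow> (\<integral>y. \<bar>y\<bar> powr r \<partial>L)) at_top"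
      using isCont_abs_powr[OF r] by (intro main[of "\<lambda>y. \<bar>y\<bar> powr r"])
  qed
qed

section \<open>Normal laws, including the point mass\<close>

lemma real_distribution_normal_law:
  assumes "0 \<le> v"
  shows "real_distribution (normal_law m v)"
proof (cases "v = 0")
  case True
  then show ?thesis
    by (auto simp: normal_law_def real_distribution_def real_distribution_axioms_def intro: prob_space_return)
next
  case False
  then show ?thesis using assms prob_space_normal_density[of "sqrt v" m]
    by (auto simp: normal_law_def real_distribution_def real_distribution_axioms_def)
qed

lemma char_normal_law:
  assumes "0 \<le> v"
  shows "char (normal_law 0 v) t = exp (- (t\<^sup>2 * v / 2))"
proof (cases "v = 0")
  case True
  then show ?thesis by (simp add: normal_law_def char_def integral_return)
next
  case False
  with assms have v: "0 < sqrt v" by simp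
  interpret P: prob_space "density lborel std_normal_density"
    using prob_space_normal_density[of 1 0] by simp
  have "distributed (density lborel std_normal_density) lborel (\<lambda>x. x) (\<lambda>x. ennreal (normal_density 0 1 x))"
    by (simp add: distributed_def distr_id2)
  from P.normal_density_affine[OF this, of "sqrt v" 0] v
  have "distributed (density lborel std_normal_density) lborel (\<lambda>x. sqrt v * x) (\<lambda>x. ennreal (normal_density 0 (sqrt v) x))"
    by simp
  then have eq: "normal_law 0 v = distr (density lborel std_normal_density) lborel (\<lambda>x. sqrt v * x)"
    using False by (simp add: normal_law_def distributed_def)
  have "char (normal_law 0 v) t = char (density lborel std_normal_density) (t * sqrt v)"
    unfolding eq char_def by (subst integral_distr) (simp_all add: mult_ac)
  also have "\<dots> = exp (- (t * sqrt v)\<^sup>2 / 2)"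
    by (rule fun_cong[OF char_std_normal_distribution])
  finally show ?thesis using assms by (simp add: power_mult_distrib)
qed

section \<open>Increasing index maps and counting\<close>

definition increasing_maps :: "nat \<Rightarrow> nat \<Rightarrow> (nat \<Rightarrow> nat) set" where
  "increasing_maps d n = {i \<in> {1..d} \<rightarrow>\<^sub>E {1..n}. strict_mono_on {1..d} i}"

lemma finite_increasing_maps [simp]: "finite (increasing_maps d n)"
  unfolding increasing_maps_def
  by (rule finite_subset[of _ "{1..d} \<rightarrow>\<^sub>E {1..n}"]) (auto intro: finite_PiE)

lemma Ustat_alt: "Ustat d f X n \<omega> = (\<Sum>i\<in>increasing_maps d n. f (\<lambda>k\<in>{1..d}. X (i k) \<omega>))"
  by (simp add: Ustat_def increasing_maps_def)

text \<open>The empty map is the only index map, so a statistic of order 0 is constant. Inductions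
  on the order can therefore start at 0.\<close>

lemma Ustat_0: "Ustat 0 f X n \<omega> = f (\<lambda>_. undefined)"
proof -
  have "increasing_maps 0 n = {\<lambda>_. undefined}"
    by (auto simp: increasing_maps_def strict_mono_on_def)
  then show ?thesis by (simp add: Ustat_alt restrict_def)
qed

text \<open>Tuples are sorted by their largest index k; the other indices form an increasing tuple
  below k. The k-th summand thus depends only on X_k and on X_1, ..., X_(k-1), which is the source
  of the martingale structure.\<close>

lemma Ustat_Suc:
  "Ustat (Suc d) f X n \<omega> = (\<Sum>k=1..n. Ustat d (\<lambda>z. f (z(Suc d := X k \<omega>))) X (k - 1) \<omega>)"
proof -
  have "(\<Sum>k=1..n. Ustat d (\<lambda>z. f (z(Suc d := X k \<omega>))) X (k - 1) \<omega>) =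
    (\<Sum>(k, j)\<in>Sigma {1..n} (\<lambda>k. increasing_maps d (k - 1)).
       f ((\<lambda>l\<in>{1..d}. X (j l) \<omega>)(Suc d := X k \<omega>)))"
    unfolding Ustat_alt by (subst sum.Sigma) auto
  also have "\<dots> = Ustat (Suc d) f X n \<omega>"
    unfolding Ustat_alt
  proof (rule sum.reindex_bij_witness[of _ "\<lambda>i. (i (Suc d), restrict i {1..d})" "\<lambda>(k, j). j(Suc d := k)"])
    fix a assume a: "a \<in> Sigma {1..n} (\<lambda>k. increasing_maps d (k - 1))"
    obtain k j where [simp]: "a = (k, j)" by (cases a)
    from a have k: "k \<in> {1..n}" and j: "j \<in> {1..d} \<rightarrow>\<^sub>E {1..k - 1}" and sm: "strict_mono_on {1..d} j"
      by (auto simp: increasing_maps_def)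
    have ext: "j l = undefined" if "l \<notin> {1..d}" for l
      using j that by (rule PiE_arb)
    have bd: "1 \<le> j l \<and> j l \<le> k - 1" if "l \<in> {1..d}" for l
      using PiE_mem[OF j that] by simp
    show "(\<lambda>i. (i (Suc d), restrict i {1..d})) ((\<lambda>(k, j). j(Suc d := k)) a) = a"
      using ext by (auto simp: restrict_def fun_eq_iff)
    have "strict_mono_on {1..Suc d} (j(Suc d := k))"
    proof (rule strict_mono_onI)
      fix r s assume rs: "r \<in> {1..Suc d}" "s \<in> {1..Suc d}" "r < s"
      then have r: "r \<in> {1..d}" by auto
      show "(j(Suc d := k)) r < (j(Suc d := k)) s"
      proof (cases "s = Suc d")
        case True
        then show ?thesis using bd[OF r] r k by auto
      next
        case False
        then show ?thesis using sm rs r by (auto simp: strict_mono_on_def)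
      qed
    qed
    moreover have "j(Suc d := k) \<in> {1..Suc d} \<rightarrow>\<^sub>E {1..n}"
    proof (rule PiE_I)
      fix l assume "l \<in> {1..Suc d}"
      then show "(j(Suc d := k)) l \<in> {1..n}"
        using bd[of l] k by (cases "l = Suc d") auto
    next
      fix l assume "l \<notin> {1..Suc d}"
      then show "(j(Suc d := k)) l = undefined" using ext[of l] by auto
    qed
    ultimately show "(\<lambda>(k, j). j(Suc d := k)) a \<in> increasing_maps (Suc d) n"
      by (simp add: increasing_maps_def)
    have "(\<lambda>l\<in>{1..Suc d}. X ((j(Suc d := k)) l) \<omega>) = (\<lambda>l\<in>{1..d}. X (j l) \<omega>)(Suc d := X k \<omega>)"
      by (auto simp: restrict_def fun_eq_iff)
    then show "f (\<lambda>k\<in>{1..Suc d}. X ((\<lambda>(k, j). j(Suc d := k)) a k) \<omega>) =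
        (case a of (k, j) \<Rightarrow> f ((\<lambda>l\<in>{1..d}. X (j l) \<omega>)(Suc d := X k \<omega>)))"
      by simp
  next
    fix i assume i: "i \<in> increasing_maps (Suc d) n"
    then have i1: "i \<in> {1..Suc d} \<rightarrow>\<^sub>E {1..n}" and i2: "strict_mono_on {1..Suc d} i"
      by (auto simp: increasing_maps_def)
    have ext: "i l = undefined" if "l \<notin> {1..Suc d}" for l
      using i1 that by (rule PiE_arb)
    have bd: "1 \<le> i l \<and> i l \<le> n" if "l \<in> {1..Suc d}" for l
      using PiE_mem[OF i1 that] by simp
    show "(\<lambda>(k, j). j(Suc d := k)) (i (Suc d), restrict i {1..d}) = i"
      using ext by (auto simp: restrict_def fun_eq_iff)
    have lt: "i l < i (Suc d)" if "l \<in> {1..d}" for l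
      using i2 that by (auto simp: strict_mono_on_def)
    have "restrict i {1..d} \<in> increasing_maps d (i (Suc d) - 1)"
      unfolding increasing_maps_def
    proof (intro CollectI conjI)
      show "restrict i {1..d} \<in> {1..d} \<rightarrow>\<^sub>E {1..i (Suc d) - 1}"
      proof (rule PiE_I)
        fix l assume l: "l \<in> {1..d}"
        then show "restrict i {1..d} l \<in> {1..i (Suc d) - 1}"
          using bd[of l] lt[OF l] by auto
      qed auto
      show "strict_mono_on {1..d} (restrict i {1..d})"
        using i2 by (auto simp: strict_mono_on_def)
    qed
    then show "(i (Suc d), restrict i {1..d}) \<in> Sigma {1..n} (\<lambda>k. increasing_maps d (k - 1))"
      using bd[of "Suc d"] by auto
  qed
  finally show ?thesis ..
qed

lemma sum_choose_shift: "(\<Sum>k=m+1..n. (k - 1) choose d) = (n choose Suc d) - (m choose Suc d)" if "m \<le> n"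
  using that
proof (induction n rule: dec_induct)
  case (step n)
  have "m choose Suc d \<le> n choose Suc d"
    using step by (intro binomial_right_mono) auto
  with step show ?case by simp
qed simp

lemma convex_on_nonneg_power: "convex_on {0::real..} (\<lambda>x. x ^ p)"
  using convex_power_odd[of p] convex_on_subset[OF convex_power_even[of p], of "{0..}"]
  by (cases "even p") auto

text \<open>Convexity of the p-th power at the uniform average of the |a_k|; an infinite index set
  contributes sum 0.\<close>

lemma abs_sum_power_le:
  fixes a :: "'i \<Rightarrow> real"
  assumes "1 \<le> p"
  shows "\<bar>\<Sum>k\<in>A. a k\<bar> ^ p \<le> real (card A) ^ (p - 1) * (\<Sum>k\<in>A. \<bar>a k\<bar> ^ p)"
proof (cases "finite A \<and> A \<noteq> {}")
  case True
  then have fin: "finite A" and c: "0 < real (card A)" by (auto simp: card_gt_0_iff)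
  have "((\<Sum>k\<in>A. (1 / real (card A)) *\<^sub>R \<bar>a k\<bar>)) ^ p \<le> (\<Sum>k\<in>A. (1 / real (card A)) * \<bar>a k\<bar> ^ p)"
    using True c by (intro convex_on_sum[OF _ _ convex_on_nonneg_power]) auto
  then have "((\<Sum>k\<in>A. \<bar>a k\<bar>) / real (card A)) ^ p \<le> (\<Sum>k\<in>A. \<bar>a k\<bar> ^ p) / real (card A)"
    by (simp add: sum_divide_distrib)
  then have "(\<Sum>k\<in>A. \<bar>a k\<bar>) ^ p \<le> real (card A) ^ (p - 1) * (\<Sum>k\<in>A. \<bar>a k\<bar> ^ p)"
    using c assms by (cases p) (simp_all add: field_simps power_divide)
  moreover have "\<bar>\<Sum>k\<in>A. a k\<bar> ^ p \<le> (\<Sum>k\<in>A. \<bar>a k\<bar>) ^ p"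
    by (intro power_mono sum_abs) simp
  ultimately show ?thesis by linarith
next
  case False
  then have "(\<Sum>k\<in>A. a k) = 0" "(\<Sum>k\<in>A. \<bar>a k\<bar> ^ p) = 0" by (auto simp: sum.infinite)
  with assms show ?thesis by (simp add: power_0_left)
qed

section \<open>Independence of past and future\<close>

locale iid_sequence = prob_space M for M :: "'a measure" +
  fixes S :: "'s measure" and X :: "nat \<Rightarrow> 'a \<Rightarrow> 's"
  assumes iid: "iid M S X"
begin

definition law :: "'s measure" where
  "law = distr M S (X 0)"

lemma indep: "indep_vars (\<lambda>_. S) X UNIV"
  using iid by (simp add: iid_def)

lemma measurable_X [measurable]: "X k \<in> measurable M S"
  using indep by (auto simp: indep_vars_def2)

lemma distr_X: "distr M S (X k) = law"
  using iid unfolding iid_def law_def by blast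

lemma sets_law [measurable_cong, simp]: "sets law = sets S"
  by (simp add: law_def)

lemma space_law [simp]: "space law = space S"
  by (simp add: law_def)

lemma prob_space_law: "prob_space law"
  unfolding law_def by (rule prob_space_distr) simp

sublocale law: prob_space law
  by (rule prob_space_law)

text \<open>The index set is arbitrary: initial segments serve the martingale argument, and
  \<open>{1..d} - {j}\<close> serves the projections \<open>Uproj\<close>.\<close>

definition past :: "nat set \<Rightarrow> 'a \<Rightarrow> nat \<Rightarrow> 's" where
  "past J \<omega> = (\<lambda>j\<in>J. X j \<omega>)"

lemma measurable_past [measurable]: "past J \<in> measurable M (PiM J (\<lambda>_. S))"
  unfolding past_def by measurable

text \<open>Independence of disjoint blocks concerns restrictions to index sets, so X_k is first
  treated as a point of the product over {k} and then read off as its only coordinate.\<close>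

lemma pair_law:
  assumes "k \<notin> J"
  shows "distr M (PiM J (\<lambda>_. S) \<Otimes>\<^sub>M S) (\<lambda>\<omega>. (past J \<omega>, X k \<omega>))
    = distr M (PiM J (\<lambda>_. S)) (past J) \<Otimes>\<^sub>M law"
proof -
  have "indep_var (PiM J (\<lambda>_. S)) (\<lambda>\<omega>. restrict (\<lambda>i. X i \<omega>) J)
      (PiM {k} (\<lambda>_. S)) (\<lambda>\<omega>. restrict (\<lambda>i. X i \<omega>) {k})"
    using assms by (intro indep_var_restrict[OF indep]) auto
  then have eq: "distr M (PiM J (\<lambda>_. S)) (past J) \<Otimes>\<^sub>M distr M (PiM {k} (\<lambda>_. S)) (past {k})
      = distr M (PiM J (\<lambda>_. S) \<Otimes>\<^sub>M PiM {k} (\<lambda>_. S)) (\<lambda>\<omega>. (past J \<omega>, past {k} \<omega>))"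
    using indep_var_distribution_eq[of "PiM J (\<lambda>_. S)" "past J" "PiM {k} (\<lambda>_. S)" "past {k}"]
    by (simp add: past_def[abs_def])
  let ?Q = "distr M (PiM J (\<lambda>_. S)) (past J)" and ?R = "distr M (PiM {k} (\<lambda>_. S)) (past {k})"
  have [measurable]: "(\<lambda>y. y k) \<in> measurable (PiM {k} (\<lambda>_. S)) S"
    by (rule measurable_component_singleton) simp
  have law_eq: "law = distr ?R S (\<lambda>y. y k)"
    by (subst distr_distr) (auto simp: comp_def past_def distr_X)
  have "?Q \<Otimes>\<^sub>M law = distr ?Q (PiM J (\<lambda>_. S)) (\<lambda>y. y) \<Otimes>\<^sub>M distr ?R S (\<lambda>y. y k)"
    unfolding law_eq by (simp add: distr_id2)
  also have "\<dots> = distr (?Q \<Otimes>\<^sub>M ?R) (PiM J (\<lambda>_. S) \<Otimes>\<^sub>M S) (\<lambda>(y, z). (y, z k))"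
    by (rule pair_measure_distr) (auto simp: law_eq[symmetric] intro: law.sigma_finite_measure_axioms)
  also have "\<dots> = distr M (PiM J (\<lambda>_. S) \<Otimes>\<^sub>M S) (\<lambda>\<omega>. (past J \<omega>, X k \<omega>))"
    unfolding eq by (subst distr_distr) (auto simp: comp_def past_def)
  finally show ?thesis ..
qed

text \<open>Tonelli's theorem for the product law of the past and a fresh variable. The right-hand
  sides no longer mention k; this is where identical distribution enters.\<close>

lemma nn_integral_past:
  assumes k: "k \<notin> J" and [measurable]: "\<phi> \<in> borel_measurable (PiM J (\<lambda>_. S) \<Otimes>\<^sub>M S)"
  shows "(\<integral>\<^sup>+\<omega>. \<phi> (past J \<omega>, X k \<omega>) \<partial>M) = (\<integral>\<^sup>+x. \<integral>\<^sup>+\<omega>. \<phi> (past J \<omega>, x) \<partial>M \<partial>law)"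
    and "(\<integral>\<^sup>+\<omega>. \<phi> (past J \<omega>, X k \<omega>) \<partial>M) = (\<integral>\<^sup>+\<omega>. \<integral>\<^sup>+x. \<phi> (past J \<omega>, x) \<partial>law \<partial>M)"
proof -
  let ?Q = "distr M (PiM J (\<lambda>_. S)) (past J)"
  interpret Q: prob_space ?Q by (rule prob_space_distr) simp
  interpret pair_sigma_finite ?Q law ..
  have "(\<integral>\<^sup>+\<omega>. \<phi> (past J \<omega>, X k \<omega>) \<partial>M) = (\<integral>\<^sup>+z. \<phi> z \<partial>(?Q \<Otimes>\<^sub>M law))"
    unfolding pair_law[OF k, symmetric] by (subst nn_integral_distr) simp_all
  also have *: "\<dots> = (\<integral>\<^sup>+x. \<integral>\<^sup>+y. \<phi> (y, x) \<partial>?Q \<partial>law)"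
    by (rule nn_integral_snd[symmetric]) (simp cong: measurable_cong_sets)
  also have "\<dots> = (\<integral>\<^sup>+x. \<integral>\<^sup>+\<omega>. \<phi> (past J \<omega>, x) \<partial>M \<partial>law)"
    by (intro nn_integral_cong nn_integral_distr) simp_all
  finally show "(\<integral>\<^sup>+\<omega>. \<phi> (past J \<omega>, X k \<omega>) \<partial>M) = (\<integral>\<^sup>+x. \<integral>\<^sup>+\<omega>. \<phi> (past J \<omega>, x) \<partial>M \<partial>law)" .
  have "(\<integral>\<^sup>+\<omega>. \<phi> (past J \<omega>, X k \<omega>) \<partial>M) = (\<integral>\<^sup>+z. \<phi> z \<partial>(?Q \<Otimes>\<^sub>M law))"
    unfolding pair_law[OF k, symmetric] by (subst nn_integral_distr) simp_all
  also have "\<dots> = (\<integral>\<^sup>+y. \<integral>\<^sup>+x. \<phi> (y, x) \<partial>law \<partial>?Q)"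
    by (rule law.nn_integral_fst[symmetric]) (simp cong: measurable_cong_sets)
  also have "\<dots> = (\<integral>\<^sup>+\<omega>. \<integral>\<^sup>+x. \<phi> (past J \<omega>, x) \<partial>law \<partial>M)"
    by (subst nn_integral_distr) simp_all
  finally show "(\<integral>\<^sup>+\<omega>. \<phi> (past J \<omega>, X k \<omega>) \<partial>M) = (\<integral>\<^sup>+\<omega>. \<integral>\<^sup>+x. \<phi> (past J \<omega>, x) \<partial>law \<partial>M)" .
qed

lemma integral_past:
  fixes \<phi> :: "_ \<Rightarrow> real"
  assumes k: "k \<notin> J" and [measurable]: "\<phi> \<in> borel_measurable (PiM J (\<lambda>_. S) \<Otimes>\<^sub>M S)"
    and int: "integrable M (\<lambda>\<omega>. \<phi> (past J \<omega>, X k \<omega>))"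
  shows "(\<integral>\<omega>. \<phi> (past J \<omega>, X k \<omega>) \<partial>M) = (\<integral>x. \<integral>\<omega>. \<phi> (past J \<omega>, x) \<partial>M \<partial>law)"
    and "(\<integral>\<omega>. \<phi> (past J \<omega>, X k \<omega>) \<partial>M) = (\<integral>\<omega>. \<integral>x. \<phi> (past J \<omega>, x) \<partial>law \<partial>M)"
    and "AE x in law. integrable M (\<lambda>\<omega>. \<phi> (past J \<omega>, x))"
    and "AE \<omega> in M. integrable law (\<lambda>x. \<phi> (past J \<omega>, x))"
    and "integrable M (\<lambda>\<omega>. \<integral>x. \<phi> (past J \<omega>, x) \<partial>law)"
    and "integrable law (\<lambda>x. \<integral>\<omega>. \<phi> (past J \<omega>, x) \<partial>M)"
proof -
  let ?Q = "distr M (PiM J (\<lambda>_. S)) (past J)"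
  interpret Q: prob_space ?Q by (rule prob_space_distr) simp
  interpret pair_sigma_finite ?Q law ..
  have [measurable]: "\<phi> \<in> borel_measurable (?Q \<Otimes>\<^sub>M law)"
    by (simp cong: measurable_cong_sets)
  have int': "integrable (?Q \<Otimes>\<^sub>M law) \<phi>"
    unfolding pair_law[OF k, symmetric] using int by (subst integrable_distr_eq) simp_all
  have eq: "(\<integral>\<omega>. \<phi> (past J \<omega>, X k \<omega>) \<partial>M) = (\<integral>z. \<phi> z \<partial>(?Q \<Otimes>\<^sub>M law))"
    unfolding pair_law[OF k, symmetric] by (subst integral_distr) simp_all
  have "(\<integral>\<omega>. \<phi> (past J \<omega>, X k \<omega>) \<partial>M) = (\<integral>x. \<integral>y. \<phi> (y, x) \<partial>?Q \<partial>law)"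
    unfolding eq using integral_snd[of "\<lambda>y x. \<phi> (y, x)"] int' by simp
  also have "\<dots> = (\<integral>x. \<integral>\<omega>. \<phi> (past J \<omega>, x) \<partial>M \<partial>law)"
    by (intro Bochner_Integration.integral_cong refl integral_distr) simp_all
  finally show "(\<integral>\<omega>. \<phi> (past J \<omega>, X k \<omega>) \<partial>M) = (\<integral>x. \<integral>\<omega>. \<phi> (past J \<omega>, x) \<partial>M \<partial>law)" .
  have "(\<integral>\<omega>. \<phi> (past J \<omega>, X k \<omega>) \<partial>M) = (\<integral>y. \<integral>x. \<phi> (y, x) \<partial>law \<partial>?Q)"
    unfolding eq using integral_fst[of "\<lambda>y x. \<phi> (y, x)"] int' by simp
  also have "\<dots> = (\<integral>\<omega>. \<integral>x. \<phi> (past J \<omega>, x) \<partial>law \<partial>M)"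
    by (intro integral_distr) simp_all
  finally show "(\<integral>\<omega>. \<phi> (past J \<omega>, X k \<omega>) \<partial>M) = (\<integral>\<omega>. \<integral>x. \<phi> (past J \<omega>, x) \<partial>law \<partial>M)" .
  have "AE x in law. integrable ?Q (\<lambda>y. \<phi> (y, x))"
    using AE_integrable_snd[of "\<lambda>y x. \<phi> (y, x)"] int' by simp
  moreover have "integrable ?Q (\<lambda>y. \<phi> (y, x)) \<longleftrightarrow> integrable M (\<lambda>\<omega>. \<phi> (past J \<omega>, x))"
    if "x \<in> space law" for x
    using that by (intro integrable_distr_eq) simp_all
  ultimately show "AE x in law. integrable M (\<lambda>\<omega>. \<phi> (past J \<omega>, x))"
    by (elim AE_mp) (auto intro!: AE_I2)
  have "AE y in ?Q. integrable law (\<lambda>x. \<phi> (y, x))"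
    using AE_integrable_fst[of "\<lambda>y x. \<phi> (y, x)"] int' by simp
  then show "AE \<omega> in M. integrable law (\<lambda>x. \<phi> (past J \<omega>, x))"
    by (rule AE_distrD[rotated]) simp
  have "integrable ?Q (\<lambda>y. \<integral>x. \<phi> (y, x) \<partial>law)"
    using integrable_fst[of "\<lambda>y x. \<phi> (y, x)"] int' by simp
  then show "integrable M (\<lambda>\<omega>. \<integral>x. \<phi> (past J \<omega>, x) \<partial>law)"
    by (subst (asm) integrable_distr_eq) simp_all
  have "integrable law (\<lambda>x. \<integral>y. \<phi> (y, x) \<partial>?Q)"
    using integrable_snd[of "\<lambda>y x. \<phi> (y, x)"] int' by simp
  also have "integrable law (\<lambda>x. \<integral>y. \<phi> (y, x) \<partial>?Q) = integrable law (\<lambda>x. \<integral>\<omega>. \<phi> (past J \<omega>, x) \<partial>M)"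
    by (intro Bochner_Integration.integrable_cong refl integral_distr) simp_all
  finally show "integrable law (\<lambda>x. \<integral>\<omega>. \<phi> (past J \<omega>, x) \<partial>M)" .
qed

section \<open>Kernels, their sections and a crude moment bound\<close>

abbreviation kernels :: "nat \<Rightarrow> ((nat \<Rightarrow> 's) \<Rightarrow> real) set" where
  "kernels d \<equiv> borel_measurable (PiM {1..d} (\<lambda>_. S))"

lemma past_upd: "past {1..Suc d} \<omega> = (past {1..d} \<omega>)(Suc d := X (Suc d) \<omega>)"
  by (auto simp: past_def fun_eq_iff)

lemma measurable_upd:
  "(\<lambda>(z, x). z(Suc d := x)) \<in> measurable (PiM {1..d} (\<lambda>_. S) \<Otimes>\<^sub>M S) (PiM {1..Suc d} (\<lambda>_. S))"
proof -
  have "{1..Suc d} = insert (Suc d) {1..d}" by auto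
  then show ?thesis using measurable_add_dim[of "Suc d" "{1..d}" "\<lambda>_. S"] by simp
qed

lemma measurable_kernel_pair:
  assumes "f \<in> kernels (Suc d)"
  shows "(\<lambda>(z, x). f (z(Suc d := x))) \<in> borel_measurable (PiM {1..d} (\<lambda>_. S) \<Otimes>\<^sub>M S)"
  using measurable_compose[OF measurable_upd assms] by (simp add: case_prod_unfold)

lemma measurable_section:
  assumes "f \<in> kernels (Suc d)" "x \<in> space S"
  shows "(\<lambda>z. f (z(Suc d := x))) \<in> kernels d"
proof -
  have "(\<lambda>z. (z, x)) \<in> measurable (PiM {1..d} (\<lambda>_. S)) (PiM {1..d} (\<lambda>_. S) \<Otimes>\<^sub>M S)"
    using assms(2) by (intro measurable_Pair measurable_ident_sets measurable_const) simp_all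
  from measurable_compose[OF this measurable_kernel_pair[OF assms(1)]] show ?thesis by simp
qed

lemma measurable_Ustat [measurable]:
  assumes [measurable]: "f \<in> kernels d"
  shows "Ustat d f X n \<in> borel_measurable M"
proof -
  have "(\<lambda>\<omega>. \<lambda>k\<in>{1..d}. X (i k) \<omega>) \<in> measurable M (PiM {1..d} (\<lambda>_. S))" for i :: "nat \<Rightarrow> nat"
    by (intro measurable_restrict) simp
  from measurable_compose[OF this assms] show ?thesis
    unfolding Ustat_alt[abs_def] by simp
qed

text \<open>Evaluating the statistic on the coordinate maps exhibits it as a function of the first n
  variables, the form to which Tonelli's and Fubini's theorems apply.\<close>

lemma Ustat_past:
  "Ustat d f X n \<omega> = Ustat d f (\<lambda>j y. y j) n (past {1..n} \<omega>)"
  unfolding Ustat_alt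
proof (intro sum.cong refl arg_cong[of _ _ f] ext)
  fix i l assume "i \<in> increasing_maps d n"
  then have "i l \<in> {1..n}" if "l \<in> {1..d}"
    using that by (auto simp: increasing_maps_def PiE_iff)
  then show "(\<lambda>k\<in>{1..d}. X (i k) \<omega>) l = (\<lambda>k\<in>{1..d}. past {1..n} \<omega> (i k)) l"
    by (simp add: past_def restrict_def del: atLeastAtMost_iff)
qed

lemma measurable_Ustat_past:
  assumes "f \<in> kernels (Suc d)"
  shows "(\<lambda>(y, x). Ustat d (\<lambda>z. f (z(Suc d := x))) (\<lambda>j y. y j) n y)
    \<in> borel_measurable (PiM {1..n} (\<lambda>_. S) \<Otimes>\<^sub>M S)"
proof -
  have "(\<lambda>yx. (\<lambda>k\<in>{1..d}. fst yx (i k), snd yx)) \<in>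
      measurable (PiM {1..n} (\<lambda>_. S) \<Otimes>\<^sub>M S) (PiM {1..d} (\<lambda>_. S) \<Otimes>\<^sub>M S)"
    if "i \<in> increasing_maps d n" for i
    using that
    by (intro measurable_Pair measurable_restrict measurable_snd
        measurable_compose[OF measurable_fst measurable_component_singleton])
       (auto simp: increasing_maps_def PiE_iff)
  from measurable_compose[OF this measurable_kernel_pair[OF assms]] show ?thesis
    unfolding Ustat_alt case_prod_unfold by (simp add: case_prod_unfold)
qed

lemma measurable_Ustat_section:
  assumes "f \<in> kernels (Suc d)"
  shows "(\<lambda>\<omega>. Ustat d (\<lambda>z. f (z(Suc d := X k \<omega>))) X n \<omega>) \<in> borel_measurable M"
proof -
  have "(\<lambda>\<omega>. (past {1..n} \<omega>, X k \<omega>)) \<in> measurable M (PiM {1..n} (\<lambda>_. S) \<Otimes>\<^sub>M S)"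
    by measurable
  from measurable_compose[OF this measurable_Ustat_past[OF assms, of n]] show ?thesis
    unfolding Ustat_past[of _ _ n] by (simp only: case_prod_conv)
qed

text \<open>An \<open>ennreal\<close> value keeps this meaningful for the sections f(., x), whose
  moments are finite only for almost every x.\<close>

definition moment :: "nat \<Rightarrow> nat \<Rightarrow> ((nat \<Rightarrow> 's) \<Rightarrow> real) \<Rightarrow> ennreal" where
  "moment p d f = abs_moment p (\<lambda>\<omega>. f (past {1..d} \<omega>))"

lemma moment_Suc:
  assumes "f \<in> kernels (Suc d)"
  shows "moment p (Suc d) f = (\<integral>\<^sup>+x. moment p d (\<lambda>z. f (z(Suc d := x))) \<partial>law)"
  using nn_integral_past(1)[of "Suc d" "{1..d}" "\<lambda>(z, x). ennreal (\<bar>f (z(Suc d := x))\<bar> ^ p)"]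
    measurable_kernel_pair[OF assms]
  by (simp add: moment_def past_upd case_prod_unfold del: One_nat_def)

lemma nn_integral_Ustat_section:
  fixes f :: "(nat \<Rightarrow> 's) \<Rightarrow> real" and c :: "'s \<Rightarrow> real"
  assumes "f \<in> kernels (Suc d)" and [measurable]: "c \<in> borel_measurable S" and "n < k"
  shows "abs_moment p (\<lambda>\<omega>. Ustat d (\<lambda>z. f (z(Suc d := X k \<omega>))) X n \<omega> - c (X k \<omega>))
    = (\<integral>\<^sup>+x. \<integral>\<^sup>+\<omega>. ennreal (\<bar>Ustat d (\<lambda>z. f (z(Suc d := x))) X n \<omega> - c x\<bar> ^ p) \<partial>M \<partial>law)"
  unfolding Ustat_past[of _ _ n]
  using nn_integral_past(1)[of k "{1..n}" "\<lambda>(y, x). ennreal (\<bar>Ustat d (\<lambda>z. f (z(Suc d := x))) (\<lambda>j y. y j) n y - c x\<bar> ^ p)"]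
    measurable_Ustat_past[OF assms(1), of n] assms(3)
  by (simp add: case_prod_unfold)

lemma measurable_section_mean:
  assumes "f \<in> kernels (Suc d)"
  shows "(\<lambda>x. \<integral>\<omega>. f ((past {1..d} \<omega>)(Suc d := x)) \<partial>M) \<in> borel_measurable S"
proof (rule borel_measurable_lebesgue_integral)
  have "(\<lambda>(x, \<omega>). (past {1..d} \<omega>, x)) \<in> measurable (S \<Otimes>\<^sub>M M) (PiM {1..d} (\<lambda>_. S) \<Otimes>\<^sub>M S)"
    by measurable
  from measurable_compose[OF this measurable_kernel_pair[OF assms]]
  show "(\<lambda>(x, \<omega>). f ((past {1..d} \<omega>)(Suc d := x))) \<in> borel_measurable (S \<Otimes>\<^sub>M M)"
    by (simp add: case_prod_unfold)
qed

lemma Umean_past: "Umean M d f X = (\<integral>\<omega>. f (past {1..d} \<omega>) \<partial>M)"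
  by (simp add: Umean_def past_def)

lemma borel_measurable_moment:
  assumes "f \<in> kernels (Suc d)"
  shows "(\<lambda>x. moment p d (\<lambda>z. f (z(Suc d := x)))) \<in> borel_measurable S"
  unfolding moment_def
proof (rule borel_measurable_nn_integral)
  have "(\<lambda>(x, \<omega>). (past {1..d} \<omega>, x)) \<in> measurable (S \<Otimes>\<^sub>M M) (PiM {1..d} (\<lambda>_. S) \<Otimes>\<^sub>M S)"
    by measurable
  from measurable_compose[OF this measurable_kernel_pair[OF assms]]
  have "(\<lambda>(x, \<omega>). f ((past {1..d} \<omega>)(Suc d := x))) \<in> borel_measurable (S \<Otimes>\<^sub>M M)"
    by (simp add: case_prod_unfold)
  then show "(\<lambda>(x, \<omega>). ennreal (\<bar>f ((past {1..d} \<omega>)(Suc d := x))\<bar> ^ p)) \<in> borel_measurable (S \<Otimes>\<^sub>M M)"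
    by (simp add: case_prod_unfold)
qed

text \<open>Conditionally on X_k = x the kernel is the fixed section f(., x), to which a bound for
  kernels of order d applies for almost every x. As the bound is linear in the moment of the
  section, integration over x turns it into the moment of f. The constant c is 0 for plain
  statistics and a binomial coefficient for deviations.\<close>

lemma section_bound:
  assumes f: "f \<in> kernels (Suc d)" and "n < k" and fin: "moment p (Suc d) f < \<infinity>"
    and bound: "\<And>F. F \<in> kernels d \<Longrightarrow> moment p d F < \<infinity> \<Longrightarrow>
      abs_moment p (\<lambda>\<omega>. Ustat d F X n \<omega> - c * Umean M d F X) \<le> C * moment p d F"
  shows "abs_moment p (\<lambda>\<omega>. Ustat d (\<lambda>z. f (z(Suc d := X k \<omega>))) X n \<omega> - c * Umean M d (\<lambda>z. f (z(Suc d := X k \<omega>))) X) \<le> C * moment p (Suc d) f"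
proof -
  note [measurable] = borel_measurable_moment[OF f] measurable_section_mean[OF f]
  have "abs_moment p (\<lambda>\<omega>. Ustat d (\<lambda>z. f (z(Suc d := X k \<omega>))) X n \<omega> - c * Umean M d (\<lambda>z. f (z(Suc d := X k \<omega>))) X)
    = (\<integral>\<^sup>+x. \<integral>\<^sup>+\<omega>. ennreal (\<bar>Ustat d (\<lambda>z. f (z(Suc d := x))) X n \<omega>
      - c * Umean M d (\<lambda>z. f (z(Suc d := x))) X\<bar> ^ p) \<partial>M \<partial>law)"
    unfolding Umean_past by (rule nn_integral_Ustat_section[OF f _ \<open>n < k\<close>]) measurable
  also have "\<dots> \<le> (\<integral>\<^sup>+x. C * moment p d (\<lambda>z. f (z(Suc d := x))) \<partial>law)"
  proof (rule nn_integral_mono_AE)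
    have "AE x in law. moment p d (\<lambda>z. f (z(Suc d := x))) \<noteq> \<infinity>"
      using fin unfolding moment_Suc[OF f] by (intro nn_integral_PInf_AE) auto
    then show "AE x in law. abs_moment p (\<lambda>\<omega>. Ustat d (\<lambda>z. f (z(Suc d := x))) X n \<omega> - c * Umean M d (\<lambda>z. f (z(Suc d := x))) X) \<le> C * moment p d (\<lambda>z. f (z(Suc d := x)))"
      using AE_space by eventually_elim (auto intro!: bound measurable_section[OF f] simp: less_top)
  qed
  also have "\<dots> = C * moment p (Suc d) f"
    unfolding moment_Suc[OF f] by (rule nn_integral_cmult) measurable
  finally show ?thesis .
qed

text \<open>There are at most n^d tuples and no cancellation is used. Peeling off the largest index
  lets \<open>section_bound\<close> do the comparison of laws that a treatment tuple by tuple would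
  require.\<close>

lemma Ustat_crude_bound:
  assumes "f \<in> kernels d" "1 \<le> p" "moment p d f < \<infinity>"
  shows "abs_moment p (Ustat d f X n) \<le> ennreal (real n ^ (d * p)) * moment p d f"
  using assms(1,3)
proof (induction d arbitrary: f n)
  case 0
  then show ?case by (simp add: Ustat_0 moment_def past_def restrict_def)
next
  case (Suc d)
  define W where "W k \<omega> = Ustat d (\<lambda>z. f (z(Suc d := X k \<omega>))) X (k - 1) \<omega>" for k \<omega>
  have [measurable]: "W k \<in> borel_measurable M" for k
    unfolding W_def by (rule measurable_Ustat_section[OF Suc.prems(1)])
  have "abs_moment p (\<lambda>\<omega>. Ustat (Suc d) f X n \<omega>) \<le>
    (\<integral>\<^sup>+\<omega>. ennreal (real n ^ (p - 1)) * (\<Sum>k=1..n. ennreal (\<bar>W k \<omega>\<bar> ^ p)) \<partial>M)"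
  proof (rule nn_integral_mono)
    fix \<omega>
    show "ennreal (\<bar>Ustat (Suc d) f X n \<omega>\<bar> ^ p) \<le> ennreal (real n ^ (p - 1)) * (\<Sum>k=1..n. ennreal (\<bar>W k \<omega>\<bar> ^ p))"
      using abs_sum_power_le[OF assms(2), of "\<lambda>k. W k \<omega>" "{1..n}"]
      by (simp add: W_def Ustat_Suc sum_nonneg ennreal_mult[symmetric] ennreal_leI)
  qed
  also have "\<dots> = ennreal (real n ^ (p - 1)) * (\<Sum>k=1..n. \<integral>\<^sup>+\<omega>. ennreal (\<bar>W k \<omega>\<bar> ^ p) \<partial>M)"
    by (subst nn_integral_cmult) (auto simp: nn_integral_sum simp del: sum_ennreal)
  also have "\<dots> \<le> ennreal (real n ^ (p - 1)) * (\<Sum>k=1..n. ennreal (real n ^ (d * p)) * moment p (Suc d) f)"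
  proof (intro mult_left_mono sum_mono)
    fix k assume k: "k \<in> {1..n}"
    \<comment> \<open>The null multiple of the mean only brings the expression into the form of
      \<open>section_bound\<close> with c = 0.\<close>
    have "abs_moment p (\<lambda>\<omega>. W k \<omega> - 0 * Umean M d (\<lambda>z. f (z(Suc d := X k \<omega>))) X)
      \<le> ennreal (real n ^ (d * p)) * moment p (Suc d) f"
      unfolding W_def
    proof (rule section_bound[OF Suc.prems(1) _ Suc.prems(2)])
      fix F assume F: "F \<in> kernels d" "moment p d F < \<infinity>"
      have "abs_moment p (\<lambda>\<omega>. Ustat d F X (k - 1) \<omega>) \<le> ennreal (real (k - 1) ^ (d * p)) * moment p d F"
        by (rule Suc.IH[OF F])
      also have "\<dots> \<le> ennreal (real n ^ (d * p)) * moment p d F"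
        using k by (intro mult_right_mono ennreal_leI power_mono) auto
      finally show "abs_moment p (\<lambda>\<omega>. Ustat d F X (k - 1) \<omega> - 0 * Umean M d F X)
        \<le> ennreal (real n ^ (d * p)) * moment p d F" by simp
    qed (use k in auto)
    then show "abs_moment p (W k) \<le> ennreal (real n ^ (d * p)) * moment p (Suc d) f"
      by simp
  qed simp
  also have "\<dots> = ennreal (real n ^ (p - 1) * (real n * real n ^ (d * p))) * moment p (Suc d) f"
    by (simp add: ennreal_mult ennreal_of_nat_eq_real_of_nat mult.assoc)
  also have "real n ^ (p - 1) * (real n * real n ^ (d * p)) = real n ^ (Suc d * p)"
    using assms(2) by (cases p) (simp_all add: power_add)
  finally show ?case .
qed

end

text \<open>Otherwise \<open>{1..d}\<close> is rewritten to \<open>{Suc 0..d}\<close>, which hides the index sets from the measurability prover.\<close>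

declare One_nat_def [simp del]

section \<open>Moment bounds for U-statistics\<close>

lemma abs_diff_power_le:
  fixes a b :: real
  shows "\<bar>a - b\<bar> ^ p \<le> 2 ^ p * (\<bar>a\<bar> ^ p + \<bar>b\<bar> ^ p)"
proof -
  have "\<bar>a - b\<bar> ^ p \<le> (2 * max \<bar>a\<bar> \<bar>b\<bar>) ^ p"
    by (intro power_mono) auto
  also have "\<dots> \<le> 2 ^ p * (\<bar>a\<bar> ^ p + \<bar>b\<bar> ^ p)"
    by (auto simp: power_mult_distrib max_def)
  finally show ?thesis .
qed

context iid_sequence
begin

text \<open>The conditional expectation of f given the first d of its d + 1 coordinates. The last
  coordinate is singled out because it carries the largest index of a tuple.\<close>

definition average :: "nat \<Rightarrow> ((nat \<Rightarrow> 's) \<Rightarrow> real) \<Rightarrow> (nat \<Rightarrow> 's) \<Rightarrow> real" where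
  "average d f z = (\<integral>x. f (z(Suc d := x)) \<partial>law)"

text \<open>The part of f that averages to zero in the last coordinate, which makes its sum over
  largest indices a martingale. The restriction is there because \<open>average d f\<close> expects
  a point of S^d.\<close>

definition centre :: "nat \<Rightarrow> ((nat \<Rightarrow> 's) \<Rightarrow> real) \<Rightarrow> (nat \<Rightarrow> 's) \<Rightarrow> real" where
  "centre d f z = f z - average d f (restrict z {1..d})"

definition Udev :: "nat \<Rightarrow> ((nat \<Rightarrow> 's) \<Rightarrow> real) \<Rightarrow> nat \<Rightarrow> 'a \<Rightarrow> real" where
  "Udev d f n \<omega> = Ustat d f X n \<omega> - real (n choose d) * Umean M d f X"

lemma average_kernel: "f \<in> kernels (Suc d) \<Longrightarrow> average d f \<in> kernels d"
  unfolding average_def[abs_def]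
  by (intro law.borel_measurable_lebesgue_integral)
     (drule measurable_kernel_pair, simp cong: measurable_cong_sets)

lemma centre_kernel:
  assumes [measurable]: "f \<in> kernels (Suc d)"
  shows "centre d f \<in> kernels (Suc d)"
proof -
  note [measurable] = average_kernel[OF assms]
  have [measurable]: "(\<lambda>z. restrict z {1..d}) \<in> measurable (PiM {1..Suc d} (\<lambda>_. S)) (PiM {1..d} (\<lambda>_. S))"
    by (intro measurable_restrict_subset) auto
  show ?thesis unfolding centre_def[abs_def] by measurable
qed

lemma Ustat_centre:
  "Ustat d (\<lambda>z. centre d f (z(Suc d := x))) X n \<omega>
    = Ustat d (\<lambda>z. f (z(Suc d := x))) X n \<omega> - Ustat d (average d f) X n \<omega>"
proof -
  have "restrict ((\<lambda>k\<in>{1..d}. X (i k) \<omega>)(Suc d := x)) {1..d} = (\<lambda>k\<in>{1..d}. X (i k) \<omega>)" for i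
    by (auto simp: restrict_def fun_eq_iff)
  then show ?thesis
    unfolding Ustat_alt centre_def by (simp add: sum_subtractf)
qed

lemma moment_average:
  assumes f: "f \<in> kernels (Suc d)" and p: "1 \<le> p"
  shows "moment p d (average d f) \<le> moment p (Suc d) f"
proof -
  note [measurable] = measurable_kernel_pair[OF f]
  have "moment p d (average d f) \<le> (\<integral>\<^sup>+\<omega>. \<integral>\<^sup>+x. ennreal (\<bar>f ((past {1..d} \<omega>)(Suc d := x))\<bar> ^ p) \<partial>law \<partial>M)"
    unfolding moment_def average_def
  proof (intro nn_integral_mono law.jensen_power p)
    fix \<omega> assume "\<omega> \<in> space M"
    then have "past {1..d} \<omega> \<in> space (PiM {1..d} (\<lambda>_. S))"
      by (rule measurable_space[OF measurable_past])
    from measurable_Pair2[OF measurable_kernel_pair[OF f] this]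
    show "(\<lambda>x. f ((past {1..d} \<omega>)(Suc d := x))) \<in> borel_measurable law"
      by (simp cong: measurable_cong_sets)
  qed
  also have "\<dots> = moment p (Suc d) f"
    using nn_integral_past(2)[of "Suc d" "{1..d}" "\<lambda>(z, x). ennreal (\<bar>f (z(Suc d := x))\<bar> ^ p)"]
    by (simp add: moment_def past_upd case_prod_unfold del: One_nat_def)
  finally show ?thesis .
qed

lemma moment_centre:
  assumes f: "f \<in> kernels (Suc d)" and p: "1 \<le> p"
  shows "moment p (Suc d) (centre d f) \<le> ennreal (2 * 2 ^ p) * moment p (Suc d) f"
proof -
  note [measurable] = f average_kernel[OF f]
  have r: "restrict (past {1..Suc d} \<omega>) {1..d} = past {1..d} \<omega>" for \<omega>
    by (auto simp: past_def restrict_def fun_eq_iff)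
  have "moment p (Suc d) (centre d f) \<le>
      (\<integral>\<^sup>+\<omega>. ennreal (2 ^ p) * (ennreal (\<bar>f (past {1..Suc d} \<omega>)\<bar> ^ p)
        + ennreal (\<bar>average d f (past {1..d} \<omega>)\<bar> ^ p)) \<partial>M)"
    unfolding moment_def centre_def r
    by (intro nn_integral_mono)
       (auto intro!: ennreal_leI abs_diff_power_le simp: ennreal_mult[symmetric] ennreal_plus[symmetric] simp del: ennreal_plus)
  also have "\<dots> = ennreal (2 ^ p) * (moment p (Suc d) f + moment p d (average d f))"
    unfolding moment_def by (subst nn_integral_cmult) (auto simp: nn_integral_add simp del: ennreal_plus)
  also have "\<dots> \<le> ennreal (2 ^ p) * (moment p (Suc d) f + moment p (Suc d) f)"
    by (intro mult_left_mono add_left_mono moment_average[OF f p]) simp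
  also have "\<dots> = ennreal (2 * 2 ^ p) * moment p (Suc d) f"
    by (simp add: ennreal_mult mult_2[symmetric] mult_ac)
  finally show ?thesis .
qed

lemma moment_finite_integrable:
  assumes [measurable]: "f \<in> kernels d" and "1 \<le> p" "moment p d f < \<infinity>"
  shows "integrable M (\<lambda>\<omega>. f (past {1..d} \<omega>))"
proof (rule Bochner_Integration.integrable_bound)
  have "integrable M (\<lambda>\<omega>. \<bar>f (past {1..d} \<omega>)\<bar> ^ p)"
    using assms(3) by (intro integrableI_nonneg) (auto simp: moment_def)
  then show "integrable M (\<lambda>\<omega>. 1 + \<bar>f (past {1..d} \<omega>)\<bar> ^ p)" by simp
  show "AE \<omega> in M. norm (f (past {1..d} \<omega>)) \<le> norm (1 + \<bar>f (past {1..d} \<omega>)\<bar> ^ p)"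
  proof (rule AE_I2)
    fix \<omega>
    have "a \<le> 1 + a ^ p" if "0 \<le> a" for a :: real
    proof (cases "a \<le> 1")
      case False
      then have "a ^ 1 \<le> a ^ p" using assms(2) by (intro power_increasing) auto
      then show ?thesis by simp
    qed (use that in \<open>simp add: add_increasing2\<close>)
    from this[of "\<bar>f (past {1..d} \<omega>)\<bar>"]
    show "norm (f (past {1..d} \<omega>)) \<le> norm (1 + \<bar>f (past {1..d} \<omega>)\<bar> ^ p)" by simp
  qed
qed measurable

lemma Umean_average:
  assumes f: "f \<in> kernels (Suc d)" and int: "integrable M (\<lambda>\<omega>. f (past {1..Suc d} \<omega>))"
  shows "Umean M d (average d f) X = Umean M (Suc d) f X"
  using integral_past(2)[of "Suc d" "{1..d}" "\<lambda>(z, x). f (z(Suc d := x))"] measurable_kernel_pair[OF f] int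
  by (simp add: Umean_past past_upd average_def case_prod_unfold del: One_nat_def)

lemma Udev_0 [simp]: "Udev 0 f n \<omega> = 0"
  by (simp add: Udev_def Ustat_0 Umean_past past_def restrict_def prob_space)

lemma Udev_at_0: "1 \<le> d \<Longrightarrow> Udev d f 0 \<omega> = 0"
  by (cases d) (simp_all add: Udev_def Ustat_Suc)

text \<open>The martingale part plus deviations of one order less. The centrings agree because
  averaging preserves the mean and the binomial coefficients of order d add up to a difference of
  those of order d + 1.\<close>

lemma Udev_increment:
  assumes f: "f \<in> kernels (Suc d)" and int: "integrable M (\<lambda>\<omega>. f (past {1..Suc d} \<omega>))" and "n \<le> m"
  shows "Udev (Suc d) f m \<omega> - Udev (Suc d) f n \<omega> =
    (\<Sum>k=n+1..m. Ustat d (\<lambda>z. centre d f (z(Suc d := X k \<omega>))) X (k - 1) \<omega>)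
    + (\<Sum>k=n+1..m. Udev d (average d f) (k - 1) \<omega>)"
proof -
  have "{1..m} = {1..n} \<union> {n+1..m}" using \<open>n \<le> m\<close> by auto
  then have "Ustat (Suc d) f X m \<omega> - Ustat (Suc d) f X n \<omega>
      = (\<Sum>k=n+1..m. Ustat d (\<lambda>z. f (z(Suc d := X k \<omega>))) X (k - 1) \<omega>)"
    by (simp add: Ustat_Suc sum.union_disjoint del: One_nat_def)
  moreover have "real (m choose Suc d) - real (n choose Suc d) = (\<Sum>k=n+1..m. real ((k - 1) choose d))"
    using sum_choose_shift[OF \<open>n \<le> m\<close>, of d] binomial_right_mono[OF \<open>n \<le> m\<close>, of "Suc d"]
    by (simp add: of_nat_sum[symmetric] of_nat_diff del: of_nat_sum)
  then have "real (m choose Suc d) * \<mu> - real (n choose Suc d) * \<mu> = (\<Sum>k=n+1..m. real ((k - 1) choose d) * \<mu>)" for \<mu>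
    by (simp add: left_diff_distrib[symmetric] sum_distrib_right[symmetric])
  then have "real (m choose Suc d) * Umean M (Suc d) f X - real (n choose Suc d) * Umean M (Suc d) f X
      = (\<Sum>k=n+1..m. real ((k - 1) choose d) * Umean M (Suc d) f X)" .
  ultimately show ?thesis
    unfolding Udev_def Ustat_centre Umean_average[OF f int] sum_subtractf by linarith
qed

text \<open>Only almost every past makes f integrable in the last coordinate. A single null set
  serves all tuples, since the statistic of |f| dominates each summand and has finite expectation by
  the crude bound with p = 1; there X_(n+1) serves as a fresh variable independent of X_1, ...,
  X_n.\<close>

lemma AE_average_centre:
  assumes f: "f \<in> kernels (Suc d)" and fin: "moment 1 (Suc d) f < \<infinity>"
  shows "AE \<omega> in M. integrable law (\<lambda>x. Ustat d (\<lambda>z. centre d f (z(Suc d := x))) X n \<omega>) \<and>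
    (\<integral>x. Ustat d (\<lambda>z. centre d f (z(Suc d := x))) X n \<omega> \<partial>law) = 0"
proof -
  note [measurable] = f measurable_kernel_pair[OF f]
  let ?F = "\<lambda>z. \<bar>f z\<bar>"
  have F: "?F \<in> kernels (Suc d)" by measurable
  have finF: "moment 1 (Suc d) ?F < \<infinity>" using fin by (simp add: moment_def)
  have "abs_moment 1 (\<lambda>\<omega>. Ustat d (\<lambda>z. ?F (z(Suc d := X (Suc n) \<omega>))) X n \<omega> - 0 * Umean M d (\<lambda>z. ?F (z(Suc d := X (Suc n) \<omega>))) X)
      \<le> ennreal (real n ^ (d * 1)) * moment 1 (Suc d) ?F"
    by (rule section_bound[OF F _ finF]) (use Ustat_crude_bound[of _ d 1] in auto)
  also have "\<dots> < \<infinity>"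
    using finF by (simp add: ennreal_mult_less_top)
  finally have fin1: "(\<integral>\<^sup>+\<omega>. ennreal \<bar>Ustat d (\<lambda>z. ?F (z(Suc d := X (Suc n) \<omega>))) X n \<omega>\<bar> \<partial>M) < \<infinity>"
    by (simp del: fun_upd_apply)
  let ?G = "\<lambda>(y, x). ennreal \<bar>Ustat d (\<lambda>z. ?F (z(Suc d := x))) (\<lambda>j y. y j) n y\<bar>"
  note [measurable] = measurable_Ustat_past[OF F, of n]
  have G: "?G \<in> borel_measurable (PiM {1..n} (\<lambda>_. S) \<Otimes>\<^sub>M S)"
    using measurable_Ustat_past[OF F, of n] by (simp add: case_prod_unfold del: fun_upd_apply)
  have "(\<integral>\<^sup>+\<omega>. \<integral>\<^sup>+x. ?G (past {1..n} \<omega>, x) \<partial>law \<partial>M) < \<infinity>"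
    using fin1 unfolding Ustat_past[of _ _ n]
    by (subst nn_integral_past(2)[of "Suc n" "{1..n}" ?G, OF _ G, symmetric]) (auto simp del: fun_upd_apply)
  moreover have "(\<lambda>\<omega>. \<integral>\<^sup>+x. ?G (past {1..n} \<omega>, x) \<partial>law) \<in> borel_measurable M"
    using G by (intro law.borel_measurable_nn_integral) (simp add: case_prod_unfold cong: measurable_cong_sets)
  ultimately have "AE \<omega> in M. (\<integral>\<^sup>+x. ?G (past {1..n} \<omega>, x) \<partial>law) \<noteq> \<infinity>"
    by (intro nn_integral_PInf_AE) auto
  then show ?thesis
    using AE_space
  proof eventually_elim
    case (elim \<omega>)
    define z where "z i = (\<lambda>k\<in>{1..d}. X (i k) \<omega>)" for i
    have z: "z i \<in> space (PiM {1..d} (\<lambda>_. S))" for i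
      using measurable_space[OF measurable_X elim(2)] by (auto simp: z_def space_PiM)
    have meas: "(\<lambda>x. f ((z i)(Suc d := x))) \<in> borel_measurable law" for i
      using measurable_Pair2[OF measurable_kernel_pair[OF f] z[of i]]
      by (simp cong: measurable_cong_sets)
    have int: "integrable law (\<lambda>x. f ((z i)(Suc d := x)))" if i: "i \<in> increasing_maps d n" for i
    proof (rule integrableI_bounded[OF meas])
      have "(\<integral>\<^sup>+x. ennreal (norm (f ((z i)(Suc d := x)))) \<partial>law) \<le> (\<integral>\<^sup>+x. ?G (past {1..n} \<omega>, x) \<partial>law)"
      proof (rule nn_integral_mono)
        fix x
        have "\<bar>f ((z i)(Suc d := x))\<bar> \<le> (\<Sum>i\<in>increasing_maps d n. \<bar>f ((z i)(Suc d := x))\<bar>)"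
          using i by (intro member_le_sum) auto
        also have "\<dots> = Ustat d (\<lambda>z. ?F (z(Suc d := x))) (\<lambda>j y. y j) n (past {1..n} \<omega>)"
          unfolding Ustat_past[of _ _ n, symmetric] by (simp add: Ustat_alt z_def)
        finally show "ennreal (norm (f ((z i)(Suc d := x)))) \<le> ?G (past {1..n} \<omega>, x)"
          by (auto intro: ennreal_leI)
      qed
      with elim(1) show "(\<integral>\<^sup>+x. ennreal (norm (f ((z i)(Suc d := x)))) \<partial>law) < \<infinity>"
        by (simp add: less_top top.extremum_unique)
    qed
    have eq: "Ustat d (\<lambda>z. centre d f (z(Suc d := x))) X n \<omega>
        = (\<Sum>i\<in>increasing_maps d n. f ((z i)(Suc d := x)) - average d f (z i))" for x
      unfolding Ustat_centre by (simp add: Ustat_alt z_def sum_subtractf)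
    have 1: "integrable law (\<lambda>x. Ustat d (\<lambda>z. centre d f (z(Suc d := x))) X n \<omega>)"
      unfolding eq using int by simp
    have "(\<integral>x. Ustat d (\<lambda>z. centre d f (z(Suc d := x))) X n \<omega> \<partial>law)
        = (\<integral>x. (\<Sum>i\<in>increasing_maps d n. f ((z i)(Suc d := x)) - average d f (z i)) \<partial>law)"
      unfolding eq ..
    also have "\<dots> = (\<Sum>i\<in>increasing_maps d n. (\<integral>x. f ((z i)(Suc d := x)) \<partial>law) - average d f (z i))"
      using int by (subst Bochner_Integration.integral_sum) (auto simp: law.prob_space[unfolded space_law])
    also have "\<dots> = 0" by (simp add: average_def)
    finally show ?case using 1 by blast
  qed
qed

text \<open>Fubini's theorem integrates the fresh variable first, and the factor that depends on the
  past leaves the inner integral.\<close>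

lemma orthogonal_to_past:
  fixes \<Phi> :: "(nat \<Rightarrow> 's) \<Rightarrow> real" and \<Psi> :: "(nat \<Rightarrow> 's) \<times> 's \<Rightarrow> real"
  assumes k: "k \<notin> J" and [measurable]: "\<Phi> \<in> borel_measurable (PiM J (\<lambda>_. S))"
    "\<Psi> \<in> borel_measurable (PiM J (\<lambda>_. S) \<Otimes>\<^sub>M S)"
    and int: "integrable M (\<lambda>\<omega>. \<Phi> (past J \<omega>) * \<Psi> (past J \<omega>, X k \<omega>))"
    and zero: "AE \<omega> in M. (\<integral>x. \<Psi> (past J \<omega>, x) \<partial>law) = 0"
  shows "(\<integral>\<omega>. \<Phi> (past J \<omega>) * \<Psi> (past J \<omega>, X k \<omega>) \<partial>M) = 0"
proof -
  have m: "(\<lambda>p. \<Phi> (fst p) * \<Psi> p) \<in> borel_measurable (PiM J (\<lambda>_. S) \<Otimes>\<^sub>M S)" by measurable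
  have "(\<integral>\<omega>. \<Phi> (past J \<omega>) * \<Psi> (past J \<omega>, X k \<omega>) \<partial>M)
      = (\<integral>\<omega>. \<integral>x. \<Phi> (past J \<omega>) * \<Psi> (past J \<omega>, x) \<partial>law \<partial>M)"
    using integral_past(2)[OF k m] int by simp
  also have "\<dots> = (\<integral>\<omega>. 0 \<partial>M)"
  proof (rule integral_cong_AE)
    show "(\<lambda>\<omega>. \<integral>x. \<Phi> (past J \<omega>) * \<Psi> (past J \<omega>, x) \<partial>law) \<in> borel_measurable M"
      using integral_past(5)[OF k m] int by (auto intro: borel_measurable_integrable)
  qed (use zero in \<open>auto elim: AE_mp\<close>)
  finally show ?thesis by simp
qed

text \<open>Partial sums are functions of the past, so \<open>orthogonal_to_past\<close> supplies
  the orthogonality in the martingale bound. The block from n + 1 to m is reindexed to start at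
  0.\<close>

lemma past_sum_moment_bound:
  fixes \<Psi> :: "nat \<Rightarrow> (nat \<Rightarrow> 's) \<times> 's \<Rightarrow> real"
  assumes q: "1 \<le> q" and \<delta>: "0 \<le> \<delta>"
    and \<Psi>: "\<And>k. \<Psi> k \<in> borel_measurable (PiM {1..k - 1} (\<lambda>_. S) \<Otimes>\<^sub>M S)"
    and zero: "\<And>k. AE \<omega> in M. (\<integral>x. \<Psi> k (past {1..k - 1} \<omega>, x) \<partial>law) = 0"
    and bound: "\<And>k. k \<in> {n+1..m} \<Longrightarrow>
      abs_moment (2 * q) (\<lambda>\<omega>. \<Psi> k (past {1..k - 1} \<omega>, X k \<omega>)) \<le> ennreal \<delta>"
  shows "abs_moment (2 * q) (\<lambda>\<omega>. \<Sum>k=n+1..m. \<Psi> k (past {1..k - 1} \<omega>, X k \<omega>))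
    \<le> ennreal (exp (2 ^ (2 * q)) * 2 * 2 ^ (2 * q) * real (m - n) ^ q * \<delta>)"
proof -
  define D where "D l \<omega> = \<Psi> (n + 1 + l) (past {1..n + l} \<omega>, X (n + 1 + l) \<omega>)" for l \<omega>
  note [measurable] = \<Psi>
  have D_eq: "D l \<omega> = \<Psi> (n + 1 + l) (past {1..n + 1 + l - 1} \<omega>, X (n + 1 + l) \<omega>)" for l \<omega>
    by (simp add: D_def)
  have [measurable]: "D l \<in> borel_measurable M" for l
    unfolding D_eq[abs_def] by measurable
  have eq: "(\<Sum>k=n+1..m. \<Psi> k (past {1..k - 1} \<omega>, X k \<omega>)) = (\<Sum>l<m - n. D l \<omega>)" for \<omega>
    by (rule sum.reindex_bij_witness[of _ "\<lambda>l. n + 1 + l" "\<lambda>k. k - (n + 1)"])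
       (auto simp: D_def)
  have "(\<integral>\<^sup>+\<omega>. ennreal ((\<Sum>l<m - n. D l \<omega>) ^ (2 * q)) \<partial>M)
    \<le> ennreal (exp (2 ^ (2 * q)) * 2 * 2 ^ (2 * q) * real (m - n) ^ q * \<delta>)"
  proof (rule martingale_moment_bound[OF q \<delta>])
    fix l assume l: "l < m - n"
    show "(\<integral>\<^sup>+\<omega>. ennreal (D l \<omega> ^ (2 * q)) \<partial>M) \<le> ennreal \<delta>"
      using bound[of "n + 1 + l"] l by (simp add: D_def power_even_abs)
    assume int: "integrable M (\<lambda>\<omega>. (\<Sum>j<l. D j \<omega>) ^ (2 * q - 1) * D l \<omega>)"
    \<comment> \<open>The power of the partial sum as a function of the whole past: each earlier
      increment reads off its own shorter past, hence the restrictions.\<close>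
    define \<Phi> where "\<Phi> y = (\<Sum>j<l. \<Psi> (n + 1 + j) (restrict y {1..n + 1 + j - 1}, y (n + 1 + j))) ^ (2 * q - 1)" for y
    have \<Phi>: "(\<Sum>j<l. D j \<omega>) ^ (2 * q - 1) = \<Phi> (past {1..n + 1 + l - 1} \<omega>)" for \<omega>
    proof -
      have "restrict (past {1..n + 1 + l - 1} \<omega>) {1..n + j} = past {1..n + j} \<omega>"
        "past {1..n + 1 + l - 1} \<omega> (n + 1 + j) = X (n + 1 + j) \<omega>" if "j < l" for j
        using that by (auto simp: past_def restrict_def fun_eq_iff)
      then show ?thesis by (simp add: \<Phi>_def D_def)
    qed
    have \<Phi>_meas: "\<Phi> \<in> borel_measurable (PiM {1..n + 1 + l - 1} (\<lambda>_. S))"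
      unfolding \<Phi>_def[abs_def]
    proof (intro borel_measurable_power borel_measurable_sum)
      fix j assume "j \<in> {..<l}"
      then show "(\<lambda>y. \<Psi> (n + 1 + j) (restrict y {1..n + 1 + j - 1}, y (n + 1 + j)))
          \<in> borel_measurable (PiM {1..n + 1 + l - 1} (\<lambda>_. S))"
        by (intro measurable_compose[OF _ \<Psi>] measurable_Pair measurable_restrict_subset
            measurable_component_singleton) auto
    qed
    show "(\<integral>\<omega>. (\<Sum>j<l. D j \<omega>) ^ (2 * q - 1) * D l \<omega> \<partial>M) = 0"
      using int unfolding \<Phi> unfolding D_eq
      by (intro orthogonal_to_past[OF _ \<Phi>_meas \<Psi>] zero) auto
  qed measurable
  then show ?thesis by (simp only: eq power_even_abs even_mult_iff even_numeral simp_thms)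
qed

lemma sum_moment_bound:
  assumes p: "1 \<le> p" and [measurable]: "\<And>k. Y k \<in> borel_measurable M" and B: "0 \<le> B"
    and bound: "\<And>k. k \<in> {n+1..m} \<Longrightarrow> abs_moment p (Y k) \<le> ennreal B"
  shows "abs_moment p (\<lambda>\<omega>. \<Sum>k=n+1..m. Y k \<omega>) \<le> ennreal (real (m - n) ^ p * B)"
proof -
  have "abs_moment p (\<lambda>\<omega>. \<Sum>k=n+1..m. Y k \<omega>)
    \<le> (\<integral>\<^sup>+\<omega>. ennreal (real (m - n) ^ (p - 1)) * (\<Sum>k=n+1..m. ennreal (\<bar>Y k \<omega>\<bar> ^ p)) \<partial>M)"
  proof (rule nn_integral_mono)
    fix \<omega>
    show "ennreal (\<bar>\<Sum>k=n+1..m. Y k \<omega>\<bar> ^ p) \<le> ennreal (real (m - n) ^ (p - 1)) * (\<Sum>k=n+1..m. ennreal (\<bar>Y k \<omega>\<bar> ^ p))"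
      using abs_sum_power_le[OF p, of "\<lambda>k. Y k \<omega>" "{n+1..m}"]
      by (simp add: sum_nonneg ennreal_mult[symmetric] ennreal_leI)
  qed
  also have "\<dots> = ennreal (real (m - n) ^ (p - 1)) * (\<Sum>k=n+1..m. \<integral>\<^sup>+\<omega>. ennreal (\<bar>Y k \<omega>\<bar> ^ p) \<partial>M)"
    by (subst nn_integral_cmult) (auto simp: nn_integral_sum simp del: sum_ennreal)
  also have "\<dots> \<le> ennreal (real (m - n) ^ (p - 1)) * (\<Sum>k=n+1..m. ennreal B)"
    by (intro mult_left_mono sum_mono bound) auto
  also have "\<dots> = ennreal (real (m - n) ^ (p - 1) * (real (m - n) * B))"
    using B by (simp add: ennreal_mult[symmetric] ennreal_of_nat_eq_real_of_nat)
  also have "real (m - n) ^ (p - 1) * (real (m - n) * B) = real (m - n) ^ p * B"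
    using p by (cases p) auto
  finally show ?thesis .
qed

lemma add_moment_bound:
  assumes [measurable]: "Y \<in> borel_measurable M" "Z \<in> borel_measurable M" and "0 \<le> a" "0 \<le> b"
    and "abs_moment p Y \<le> ennreal a" "abs_moment p Z \<le> ennreal b"
  shows "abs_moment p (\<lambda>\<omega>. Y \<omega> + Z \<omega>) \<le> ennreal (2 ^ p * (a + b))"
proof -
  have "abs_moment p (\<lambda>\<omega>. Y \<omega> + Z \<omega>)
    \<le> (\<integral>\<^sup>+\<omega>. ennreal (2 ^ p) * (ennreal (\<bar>Y \<omega>\<bar> ^ p) + ennreal (\<bar>Z \<omega>\<bar> ^ p)) \<partial>M)"
  proof (rule nn_integral_mono)
    fix \<omega>
    show "ennreal (\<bar>Y \<omega> + Z \<omega>\<bar> ^ p) \<le> ennreal (2 ^ p) * (ennreal (\<bar>Y \<omega>\<bar> ^ p) + ennreal (\<bar>Z \<omega>\<bar> ^ p))"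
      using abs_diff_power_le[of "Y \<omega>" "- Z \<omega>" p]
      by (simp add: ennreal_mult[symmetric] ennreal_plus[symmetric] ennreal_leI del: ennreal_plus)
  qed
  also have "\<dots> = ennreal (2 ^ p) * (abs_moment p Y + abs_moment p Z)"
    by (subst nn_integral_cmult) (auto simp: nn_integral_add simp del: ennreal_plus)
  also have "\<dots> \<le> ennreal (2 ^ p) * (ennreal a + ennreal b)"
    using assms by (intro mult_left_mono add_mono) auto
  also have "\<dots> = ennreal (2 ^ p * (a + b))"
    using assms by (simp add: ennreal_mult[symmetric] ennreal_plus[symmetric] del: ennreal_plus)
  finally show ?thesis .
qed

lemma measurable_Udev [measurable]: "f \<in> kernels d \<Longrightarrow> Udev d f n \<in> borel_measurable M"
  unfolding Udev_def[abs_def] by (intro borel_measurable_diff measurable_Ustat borel_measurable_const)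

lemma measurable_centre_section [measurable]:
  assumes "f \<in> kernels (Suc d)"
  shows "(\<lambda>\<omega>. Ustat d (\<lambda>z. centre d f (z(Suc d := X k \<omega>))) X n \<omega>) \<in> borel_measurable M"
  by (rule measurable_Ustat_section[OF centre_kernel[OF assms]])

lemma moment_one_finite:
  assumes f: "f \<in> kernels d" and "1 \<le> p" "moment p d f < \<infinity>"
  shows "moment 1 d f < \<infinity>"
  using moment_finite_integrable[OF assms] unfolding integrable_iff_bounded by (simp add: moment_def)

lemma Udev_moment_bound:
  assumes q: "1 \<le> q"
  shows "\<exists>C\<ge>0. \<forall>f\<in>kernels d. moment (2 * q) d f < \<infinity> \<longrightarrow> (\<forall>n m. n \<le> m \<longrightarrow>
    abs_moment (2 * q) (\<lambda>\<omega>. Udev d f m \<omega> - Udev d f n \<omega>)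
      \<le> ennreal (C * real (m - n) ^ q * real m ^ (2 * q * (d - 1))) * moment (2 * q) d f)"
proof (induction d)
  case 0
  then show ?case using q by (intro exI[of _ 0]) (auto simp: power_0_left)
next
  case (Suc d)
  then obtain C where C0: "0 \<le> C" and C: "\<And>f n m. f \<in> kernels d \<Longrightarrow> moment (2 * q) d f < \<infinity> \<Longrightarrow> n \<le> m \<Longrightarrow>
    abs_moment (2 * q) (\<lambda>\<omega>. Udev d f m \<omega> - Udev d f n \<omega>)
      \<le> ennreal (C * real (m - n) ^ q * real m ^ (2 * q * (d - 1))) * moment (2 * q) d f" by blast
  \<comment> \<open>K is the constant of the martingale bound. In C' the inner factor 2 * 2^(2q)
    comes from \<open>moment_centre\<close>, the outer 2^(2q) from adding two random
    variables.\<close>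
  define K :: real where "K = exp (2 ^ (2 * q)) * 2 * 2 ^ (2 * q)"
  define C' where "C' = 2 ^ (2 * q) * (K * (2 * 2 ^ (2 * q)) + C)"
  have C'0: "0 \<le> C'" using C0 by (simp add: C'_def K_def)
  have q2: "1 \<le> 2 * q" using q by simp
  show ?case
  proof (intro exI[of _ C'] conjI ballI impI allI C'0)
    fix f n m assume f: "f \<in> kernels (Suc d)" and fin: "moment (2 * q) (Suc d) f < \<infinity>" and nm: "n \<le> (m::nat)"
    note [measurable] = f average_kernel[OF f]
    note int = moment_finite_integrable[OF f q2 fin]
    define A where "A = enn2real (moment (2 * q) (Suc d) f)"
    have A0: "0 \<le> A" and A: "moment (2 * q) (Suc d) f = ennreal A"
      using fin by (auto simp: A_def less_top)
    define V where "V k \<omega> = Ustat d (\<lambda>z. centre d f (z(Suc d := X k \<omega>))) X (k - 1) \<omega>" for k \<omega>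
    have [measurable]: "V k \<in> borel_measurable M" for k
      unfolding V_def by measurable
    have h: "centre d f \<in> kernels (Suc d)" by (rule centre_kernel[OF f])
    have hm: "moment (2 * q) (Suc d) (centre d f) \<le> ennreal (2 * 2 ^ (2 * q) * A)"
      using moment_centre[OF f q2] A0 by (simp add: A ennreal_mult[symmetric])
    have hfin: "moment (2 * q) (Suc d) (centre d f) < \<infinity>"
      using hm by (auto intro: le_less_trans)
    have V: "abs_moment (2 * q) (V k) \<le> ennreal (real m ^ (2 * q * d) * (2 * 2 ^ (2 * q) * A))"
      if k: "k \<in> {n+1..m}" for k
    proof -
      have "abs_moment (2 * q) (\<lambda>\<omega>. V k \<omega> - 0 * Umean M d (\<lambda>z. centre d f (z(Suc d := X k \<omega>))) X)
        \<le> ennreal (real m ^ (d * (2 * q))) * moment (2 * q) (Suc d) (centre d f)"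
        unfolding V_def
      proof (rule section_bound[OF h _ hfin])
        fix F assume F: "F \<in> kernels d" "moment (2 * q) d F < \<infinity>"
        have "abs_moment (2 * q) (\<lambda>\<omega>. Ustat d F X (k - 1) \<omega>) \<le> ennreal (real (k - 1) ^ (d * (2 * q))) * moment (2 * q) d F"
          by (rule Ustat_crude_bound[OF F(1) q2 F(2)])
        also have "\<dots> \<le> ennreal (real m ^ (d * (2 * q))) * moment (2 * q) d F"
          using k by (intro mult_right_mono ennreal_leI power_mono) auto
        finally show "abs_moment (2 * q) (\<lambda>\<omega>. Ustat d F X (k - 1) \<omega> - 0 * Umean M d F X)
          \<le> ennreal (real m ^ (d * (2 * q))) * moment (2 * q) d F" by simp
      qed (use k in auto)
      also have "\<dots> \<le> ennreal (real m ^ (d * (2 * q))) * ennreal (2 * 2 ^ (2 * q) * A)"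
        by (intro mult_left_mono hm) simp
      finally show ?thesis
        using A0 by (simp add: ennreal_mult[symmetric] mult_ac)
    qed
    have sumV: "abs_moment (2 * q) (\<lambda>\<omega>. \<Sum>k=n+1..m. V k \<omega>)
        \<le> ennreal (K * real (m - n) ^ q * (real m ^ (2 * q * d) * (2 * 2 ^ (2 * q) * A)))"
    proof -
      let ?\<Psi> = "\<lambda>k (y, x). Ustat d (\<lambda>z. centre d f (z(Suc d := x))) (\<lambda>j y. y j) (k - 1) y"
      have V_eq: "?\<Psi> k (past {1..k - 1} \<omega>, X k \<omega>) = V k \<omega>" for k \<omega>
        unfolding V_def Ustat_past[of _ _ "k - 1"] by simp
      have "abs_moment (2 * q) (\<lambda>\<omega>. \<Sum>k=n+1..m. ?\<Psi> k (past {1..k - 1} \<omega>, X k \<omega>))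
        \<le> ennreal (exp (2 ^ (2 * q)) * 2 * 2 ^ (2 * q) * real (m - n) ^ q * (real m ^ (2 * q * d) * (2 * 2 ^ (2 * q) * A)))"
      proof (rule past_sum_moment_bound[OF q])
        show "AE \<omega> in M. (\<integral>x. ?\<Psi> k (past {1..k - 1} \<omega>, x) \<partial>law) = 0" for k
          using AE_average_centre[OF f moment_one_finite[OF f q2 fin], of "k - 1"]
          unfolding Ustat_past[of _ _ "k - 1"] by auto
        show "?\<Psi> k \<in> borel_measurable (PiM {1..k - 1} (\<lambda>_. S) \<Otimes>\<^sub>M S)" for k
          by (rule measurable_Ustat_past[OF h])
        show "abs_moment (2 * q) (\<lambda>\<omega>. ?\<Psi> k (past {1..k - 1} \<omega>, X k \<omega>))
          \<le> ennreal (real m ^ (2 * q * d) * (2 * 2 ^ (2 * q) * A))" if "k \<in> {n+1..m}" for k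
          unfolding V_eq by (rule V[OF that])
      qed (use A0 in simp)
      then show ?thesis unfolding V_eq K_def .
    qed
    \<comment> \<open>Order 0 needs its own value: the deviation vanishes, whereas the truncated
      exponent d - 1 would leave a bound that grows with m.\<close>
    have Z: "abs_moment (2 * q) (\<lambda>\<omega>. Udev d (average d f) (k - 1) \<omega>)
        \<le> ennreal (if d = 0 then 0 else C * real m ^ q * real m ^ (2 * q * (d - 1)) * A)" if k: "k \<in> {n+1..m}" for k
    proof (cases "d = 0")
      case True
      then show ?thesis using q by (simp add: power_0_left)
    next
      case False
      have am: "moment (2 * q) d (average d f) \<le> ennreal A"
        using moment_average[OF f q2] by (simp add: A)
      have "abs_moment (2 * q) (\<lambda>\<omega>. Udev d (average d f) (k - 1) \<omega> - Udev d (average d f) 0 \<omega>)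
        \<le> ennreal (C * real (k - 1 - 0) ^ q * real (k - 1) ^ (2 * q * (d - 1))) * moment (2 * q) d (average d f)"
        by (rule C[OF average_kernel[OF f]]) (use am in \<open>auto intro: le_less_trans\<close>)
      also have "\<dots> \<le> ennreal (C * real m ^ q * real m ^ (2 * q * (d - 1))) * ennreal A"
        using k C0 by (intro mult_mono ennreal_leI power_mono am) auto
      finally show ?thesis
        using False C0 A0 by (simp add: Udev_at_0 ennreal_mult[symmetric])
    qed
    have sumZ: "abs_moment (2 * q) (\<lambda>\<omega>. \<Sum>k=n+1..m. Udev d (average d f) (k - 1) \<omega>)
        \<le> ennreal (C * real (m - n) ^ q * (real m ^ (2 * q * d) * A))"
    proof -
      have "abs_moment (2 * q) (\<lambda>\<omega>. \<Sum>k=n+1..m. Udev d (average d f) (k - 1) \<omega>)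
        \<le> ennreal (real (m - n) ^ (2 * q) * (if d = 0 then 0 else C * real m ^ q * real m ^ (2 * q * (d - 1)) * A))"
        using C0 A0 by (intro sum_moment_bound[OF q2 _ _ Z]) auto
      also have "\<dots> \<le> ennreal (C * real (m - n) ^ q * (real m ^ (2 * q * d) * A))"
      proof (cases "d = 0")
        case False
        have "real (m - n) ^ (2 * q) * (C * real m ^ q * real m ^ (2 * q * (d - 1)) * A)
          = (C * real (m - n) ^ q * A) * (real (m - n) ^ q * real m ^ q * real m ^ (2 * q * (d - 1)))"
          unfolding mult_2[of q] power_add[of _ q q] by (simp add: mult_ac)
        also have "\<dots> \<le> (C * real (m - n) ^ q * A) * (real m ^ q * real m ^ q * real m ^ (2 * q * (d - 1)))"
          using C0 A0 by (intro mult_left_mono mult_right_mono power_mono) auto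
        also have "real m ^ q * real m ^ q * real m ^ (2 * q * (d - 1)) = real m ^ (2 * q * d)"
          using False by (cases d) (simp_all add: power_add[symmetric] mult_2 algebra_simps)
        finally show ?thesis
          using False by (simp add: mult_ac ennreal_leI)
      qed simp
      finally show ?thesis .
    qed
    have "abs_moment (2 * q) (\<lambda>\<omega>. (\<Sum>k=n+1..m. V k \<omega>) + (\<Sum>k=n+1..m. Udev d (average d f) (k - 1) \<omega>))
      \<le> ennreal (2 ^ (2 * q) * (K * real (m - n) ^ q * (real m ^ (2 * q * d) * (2 * 2 ^ (2 * q) * A))
          + C * real (m - n) ^ q * (real m ^ (2 * q * d) * A)))"
      by (rule add_moment_bound[OF _ _ _ _ sumV sumZ]) (use C0 A0 in \<open>auto simp: K_def\<close>)
    also have "2 ^ (2 * q) * (K * real (m - n) ^ q * (real m ^ (2 * q * d) * (2 * 2 ^ (2 * q) * A))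
          + C * real (m - n) ^ q * (real m ^ (2 * q * d) * A)) = C' * real (m - n) ^ q * real m ^ (2 * q * (Suc d - 1)) * A"
      by (simp add: C'_def algebra_simps)
    also have "ennreal \<dots> = ennreal (C' * real (m - n) ^ q * real m ^ (2 * q * (Suc d - 1))) * moment (2 * q) (Suc d) f"
      using A0 C'0 by (simp add: A ennreal_mult[symmetric])
    finally show "abs_moment (2 * q) (\<lambda>\<omega>. Udev (Suc d) f m \<omega> - Udev (Suc d) f n \<omega>)
      \<le> ennreal (C' * real (m - n) ^ q * real m ^ (2 * q * (Suc d - 1))) * moment (2 * q) (Suc d) f"
      unfolding Udev_increment[OF f int nm] V_def .
  qed
qed

end

section \<open>The linear part\<close>

text \<open>Pascal's rule for n - k, accumulated over n: summing over a new largest index l raises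
  the order of the upper binomial coefficient by one.\<close>

lemma sum_choose_convolution_Suc:
  fixes b :: "nat \<Rightarrow> real"
  shows "(\<Sum>k=1..n. b k * real ((n - k) choose Suc e)) = (\<Sum>l=1..n. \<Sum>k=1..l - 1. b k * real ((l - 1 - k) choose e))"
proof (induction n)
  case (Suc n)
  have "(\<Sum>k=1..n. b k * real ((Suc n - k) choose Suc e))
      = (\<Sum>k=1..n. b k * real ((n - k) choose e)) + (\<Sum>k=1..n. b k * real ((n - k) choose Suc e))"
    unfolding sum.distrib[symmetric]
    by (intro sum.cong refl) (auto simp: Suc_diff_le algebra_simps)
  with Suc show ?case by simp
qed simp

context iid_sequence
begin

text \<open>The Hajek projection of the centred statistic when \<phi> is the family of the f_j: the
  product of binomial coefficients counts the increasing tuples that have k in position j.\<close>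

definition linear_part :: "nat \<Rightarrow> (nat \<Rightarrow> 's \<Rightarrow> real) \<Rightarrow> nat \<Rightarrow> 'a \<Rightarrow> real" where
  "linear_part d \<phi> n \<omega> =
    (\<Sum>j=1..d. \<Sum>k=1..n. real ((k - 1) choose (j - 1)) * real ((n - k) choose (d - j)) * \<phi> j (X k \<omega>))"

lemma linear_part_0 [simp]: "linear_part 0 \<phi> n \<omega> = 0"
  by (simp add: linear_part_def)

text \<open>Mirrors the recursion of \<open>Udev\<close>. The last position means that k is the
  largest index; the earlier positions come from the linear parts of order d below the largest
  index.\<close>

lemma linear_part_Suc:
  "linear_part (Suc d) \<phi> n \<omega> =
    (\<Sum>k=1..n. real ((k - 1) choose d) * \<phi> (Suc d) (X k \<omega>)) + (\<Sum>k=1..n. linear_part d \<phi> (k - 1) \<omega>)"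
proof -
  have "(\<Sum>k=1..n. linear_part d \<phi> (k - 1) \<omega>) =
      (\<Sum>j=1..d. \<Sum>l=1..n. \<Sum>k=1..l - 1. real ((k - 1) choose (j - 1)) * real ((l - 1 - k) choose (d - j)) * \<phi> j (X k \<omega>))"
    unfolding linear_part_def by (rule sum.swap)
  also have "\<dots> = (\<Sum>j=1..d. \<Sum>k=1..n. real ((k - 1) choose (j - 1)) * real ((n - k) choose (Suc d - j)) * \<phi> j (X k \<omega>))"
  proof (rule sum.cong[OF refl])
    fix j assume "j \<in> {1..d}"
    then have "Suc d - j = Suc (d - j)" by auto
    then show "(\<Sum>l=1..n. \<Sum>k=1..l - 1. real ((k - 1) choose (j - 1)) * real ((l - 1 - k) choose (d - j)) * \<phi> j (X k \<omega>))
      = (\<Sum>k=1..n. real ((k - 1) choose (j - 1)) * real ((n - k) choose (Suc d - j)) * \<phi> j (X k \<omega>))"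
      using sum_choose_convolution_Suc[of "\<lambda>k. real ((k - 1) choose (j - 1)) * \<phi> j (X k \<omega>)" n "d - j"]
      by (simp add: mult_ac)
  qed
  finally show ?thesis
    by (simp add: linear_part_def)
qed

lemma linear_part_cong:
  assumes "\<And>j k. j \<in> {1..d} \<Longrightarrow> k \<in> {1..n} \<Longrightarrow> \<phi> j (X k \<omega>) = \<psi> j (X k \<omega>)"
  shows "linear_part d \<phi> n \<omega> = linear_part d \<psi> n \<omega>"
  using assms by (simp add: linear_part_def)

section \<open>Projections and the approximation by the linear part in L^2\<close>

lemma measurable_replace:
  assumes "f \<in> kernels d" and j: "j \<in> {1..d}"
  shows "(\<lambda>(y, x). f (\<lambda>k\<in>{1..d}. if k = j then x else y k)) \<in> borel_measurable (PiM ({1..d} - {j}) (\<lambda>_. S) \<Otimes>\<^sub>M S)"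
proof -
  have "(\<lambda>yx. \<lambda>k\<in>{1..d}. if k = j then snd yx else fst yx k) \<in>
      measurable (PiM ({1..d} - {j}) (\<lambda>_. S) \<Otimes>\<^sub>M S) (PiM {1..d} (\<lambda>_. S))"
  proof (intro measurable_restrict)
    fix k assume "k \<in> {1..d}"
    then show "(\<lambda>yx. if k = j then snd yx else fst yx k) \<in> measurable (PiM ({1..d} - {j}) (\<lambda>_. S) \<Otimes>\<^sub>M S) S"
      by (cases "k = j") (auto intro: measurable_compose[OF measurable_fst measurable_component_singleton])
  qed
  from measurable_compose[OF this assms(1)] show ?thesis
    by (simp add: case_prod_unfold)
qed

lemma replace_past:
  "(\<lambda>k\<in>{1..d}. if k = j then x else past ({1..d} - {j}) \<omega> k) = (\<lambda>k\<in>{1..d}. if k = j then x else X k \<omega>)"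
  by (auto simp: past_def restrict_def fun_eq_iff)

lemma past_replace: "j \<in> {1..d} \<Longrightarrow> (\<lambda>k\<in>{1..d}. if k = j then X j \<omega> else X k \<omega>) = past {1..d} \<omega>"
  by (auto simp: past_def restrict_def fun_eq_iff)

lemma AE_integrable_replace:
  assumes f: "f \<in> kernels d" and j: "j \<in> {1..d}" and int: "integrable M (\<lambda>\<omega>. f (past {1..d} \<omega>))"
  shows "AE x in law. integrable M (\<lambda>\<omega>. f (\<lambda>k\<in>{1..d}. if k = j then x else X k \<omega>))"
  using integral_past(3)[OF _ measurable_replace[OF f j], of j] int j
  by (simp add: replace_past past_replace)

lemma moment_replace:
  assumes f: "f \<in> kernels d" and j: "j \<in> {1..d}"
  shows "(\<integral>\<^sup>+x. \<integral>\<^sup>+\<omega>. ennreal (\<bar>f (\<lambda>k\<in>{1..d}. if k = j then x else X k \<omega>)\<bar> ^ p) \<partial>M \<partial>law) = moment p d f"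
proof -
  have "(\<lambda>(y, x). ennreal (\<bar>f (\<lambda>k\<in>{1..d}. if k = j then x else y k)\<bar> ^ p))
      \<in> borel_measurable (PiM ({1..d} - {j}) (\<lambda>_. S) \<Otimes>\<^sub>M S)"
    using measurable_replace[OF f j] by (simp add: case_prod_unfold)
  from nn_integral_past(1)[OF _ this, of j] j show ?thesis
    by (simp add: replace_past past_replace moment_def)
qed

lemma measurable_replace_X:
  assumes f: "f \<in> kernels d" and j: "j \<in> {1..d}" and x: "x \<in> space S"
  shows "(\<lambda>\<omega>. f (\<lambda>k\<in>{1..d}. if k = j then x else X k \<omega>)) \<in> borel_measurable M"
  using measurable_compose[OF measurable_past measurable_Pair1[OF measurable_replace[OF f j] x]]
  by (simp add: replace_past)

abbreviation proj :: "nat \<Rightarrow> ((nat \<Rightarrow> 's) \<Rightarrow> real) \<Rightarrow> nat \<Rightarrow> 's \<Rightarrow> real" where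
  "proj d f \<equiv> Uproj M d f X"

lemma measurable_proj:
  assumes f: "f \<in> kernels d" and j: "j \<in> {1..d}"
  shows "proj d f j \<in> borel_measurable S"
proof -
  have "(\<lambda>(x, \<omega>). (past ({1..d} - {j}) \<omega>, x)) \<in> measurable (S \<Otimes>\<^sub>M M) (PiM ({1..d} - {j}) (\<lambda>_. S) \<Otimes>\<^sub>M S)"
    by measurable
  from measurable_compose[OF this measurable_replace[OF f j]]
  have "(\<lambda>(x, \<omega>). f (\<lambda>k\<in>{1..d}. if k = j then x else X k \<omega>)) \<in> borel_measurable (S \<Otimes>\<^sub>M M)"
    by (simp only: case_prod_unfold fst_conv snd_conv replace_past)
  from borel_measurable_lebesgue_integral[OF this] show ?thesis
    unfolding Uproj_def[abs_def] by (intro borel_measurable_diff borel_measurable_const)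
qed

text \<open>Fubini's theorem integrates the last coordinate first. The identity is almost sure
  because the section with x in slot j has to be integrable.\<close>

lemma proj_average:
  assumes f: "f \<in> kernels (Suc d)" and int: "integrable M (\<lambda>\<omega>. f (past {1..Suc d} \<omega>))" and j: "j \<in> {1..d}"
  shows "AE x in law. proj d (average d f) j x = proj (Suc d) f j x"
proof -
  have j': "j \<in> {1..Suc d}" using j by auto
  show ?thesis
    using AE_integrable_replace[OF f j' int] AE_space
  proof eventually_elim
    case (elim x)
    let ?r = "\<lambda>y. \<lambda>k\<in>{1..d}. if k = j then x else y k"
    have upd: "(?r y)(Suc d := x') = (\<lambda>k\<in>{1..Suc d}. if k = j then x else if k = Suc d then x' else y k)" for y x'
      using j by (auto simp: restrict_def fun_eq_iff)
    have "(\<lambda>yx. (?r (fst yx), snd yx)) \<in> measurable (PiM {1..d} (\<lambda>_. S) \<Otimes>\<^sub>M S) (PiM {1..d} (\<lambda>_. S) \<Otimes>\<^sub>M S)"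
    proof (intro measurable_Pair measurable_restrict measurable_snd)
      fix k assume "k \<in> {1..d}"
      then show "(\<lambda>yx. if k = j then x else fst yx k) \<in> measurable (PiM {1..d} (\<lambda>_. S) \<Otimes>\<^sub>M S) S"
        using elim(2) by (cases "k = j") (auto intro: measurable_compose[OF measurable_fst measurable_component_singleton])
    qed
    from measurable_compose[OF this measurable_kernel_pair[OF f]]
    have m: "(\<lambda>yx. f ((?r (fst yx))(Suc d := snd yx))) \<in> borel_measurable (PiM {1..d} (\<lambda>_. S) \<Otimes>\<^sub>M S)"
      by (simp add: case_prod_unfold)
    have eq: "(?r (past {1..d} \<omega>))(Suc d := X (Suc d) \<omega>) = (\<lambda>k\<in>{1..Suc d}. if k = j then x else X k \<omega>)" for \<omega>
      using j unfolding upd by (auto simp: restrict_def fun_eq_iff past_def)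
    have r: "?r (past {1..d} \<omega>) = ?r (\<lambda>k. X k \<omega>)" for \<omega>
      by (auto simp: restrict_def fun_eq_iff past_def)
    have int': "integrable M (\<lambda>\<omega>. f ((?r (past {1..d} \<omega>))(Suc d := X (Suc d) \<omega>)))"
      unfolding eq by (rule elim(1))
    have "(\<integral>\<omega>. f ((?r (past {1..d} \<omega>))(Suc d := X (Suc d) \<omega>)) \<partial>M) = (\<integral>\<omega>. average d f (?r (past {1..d} \<omega>)) \<partial>M)"
      using integral_past(2)[OF _ m, of "Suc d", unfolded fst_conv snd_conv, OF _ int'] unfolding average_def by simp
    then have "(\<integral>\<omega>. f (\<lambda>k\<in>{1..Suc d}. if k = j then x else X k \<omega>) \<partial>M) = (\<integral>\<omega>. average d f (?r (\<lambda>k. X k \<omega>)) \<partial>M)"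
      unfolding eq unfolding r .
    then show ?case
      by (simp add: Uproj_def Umean_average[OF f int])
  qed
qed

text \<open>Centring subtracts the average, whose mean is \<mu>, and this is the constant subtracted
  in the last projection.\<close>

lemma proj_last:
  assumes f: "f \<in> kernels (Suc d)" and int: "integrable M (\<lambda>\<omega>. f (past {1..Suc d} \<omega>))"
    and int_avg: "integrable M (\<lambda>\<omega>. average d f (past {1..d} \<omega>))"
  shows "AE x in law. Umean M d (\<lambda>z. centre d f (z(Suc d := x))) X = proj (Suc d) f (Suc d) x"
proof -
  have "AE x in law. integrable M (\<lambda>\<omega>. f (\<lambda>k\<in>{1..Suc d}. if k = Suc d then x else X k \<omega>))"
    by (rule AE_integrable_replace[OF f _ int]) simp
  then show ?thesis
  proof eventually_elim
    case (elim x)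
    have eq: "(past {1..d} \<omega>)(Suc d := x) = (\<lambda>k\<in>{1..Suc d}. if k = Suc d then x else X k \<omega>)"
      "restrict ((past {1..d} \<omega>)(Suc d := x)) {1..d} = past {1..d} \<omega>" for \<omega>
      by (auto simp: restrict_def fun_eq_iff past_def)
    have "Umean M d (\<lambda>z. centre d f (z(Suc d := x))) X
        = (\<integral>\<omega>. f (\<lambda>k\<in>{1..Suc d}. if k = Suc d then x else X k \<omega>) - average d f (past {1..d} \<omega>) \<partial>M)"
      unfolding Umean_past centre_def eq(2) unfolding eq(1) ..
    also have "\<dots> = (\<integral>\<omega>. f (\<lambda>k\<in>{1..Suc d}. if k = Suc d then x else X k \<omega>) \<partial>M) - (\<integral>\<omega>. average d f (past {1..d} \<omega>) \<partial>M)"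
      using elim by (intro Bochner_Integration.integral_diff int_avg) auto
    finally show ?case
      using Umean_average[OF f int] by (simp add: Uproj_def Umean_past)
  qed
qed

lemma AE_law_X: "AE x in law. P x \<Longrightarrow> AE \<omega> in M. P (X k \<omega>)"
  unfolding distr_X[of k, symmetric] by (rule AE_distrD[OF measurable_X])

lemma measurable_linear_part:
  assumes "\<And>j. j \<in> {1..d} \<Longrightarrow> \<phi> j \<in> borel_measurable S"
  shows "linear_part d \<phi> n \<in> borel_measurable M"
  unfolding linear_part_def[abs_def]
  by (intro borel_measurable_sum borel_measurable_times borel_measurable_const
      measurable_compose[OF measurable_X assms]) auto

text \<open>Removing from each martingale increment its mean given X_k leaves an orthogonal sum: n
  terms with second moment O(n^(2d-1)) for order d + 1, in total O(n^(2d)). The averaged kernel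
  contributes n remainders of second moment O(n^(2d-2)), and adding these without cancellation gives
  n^(2d) again. This is a factor n below the second moment n^(2d+1) of the deviation scale.\<close>

lemma Udev_linear_part:
  "\<exists>C\<ge>0. \<forall>f\<in>kernels d. moment 2 d f < \<infinity> \<longrightarrow> (\<forall>n.
    abs_moment 2 (\<lambda>\<omega>. Udev d f n \<omega> - linear_part d (proj d f) n \<omega>)
      \<le> ennreal (C * real n ^ (2 * (d - 1))) * moment 2 d f)"
proof (induction d)
  case 0
  then show ?case by (intro exI[of _ 0]) auto
next
  case (Suc d)
  then obtain C where C0: "0 \<le> C" and C: "\<And>f n. f \<in> kernels d \<Longrightarrow> moment 2 d f < \<infinity> \<Longrightarrow>
    abs_moment 2 (\<lambda>\<omega>. Udev d f n \<omega> - linear_part d (proj d f) n \<omega>)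
      \<le> ennreal (C * real n ^ (2 * (d - 1))) * moment 2 d f" by blast
  obtain B where B0: "0 \<le> B" and B: "\<And>f n m. f \<in> kernels d \<Longrightarrow> moment 2 d f < \<infinity> \<Longrightarrow> n \<le> m \<Longrightarrow>
    abs_moment 2 (\<lambda>\<omega>. Udev d f m \<omega> - Udev d f n \<omega>)
      \<le> ennreal (B * real (m - n) * real m ^ (2 * (d - 1))) * moment 2 d f"
    using Udev_moment_bound[of 1 d] by auto
  \<comment> \<open>K is the martingale constant exp(2^(2q)) * 2 * 2^(2q) at q = 1. In C' the 8 is
    the factor 2 * 2^2 of \<open>moment_centre\<close> and the 4 comes from adding two random
    variables.\<close>
  define K :: real where "K = exp 4 * 2 * 4"
  define C' where "C' = 4 * (K * (B * 8) + C)"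
  have C'0: "0 \<le> C'" using C0 B0 by (simp add: C'_def K_def)
  show ?case
  proof (intro exI[of _ C'] conjI ballI impI allI C'0)
    fix f and n :: nat assume f: "f \<in> kernels (Suc d)" and fin: "moment 2 (Suc d) f < \<infinity>"
    note [measurable] = f average_kernel[OF f]
    note int = moment_finite_integrable[OF f _ fin, simplified]
    define A where "A = enn2real (moment 2 (Suc d) f)"
    have A0: "0 \<le> A" and A: "moment 2 (Suc d) f = ennreal A"
      using fin by (auto simp: A_def less_top)
    have am: "moment 2 d (average d f) \<le> ennreal A"
      using moment_average[OF f, of 2] by (simp add: A)
    have afin: "moment 2 d (average d f) < \<infinity>" using am by (auto intro: le_less_trans)
    have int_avg: "integrable M (\<lambda>\<omega>. average d f (past {1..d} \<omega>))"
      by (rule moment_finite_integrable[OF average_kernel[OF f] _ afin]) simp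
    have h: "centre d f \<in> kernels (Suc d)" by (rule centre_kernel[OF f])
    have hm: "moment 2 (Suc d) (centre d f) \<le> ennreal (8 * A)"
    proof -
      have "moment 2 (Suc d) (centre d f) \<le> ennreal (2 * 2\<^sup>2) * ennreal A"
        using moment_centre[OF f, of 2] unfolding A by simp
      also have "\<dots> = ennreal (8 * A)"
        using A0 by (subst ennreal_mult[symmetric]) auto
      finally show ?thesis .
    qed
    have hfin: "moment 2 (Suc d) (centre d f) < \<infinity>"
      using hm by (auto intro: le_less_trans)
    have hint: "integrable M (\<lambda>\<omega>. centre d f (past {1..Suc d} \<omega>))"
      by (rule moment_finite_integrable[OF h _ hfin]) simp
    \<comment> \<open>Subtracting the mean over the past at fixed X_k turns the increment into a
      deviation of order d, smaller in L^2 by a factor root n than the crude bound. The mean over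
      X_k remains zero, so orthogonality survives.\<close>
    define \<Psi> where "\<Psi> k yx = Ustat d (\<lambda>z. centre d f (z(Suc d := snd yx))) (\<lambda>j y. y j) (k - 1) (fst yx)
      - real ((k - 1) choose d) * Umean M d (\<lambda>z. centre d f (z(Suc d := snd yx))) X" for k :: nat and yx
    define E where "E k \<omega> = \<Psi> k (past {1..k - 1} \<omega>, X k \<omega>)" for k \<omega>
    have E_eq: "E k \<omega> = Ustat d (\<lambda>z. centre d f (z(Suc d := X k \<omega>))) X (k - 1) \<omega>
        - real ((k - 1) choose d) * Umean M d (\<lambda>z. centre d f (z(Suc d := X k \<omega>))) X" for k \<omega>
      unfolding E_def \<Psi>_def Ustat_past[of _ _ "k - 1"] by simp
    have [measurable]: "(\<lambda>x. Umean M d (\<lambda>z. centre d f (z(Suc d := x))) X) \<in> borel_measurable S"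
      unfolding Umean_past by (rule measurable_section_mean[OF h])
    have \<Psi>_meas: "\<Psi> k \<in> borel_measurable (PiM {1..k - 1} (\<lambda>_. S) \<Otimes>\<^sub>M S)" for k
    proof -
      have "(\<lambda>yx. Ustat d (\<lambda>z. centre d f (z(Suc d := snd yx))) (\<lambda>j y. y j) (k - 1) (fst yx))
          \<in> borel_measurable (PiM {1..k - 1} (\<lambda>_. S) \<Otimes>\<^sub>M S)"
        using measurable_Ustat_past[OF h, of "k - 1"] by (simp add: case_prod_unfold)
      then show ?thesis unfolding \<Psi>_def[abs_def] by measurable
    qed
    have [measurable]: "E k \<in> borel_measurable M" for k
      unfolding E_def[abs_def] by (intro measurable_compose[OF _ \<Psi>_meas]) measurable
    have fin1: "moment 1 (Suc d) f < \<infinity>"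
      by (rule moment_one_finite[OF f _ fin]) simp
    have zero: "AE \<omega> in M. (\<integral>x. \<Psi> k (past {1..k - 1} \<omega>, x) \<partial>law) = 0" for k
    proof -
      have 1: "integrable law (\<lambda>x. Umean M d (\<lambda>z. centre d f (z(Suc d := x))) X)"
        "(\<integral>x. Umean M d (\<lambda>z. centre d f (z(Suc d := x))) X \<partial>law) = Umean M (Suc d) (centre d f) X"
        using integral_past(6)[OF _ measurable_kernel_pair[OF h], of "Suc d"]
          integral_past(1)[OF _ measurable_kernel_pair[OF h], of "Suc d"] hint
        by (simp_all add: Umean_past past_upd)
      have r: "restrict (past {1..Suc d} \<omega>) {1..d} = past {1..d} \<omega>" for \<omega>
        by (auto simp: past_def restrict_def fun_eq_iff)
      have 2: "Umean M (Suc d) (centre d f) X = 0"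
        using int int_avg Umean_average[OF f int] by (simp add: Umean_past centre_def r)
      show ?thesis
        using AE_average_centre[OF f fin1, of "k - 1"]
      proof eventually_elim
        case (elim \<omega>)
        then show ?case
          unfolding \<Psi>_def fst_conv snd_conv Ustat_past[symmetric]
          using 1 2 by (subst Bochner_Integration.integral_diff) auto
      qed
    qed
    have E: "abs_moment (2 * 1) (E k) \<le> ennreal (if d = 0 then 0 else B * real n * real n ^ (2 * (d - 1)) * (8 * A))"
      if k: "k \<in> {0+1..n}" for k
    proof (cases "d = 0")
      case True
      have "E k \<omega> = 0" for \<omega>
        using Udev_0[of "\<lambda>z. centre 0 f (z(Suc 0 := X k \<omega>))" "k - 1" \<omega>]
        unfolding E_eq True Udev_def .
      then show ?thesis using True by simp
    next
      case False
      have "abs_moment 2 (E k) \<le> ennreal (B * real n * real n ^ (2 * (d - 1))) * moment 2 (Suc d) (centre d f)"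
        unfolding E_eq
      proof (rule section_bound[OF h _ hfin])
        fix F assume F: "F \<in> kernels d" "moment 2 d F < \<infinity>"
        have "abs_moment 2 (\<lambda>\<omega>. Udev d F (k - 1) \<omega> - Udev d F 0 \<omega>)
          \<le> ennreal (B * real (k - 1 - 0) * real (k - 1) ^ (2 * (d - 1))) * moment 2 d F"
          by (rule B[OF F]) simp
        also have "\<dots> \<le> ennreal (B * real n * real n ^ (2 * (d - 1))) * moment 2 d F"
          using k B0 by (intro mult_right_mono ennreal_leI mult_mono power_mono) auto
        finally show "abs_moment 2 (\<lambda>\<omega>. Ustat d F X (k - 1) \<omega> - real ((k - 1) choose d) * Umean M d F X)
          \<le> ennreal (B * real n * real n ^ (2 * (d - 1))) * moment 2 d F"
          using False by (simp add: Udev_at_0) (simp add: Udev_def)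
      qed (use k in auto)
      also have "\<dots> \<le> ennreal (B * real n * real n ^ (2 * (d - 1))) * ennreal (8 * A)"
        by (intro mult_left_mono hm) simp
      finally show ?thesis
        using False A0 B0 by (simp add: ennreal_mult[symmetric])
    qed
    have sumE: "abs_moment 2 (\<lambda>\<omega>. \<Sum>k=0+1..n. E k \<omega>) \<le> ennreal (K * (B * 8) * (real n ^ (2 * d) * A))"
    proof -
      have "abs_moment (2 * 1) (\<lambda>\<omega>. \<Sum>k=0+1..n. E k \<omega>)
        \<le> ennreal (exp (2 ^ (2 * 1)) * 2 * 2 ^ (2 * 1) * real (n - 0) ^ 1 * (if d = 0 then 0 else B * real n * real n ^ (2 * (d - 1)) * (8 * A)))"
        using E B0 A0 unfolding E_def by (intro past_sum_moment_bound \<Psi>_meas zero) auto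
      also have "exp (2 ^ (2 * 1)) * 2 * 2 ^ (2 * 1) * real (n - 0) ^ 1 * (if d = 0 then 0 else B * real n * real n ^ (2 * (d - 1)) * (8 * A))
          \<le> K * (B * 8) * (real n ^ (2 * d) * A)"
      proof (cases d)
        case (Suc d')
        then show ?thesis by (simp add: K_def power_add mult_ac)
      qed (use B0 A0 in \<open>simp add: K_def\<close>)
      finally show ?thesis by (simp add: ennreal_leI)
    qed
    define R where "R k \<omega> = Udev d (average d f) (k - 1) \<omega> - linear_part d (proj d (average d f)) (k - 1) \<omega>" for k \<omega>
    have [measurable]: "R k \<in> borel_measurable M" for k
      unfolding R_def[abs_def]
      by (intro borel_measurable_diff measurable_Udev measurable_linear_part measurable_proj average_kernel[OF f])
    have R: "abs_moment 2 (R k) \<le> ennreal (if d = 0 then 0 else C * real n ^ (2 * (d - 1)) * A)"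
      if k: "k \<in> {0+1..n}" for k
    proof (cases "d = 0")
      case True
      then show ?thesis by (simp add: R_def)
    next
      case False
      have "abs_moment 2 (R k) \<le> ennreal (C * real (k - 1) ^ (2 * (d - 1))) * moment 2 d (average d f)"
        unfolding R_def by (rule C[OF average_kernel[OF f] afin])
      also have "\<dots> \<le> ennreal (C * real n ^ (2 * (d - 1))) * ennreal A"
        using k C0 by (intro mult_mono ennreal_leI power_mono am) auto
      finally show ?thesis using False C0 A0 by (simp add: ennreal_mult[symmetric])
    qed
    have sumR: "abs_moment 2 (\<lambda>\<omega>. \<Sum>k=0+1..n. R k \<omega>) \<le> ennreal (C * (real n ^ (2 * d) * A))"
    proof -
      have "abs_moment 2 (\<lambda>\<omega>. \<Sum>k=0+1..n. R k \<omega>)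
        \<le> ennreal (real (n - 0) ^ 2 * (if d = 0 then 0 else C * real n ^ (2 * (d - 1)) * A))"
        using R C0 A0 by (intro sum_moment_bound) auto
      also have "real (n - 0) ^ 2 * (if d = 0 then 0 else C * real n ^ (2 * (d - 1)) * A) \<le> C * (real n ^ (2 * d) * A)"
      proof (cases d)
        case (Suc d')
        then show ?thesis by (simp add: power_add mult_ac power2_eq_square)
      qed (use C0 A0 in simp)
      finally show ?thesis by (simp add: ennreal_leI)
    qed
    \<comment> \<open>The identities for the projections hold only almost everywhere under
      \<open>law\<close>; as there are countably many k and finitely many j, one null set in M
      suffices.\<close>
    define P where "P x \<longleftrightarrow> Umean M d (\<lambda>z. centre d f (z(Suc d := x))) X = proj (Suc d) f (Suc d) x" for x
    have "AE x in law. P x"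
      unfolding P_def by (rule proj_last[OF f int int_avg])
    then have "AE \<omega> in M. \<forall>k. P (X k \<omega>)"
      by (simp add: AE_all_countable AE_law_X)
    moreover have "AE \<omega> in M. \<forall>j\<in>{1..d}. \<forall>k. proj d (average d f) j (X k \<omega>) = proj (Suc d) f j (X k \<omega>)"
      proof (rule AE_finite_allI)
      fix j assume "j \<in> {1..d}"
      then show "AE \<omega> in M. \<forall>k. proj d (average d f) j (X k \<omega>) = proj (Suc d) f j (X k \<omega>)"
        by (subst AE_all_countable) (rule allI, rule AE_law_X[OF proj_average[OF f int]])
    qed simp
    ultimately have AE: "AE \<omega> in M. Udev (Suc d) f n \<omega> - linear_part (Suc d) (proj (Suc d) f) n \<omega>
      = (\<Sum>k=0+1..n. E k \<omega>) + (\<Sum>k=0+1..n. R k \<omega>)"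
    proof eventually_elim
      case (elim \<omega>)
      have 1: "linear_part d (proj d (average d f)) (k - 1) \<omega> = linear_part d (proj (Suc d) f) (k - 1) \<omega>" for k
        using elim(2) by (intro linear_part_cong) auto
      note inc = Udev_increment[OF f int le0, of n \<omega>, unfolded Udev_at_0[of "Suc d", OF le_add1[of 1 d, unfolded plus_1_eq_Suc]] diff_zero]
      have 3: "E k \<omega> = Ustat d (\<lambda>z. centre d f (z(Suc d := X k \<omega>))) X (k - 1) \<omega>
          - real ((k - 1) choose d) * proj (Suc d) f (Suc d) (X k \<omega>)" for k
        using elim(1) unfolding E_eq P_def by metis
      show ?case
        unfolding inc 3 R_def 1 linear_part_Suc sum_subtractf by simp
    qed
    have "abs_moment 2 (\<lambda>\<omega>. Udev (Suc d) f n \<omega> - linear_part (Suc d) (proj (Suc d) f) n \<omega>)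
      = abs_moment 2 (\<lambda>\<omega>. (\<Sum>k=0+1..n. E k \<omega>) + (\<Sum>k=0+1..n. R k \<omega>))"
      by (rule nn_integral_cong_AE) (use AE in eventually_elim, simp)
    also have "\<dots> \<le> ennreal (2\<^sup>2 * (K * (B * 8) * (real n ^ (2 * d) * A) + C * (real n ^ (2 * d) * A)))"
      by (rule add_moment_bound[OF _ _ _ _ sumE sumR]) (use A0 B0 C0 in \<open>auto simp: K_def\<close>)
    also have "2\<^sup>2 * (K * (B * 8) * (real n ^ (2 * d) * A) + C * (real n ^ (2 * d) * A)) = C' * real n ^ (2 * (Suc d - 1)) * A"
      by (simp add: C'_def algebra_simps)
    also have "ennreal \<dots> = ennreal (C' * real n ^ (2 * (Suc d - 1))) * moment 2 (Suc d) f"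
      using A0 C'0 by (simp add: A ennreal_mult[symmetric])
    finally show "abs_moment 2 (\<lambda>\<omega>. Udev (Suc d) f n \<omega> - linear_part (Suc d) (proj (Suc d) f) n \<omega>)
      \<le> ennreal (C' * real n ^ (2 * (Suc d - 1))) * moment 2 (Suc d) f" .
  qed
qed

end

section \<open>Asymptotics of the binomial weights\<close>

definition falling_ratio :: "nat \<Rightarrow> nat \<Rightarrow> nat \<Rightarrow> real" where
  "falling_ratio n a m = fact a * real (m choose a) / real n ^ a"

text \<open>The ratio is the falling factorial m (m - 1) ... (m - a + 1) over n^a. For a > m both
  sides vanish, the right one through the factor with i = m.\<close>

lemma falling_ratio_prod: "falling_ratio n a m = (\<Prod>i<a. real (m - i) / real n)"
proof (induction a)
  case (Suc a)
  have "Suc a * (m choose Suc a) = (m - a) * (m choose a)"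
    using binomial_absorb_comp[of m a] binomial_absorption[of a m] by simp
  then have "real (Suc a) * real (m choose Suc a) = real (m - a) * real (m choose a)"
    by (metis of_nat_mult)
  then have "falling_ratio n (Suc a) m = falling_ratio n a m * (real (m - a) / real n)"
    by (simp add: falling_ratio_def mult_ac)
  with Suc show ?case by simp
qed (simp add: falling_ratio_def)

lemma falling_ratio_bounds:
  assumes "m \<le> n"
  shows "0 \<le> falling_ratio n a m" "falling_ratio n a m \<le> 1"
proof -
  show "0 \<le> falling_ratio n a m" by (simp add: falling_ratio_def)
  show "falling_ratio n a m \<le> 1"
    unfolding falling_ratio_prod using assms by (intro prod_le_1) (auto simp: divide_le_eq)
qed

text \<open>Each of the a factors lies in [0, 1] and differs from m/n by at most a/n, also where m -
  i is truncated; for products of such factors the differences add up.\<close>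

lemma falling_ratio_power:
  assumes "m \<le> n"
  shows "\<bar>falling_ratio n a m - (real m / real n) ^ a\<bar> \<le> real (a * a) / real n"
proof -
  have "norm ((\<Prod>i<a. real (m - i) / real n) - (\<Prod>i<a. real m / real n))
      \<le> (\<Sum>i<a. norm (real (m - i) / real n - real m / real n))"
    using assms by (intro norm_prod_diff) (auto simp: divide_le_eq)
  also have "\<dots> \<le> (\<Sum>i<a. real a / real n)"
  proof (rule sum_mono)
    fix i assume "i \<in> {..<a}"
    then have "\<bar>real (m - i) - real m\<bar> \<le> real a" by auto
    then show "norm (real (m - i) / real n - real m / real n) \<le> real a / real n"
      by (simp add: diff_divide_distrib[symmetric] divide_right_mono)
  qed
  finally show ?thesis by (simp add: falling_ratio_prod)
qed

lemma abs_mult_diff_le: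
  fixes x y x' y' :: real
  assumes "\<bar>x\<bar> \<le> 1" "\<bar>y'\<bar> \<le> 1"
  shows "\<bar>x * y - x' * y'\<bar> \<le> \<bar>x - x'\<bar> + \<bar>y - y'\<bar>"
proof -
  have "x * y - x' * y' = x * (y - y') + (x - x') * y'" by (simp add: algebra_simps)
  also have "\<bar>\<dots>\<bar> \<le> \<bar>x\<bar> * \<bar>y - y'\<bar> + \<bar>x - x'\<bar> * \<bar>y'\<bar>"
    by (rule order_trans[OF abs_triangle_ineq]) (simp add: abs_mult)
  also have "\<dots> \<le> 1 * \<bar>y - y'\<bar> + \<bar>x - x'\<bar> * 1"
    using assms by (intro add_mono mult_mono) auto
  finally show ?thesis by simp
qed

lemma falling_ratio_mult:
  assumes "m \<le> n"
  shows "\<bar>falling_ratio n a m * falling_ratio n b m - falling_ratio n (a + b) m\<bar>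
    \<le> real (a * a + b * b + (a + b) * (a + b)) / real n"
proof -
  let ?x = "real m / real n"
  have x: "\<bar>?x ^ b\<bar> \<le> 1" using assms by (simp add: power_abs[symmetric] power_le_one divide_le_eq)
  have "\<bar>falling_ratio n a m * falling_ratio n b m - ?x ^ a * ?x ^ b\<bar>
      \<le> \<bar>falling_ratio n a m - ?x ^ a\<bar> + \<bar>falling_ratio n b m - ?x ^ b\<bar>"
    using falling_ratio_bounds[OF assms, of a] x by (intro abs_mult_diff_le) auto
  moreover have "\<bar>falling_ratio n a m - ?x ^ a\<bar> \<le> real (a * a) / real n"
    "\<bar>falling_ratio n b m - ?x ^ b\<bar> \<le> real (b * b) / real n"
    "\<bar>falling_ratio n (a + b) m - ?x ^ (a + b)\<bar> \<le> real ((a + b) * (a + b)) / real n"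
    by (rule falling_ratio_power[OF assms])+
  ultimately show ?thesis
    by (simp only: power_add[symmetric] of_nat_add add_divide_distrib)
qed

text \<open>Both sides count the subsets of {1..n} with a + b + 1 elements, the left one according
  to the element k that has a elements below it.\<close>

lemma sum_choose_convolution:
  "(\<Sum>k=1..n. real ((k - 1) choose a) * real ((n - k) choose b)) = real (n choose (a + b + 1))"
proof (induction b arbitrary: n)
  case 0
  have "(\<Sum>k=1..n. real ((k - 1) choose a)) = real (n choose Suc a)"
    using sum_choose_shift[of 0 n a] by (simp add: of_nat_sum[symmetric] del: of_nat_sum)
  then show ?case by (simp only: binomial_n_0 diff_zero add_0_right Suc_eq_plus1 of_nat_1 mult_1_right)
next
  case (Suc b)
  have "(\<Sum>k=1..n. real ((k - 1) choose a) * real ((n - k) choose Suc b))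
    = (\<Sum>l=1..n. real ((l - 1) choose (a + b + 1)))"
    unfolding sum_choose_convolution_Suc Suc ..
  also have "\<dots> = real (n choose (a + Suc b + 1))"
    using sum_choose_shift[of 0 n "a + b + 1"] by (simp add: of_nat_sum[symmetric] del: of_nat_sum)
  finally show ?case .
qed

lemma falling_ratio_diagonal: "(\<lambda>n. falling_ratio n a n) \<longlonglongrightarrow> 1"
proof (rule LIM_zero_cancel, rule Lim_null_comparison)
  show "\<forall>\<^sub>F n in sequentially. norm (falling_ratio n a n - 1) \<le> real (a * a) / real n"
    using eventually_gt_at_top[of 0]
  proof eventually_elim
    case (elim n)
    then show ?case using falling_ratio_power[of n n a] by simp
  qed
  show "(\<lambda>n. real (a * a) / real n) \<longlonglongrightarrow> 0" by (rule lim_const_over_n)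
qed

text \<open>The limit is the Beta integral of u^(a+a') (1-u)^(b+b') over [0, 1]. In place of Riemann
  sums, products are merged into single falling ratios at a cost of O(1/n), and the remaining sum is
  evaluated exactly by \<open>sum_choose_convolution\<close>.\<close>

lemma falling_ratio_product_limit:
  "(\<lambda>n. (\<Sum>k=1..n. falling_ratio n a (k - 1) * falling_ratio n b (n - k) *
      (falling_ratio n a' (k - 1) * falling_ratio n b' (n - k))) / real n)
    \<longlonglongrightarrow> fact (a + a') * fact (b + b') / fact (a + a' + (b + b') + 1)"
proof -
  define A where "A = a + a'"
  define B where "B = b + b'"
  define K where "K = real (a * a + a' * a' + A * A) + real (b * b + b' * b' + B * B)"
  let ?T = "\<lambda>n. (\<Sum>k=1..n. falling_ratio n a (k - 1) * falling_ratio n b (n - k) *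
      (falling_ratio n a' (k - 1) * falling_ratio n b' (n - k))) / real n"
  let ?S = "\<lambda>n. (\<Sum>k=1..n. falling_ratio n A (k - 1) * falling_ratio n B (n - k)) / real n"
  let ?L = "fact A * fact B / fact (A + B + 1) :: real"
  have inv: "(\<lambda>n. c / real n) \<longlonglongrightarrow> 0" for c
    using lim_const_over_n[of c] by simp
  have S: "?S n = ?L * falling_ratio n (A + B + 1) n" for n
  proof -
    have "(\<Sum>k=1..n. falling_ratio n A (k - 1) * falling_ratio n B (n - k))
      = fact A * fact B / (real n ^ A * real n ^ B) * (\<Sum>k=1..n. real ((k - 1) choose A) * real ((n - k) choose B))"
      by (simp add: falling_ratio_def sum_distrib_left sum_divide_distrib mult_ac)
    then show ?thesis
      unfolding sum_choose_convolution by (simp add: falling_ratio_def power_add mult_ac)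
  qed
  have "(\<lambda>n. falling_ratio n (A + B + 1) n) \<longlonglongrightarrow> 1"
    by (rule falling_ratio_diagonal)
  then have lim: "?S \<longlonglongrightarrow> ?L * 1"
    unfolding S by (intro tendsto_mult tendsto_const)
  have "(\<lambda>n. ?T n - ?S n) \<longlonglongrightarrow> 0"
  proof (rule Lim_null_comparison)
    show "\<forall>\<^sub>F n in sequentially. norm (?T n - ?S n) \<le> K / real n"
      using eventually_gt_at_top[of 0]
    proof eventually_elim
      case (elim n)
      have le: "\<bar>falling_ratio n a (k - 1) * falling_ratio n b (n - k) *
          (falling_ratio n a' (k - 1) * falling_ratio n b' (n - k)) - falling_ratio n A (k - 1) * falling_ratio n B (n - k)\<bar>
          \<le> K / real n" if "k \<in> {1..n}" for k
      proof -
        have k: "k - 1 \<le> n" "n - k \<le> n" using that by auto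
        have "\<bar>(falling_ratio n a (k - 1) * falling_ratio n a' (k - 1)) * (falling_ratio n b (n - k) * falling_ratio n b' (n - k))
            - falling_ratio n A (k - 1) * falling_ratio n B (n - k)\<bar>
          \<le> \<bar>falling_ratio n a (k - 1) * falling_ratio n a' (k - 1) - falling_ratio n A (k - 1)\<bar>
            + \<bar>falling_ratio n b (n - k) * falling_ratio n b' (n - k) - falling_ratio n B (n - k)\<bar>"
          using falling_ratio_bounds[OF k(1)] falling_ratio_bounds[OF k(2)]
          by (intro abs_mult_diff_le) (auto simp: abs_mult intro!: mult_le_one)
        also have "\<dots> \<le> K / real n"
          unfolding K_def add_divide_distrib A_def B_def
          by (intro add_mono falling_ratio_mult k)
        finally show ?thesis by (simp add: mult_ac)
      qed
      have "norm (?T n - ?S n) \<le> (\<Sum>k=1..n. K / real n) / real n"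
        unfolding diff_divide_distrib[symmetric] sum_subtractf[symmetric] real_norm_def abs_divide abs_of_nat
        using le elim by (intro divide_right_mono order_trans[OF sum_abs] sum_mono) auto
      also have "\<dots> = K / real n" using elim by simp
      finally show ?case .
    qed
  qed (rule inv)
  from tendsto_add[OF this lim] show ?thesis by (simp add: A_def B_def)
qed

section \<open>The central limit theorem for the deviations\<close>

context iid_sequence
begin

lemma integral_law:
  fixes h :: "'s \<Rightarrow> real"
  assumes "h \<in> borel_measurable S"
  shows "(\<integral>\<omega>. h (X k \<omega>) \<partial>M) = (\<integral>x. h x \<partial>law)" "integrable M (\<lambda>\<omega>. h (X k \<omega>)) \<longleftrightarrow> integrable law h"
  using integral_distr[of "X k" M S h] integrable_distr_eq[of "X k" M S h] assms by (simp_all add: distr_X)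

lemma integrable_proj_power:
  assumes f: "f \<in> kernels d" and j: "j \<in> {1..d}" and p: "1 \<le> p" and fin: "moment p d f < \<infinity>"
  shows "integrable law (\<lambda>x. \<bar>proj d f j x\<bar> ^ p)"
proof -
  let ?\<mu> = "Umean M d f X"
  let ?m = "\<lambda>x. \<integral>\<^sup>+\<omega>. ennreal (\<bar>f (\<lambda>k\<in>{1..d}. if k = j then x else X k \<omega>)\<bar> ^ p) \<partial>M"
  note [measurable] = measurable_proj[OF f j]
  have le: "ennreal (\<bar>proj d f j x\<bar> ^ p) \<le> ennreal (2 ^ p) * (?m x + ennreal (\<bar>?\<mu>\<bar> ^ p))" if x: "x \<in> space S" for x
  proof -
    let ?e = "\<integral>\<omega>. f (\<lambda>k\<in>{1..d}. if k = j then x else X k \<omega>) \<partial>M"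
    have "ennreal (\<bar>proj d f j x\<bar> ^ p) \<le> ennreal (2 ^ p * (\<bar>?e\<bar> ^ p + \<bar>?\<mu>\<bar> ^ p))"
      unfolding Uproj_def by (intro ennreal_leI abs_diff_power_le)
    also have "\<dots> = ennreal (2 ^ p) * (ennreal (\<bar>?e\<bar> ^ p) + ennreal (\<bar>?\<mu>\<bar> ^ p))"
      by (subst ennreal_mult) auto
    also have "\<dots> \<le> ennreal (2 ^ p) * (?m x + ennreal (\<bar>?\<mu>\<bar> ^ p))"
      by (intro mult_left_mono add_right_mono jensen_power measurable_replace_X[OF f j x] p) simp
    finally show ?thesis .
  qed
  have "(\<lambda>(x, \<omega>). (past ({1..d} - {j}) \<omega>, x)) \<in> measurable (S \<Otimes>\<^sub>M M) (PiM ({1..d} - {j}) (\<lambda>_. S) \<Otimes>\<^sub>M S)"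
    by measurable
  from measurable_compose[OF this measurable_replace[OF f j]]
  have m0: "(\<lambda>z. f (\<lambda>k\<in>{1..d}. if k = j then fst z else X k (snd z))) \<in> borel_measurable (S \<Otimes>\<^sub>M M)"
    by (simp only: case_prod_unfold fst_conv snd_conv replace_past)
  have [measurable]: "?m \<in> borel_measurable S"
    using m0 by (intro borel_measurable_nn_integral) (simp add: case_prod_unfold)
  have "(\<integral>\<^sup>+x. ennreal (\<bar>proj d f j x\<bar> ^ p) \<partial>law) \<le> (\<integral>\<^sup>+x. ennreal (2 ^ p) * (?m x + ennreal (\<bar>?\<mu>\<bar> ^ p)) \<partial>law)"
    using le by (intro nn_integral_mono) simp
  also have "\<dots> = ennreal (2 ^ p) * (moment p d f + ennreal (\<bar>?\<mu>\<bar> ^ p))"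
    using moment_replace[OF f j, of p] law.emeasure_space_1
    by (subst nn_integral_cmult) (simp_all add: nn_integral_add)
  also have "\<dots> < \<infinity>" using fin by (simp add: ennreal_mult_less_top)
  finally show ?thesis by (intro integrableI_nonneg) auto
qed

lemma integral_proj:
  assumes f: "f \<in> kernels d" and j: "j \<in> {1..d}" and int: "integrable M (\<lambda>\<omega>. f (past {1..d} \<omega>))"
  shows "(\<integral>x. proj d f j x \<partial>law) = 0"
proof -
  have nin: "j \<notin> {1..d} - {j}" by simp
  have int': "integrable M (\<lambda>\<omega>. case (past ({1..d} - {j}) \<omega>, X j \<omega>) of (y, x) \<Rightarrow> f (\<lambda>k\<in>{1..d}. if k = j then x else y k))"
    unfolding case_prod_conv replace_past past_replace[OF j] by (rule int)
  note * = integral_past(1,6)[OF nin measurable_replace[OF f j] int', unfolded case_prod_conv replace_past past_replace[OF j]]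
  show ?thesis
    unfolding Uproj_def Umean_past *(1)
    by (subst Bochner_Integration.integral_diff) (use *(2) law.prob_space[unfolded space_law] in simp_all)
qed

lemma Ucov_eq:
  assumes f: "f \<in> kernels d" and i: "i \<in> {1..d}" and j: "j \<in> {1..d}" and int: "integrable M (\<lambda>\<omega>. f (past {1..d} \<omega>))"
  shows "Ucov M d f X i j = (\<integral>x. proj d f i x * proj d f j x \<partial>law)"
proof -
  note [measurable] = measurable_proj[OF f i] measurable_proj[OF f j]
  show ?thesis
    unfolding Ucov_def covar_def
    using integral_law(1)[of "proj d f i"] integral_law(1)[of "proj d f j"]
      integral_law(1)[of "\<lambda>x. proj d f i x * proj d f j x"]
    by (simp add: integral_proj[OF f i int] integral_proj[OF f j int])
qed

text \<open>The linear part divided by n^(d-1/2) is a normalised sum of independent variables, and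
  its squared L^2-distance from the scaled deviation is O(1/n). Second moments determine the limit
  variance; third moments control the error in the central limit theorem.\<close>

lemma char_Udev:
  assumes f: "f \<in> kernels d" and d: "1 \<le> d" and fin2: "moment 2 d f < \<infinity>" and fin3: "moment 3 d f < \<infinity>"
  shows "(\<lambda>n. char (distr M borel (\<lambda>\<omega>. Udev d f n \<omega> / (real n ^ (d - 1) * sqrt (real n)))) t)
    \<longlonglongrightarrow> exp (- (t\<^sup>2 * Usigma2 M d f X / 2))"
proof -
  have int: "integrable M (\<lambda>\<omega>. f (past {1..d} \<omega>))"
    by (rule moment_finite_integrable[OF f _ fin2]) simp
  let ?\<phi> = "proj d f"
  have [measurable]: "?\<phi> j \<in> borel_measurable S" if "j \<in> {1..d}" for j
    by (rule measurable_proj[OF f that])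
  \<comment> \<open>The weight of f_j(X_k) after division by n^(d-1). In terms of falling ratios it
    visibly lies in [0, 1], and averages over k of products of two weights converge to Beta
    integrals.\<close>
  define w where "w n j k = falling_ratio n (j - 1) (k - 1) * falling_ratio n (d - j) (n - k) / (fact (j - 1) * fact (d - j))" for n j k
  have w0: "0 \<le> w n j k" and w1: "w n j k \<le> 1" if "k \<in> {1..n}" for n j k
  proof -
    have k: "k - 1 \<le> n" "n - k \<le> n" using that by auto
    show "0 \<le> w n j k"
      using falling_ratio_bounds[OF k(1)] falling_ratio_bounds[OF k(2)] by (simp add: w_def)
    have "falling_ratio n (j - 1) (k - 1) * falling_ratio n (d - j) (n - k) \<le> 1"
      using falling_ratio_bounds[OF k(1)] falling_ratio_bounds[OF k(2)] by (intro mult_le_one) auto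
    also have "(1::real) \<le> fact (j - 1) * fact (d - j)"
      using mult_mono[OF fact_ge_1[of "j - 1", where 'a=real] fact_ge_1[of "d - j", where 'a=real]] by simp
    finally show "w n j k \<le> 1"
      by (simp add: w_def)
  qed
  define \<psi> where "\<psi> n k x = (\<Sum>j=1..d. w n j k * ?\<phi> j x)" for n k x
  \<comment> \<open>One function dominating every entry of the array, so that second and third
    moments are bounded uniformly in n and k.\<close>
  define \<Phi> where "\<Phi> x = (\<Sum>j=1..d. \<bar>?\<phi> j x\<bar>)" for x
  define \<xi> where "\<xi> n k \<omega> = \<psi> n k (X k \<omega>)" for n k \<omega>
  have [measurable]: "\<psi> n k \<in> borel_measurable S" for n k
    unfolding \<psi>_def[abs_def] by (intro borel_measurable_sum borel_measurable_times borel_measurable_const measurable_proj[OF f])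
  have [measurable]: "\<Phi> \<in> borel_measurable S"
    unfolding \<Phi>_def[abs_def] by (intro borel_measurable_sum borel_measurable_abs measurable_proj[OF f])
  have \<Phi>0: "0 \<le> \<Phi> x" for x by (simp add: \<Phi>_def sum_nonneg)
  have le: "\<bar>\<psi> n k x\<bar> \<le> \<Phi> x" if k: "k \<in> {1..n}" for n k x
    unfolding \<psi>_def \<Phi>_def
  proof (rule order_trans[OF sum_abs], rule sum_mono)
    fix j
    show "\<bar>w n j k * ?\<phi> j x\<bar> \<le> \<bar>?\<phi> j x\<bar>"
      using mult_right_mono[OF w1[OF k], of "\<bar>?\<phi> j x\<bar>"] w0[OF k] by (simp add: abs_mult)
  qed
  have \<Phi>_int: "integrable law (\<lambda>x. \<Phi> x ^ p)" if p: "1 \<le> p" "moment p d f < \<infinity>" for p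
  proof (rule Bochner_Integration.integrable_bound)
    show "integrable law (\<lambda>x. real d ^ (p - 1) * (\<Sum>j=1..d. \<bar>?\<phi> j x\<bar> ^ p))"
      by (intro integrable_mult_right Bochner_Integration.integrable_sum integrable_proj_power[OF f _ p])
    show "AE x in law. norm (\<Phi> x ^ p) \<le> norm (real d ^ (p - 1) * (\<Sum>j=1..d. \<bar>?\<phi> j x\<bar> ^ p))"
      using abs_sum_power_le[OF p(1), of "\<lambda>j. \<bar>?\<phi> j x\<bar>" "{1..d}" for x]
      by (intro AE_I2) (simp add: \<Phi>_def power_abs sum_nonneg abs_mult)
  qed measurable
  have \<psi>_int: "integrable law (\<lambda>x. \<bar>\<psi> n k x\<bar> ^ p)" and \<psi>_le: "(\<integral>x. \<bar>\<psi> n k x\<bar> ^ p \<partial>law) \<le> (\<integral>x. \<Phi> x ^ p \<partial>law)"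
    if k: "k \<in> {1..n}" and p: "1 \<le> p" "moment p d f < \<infinity>" for n k p
  proof -
    have le': "\<bar>\<psi> n k x\<bar> ^ p \<le> \<Phi> x ^ p" for x
      by (intro power_mono le[OF k]) simp
    show 1: "integrable law (\<lambda>x. \<bar>\<psi> n k x\<bar> ^ p)"
      by (rule Bochner_Integration.integrable_bound[OF \<Phi>_int[OF p]]) (use le' in \<open>auto simp: \<Phi>0\<close>)
    show "(\<integral>x. \<bar>\<psi> n k x\<bar> ^ p \<partial>law) \<le> (\<integral>x. \<Phi> x ^ p \<partial>law)"
      by (intro integral_mono 1 \<Phi>_int[OF p] le')
  qed
  have p1: "integrable law (?\<phi> j)" if "j \<in> {1..d}" for j
    using law.square_integrable_imp_integrable[of "?\<phi> j"] integrable_proj_power[OF f that _ fin2] that by simp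
  have prod_int: "integrable law (\<lambda>x. ?\<phi> i x * ?\<phi> j x)" if ij: "i \<in> {1..d}" "j \<in> {1..d}" for i j
  proof (rule Bochner_Integration.integrable_bound)
    show "integrable law (\<lambda>x. \<bar>?\<phi> i x\<bar>\<^sup>2 + \<bar>?\<phi> j x\<bar>\<^sup>2)"
      using integrable_proj_power[OF f _ _ fin2] ij by (intro Bochner_Integration.integrable_add) auto
    show "AE x in law. norm (?\<phi> i x * ?\<phi> j x) \<le> norm (\<bar>?\<phi> i x\<bar>\<^sup>2 + \<bar>?\<phi> j x\<bar>\<^sup>2)"
      using abs_power_mult_le[of 1 "?\<phi> i x" "?\<phi> j x" for x] by (intro AE_I2) simp
  qed (use ij in measurable)
  let ?L = "\<lambda>i j. fact (i + j - 2) * fact (2 * d - i - j) / (fact (i - 1) * fact (j - 1) * fact (d - i) * fact (d - j) * fact (2 * d - 1)) :: real"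
  have var: "(\<lambda>n. (\<Sum>k=1..n. \<integral>\<omega>. (\<xi> n k \<omega>)\<^sup>2 \<partial>M) / real n) \<longlonglongrightarrow> Usigma2 M d f X"
  proof -
    have "(\<integral>\<omega>. (\<xi> n k \<omega>)\<^sup>2 \<partial>M) = (\<Sum>i=1..d. \<Sum>j=1..d. w n i k * w n j k * Ucov M d f X i j)" for n k
    proof -
      have "(\<integral>\<omega>. (\<xi> n k \<omega>)\<^sup>2 \<partial>M) = (\<integral>x. (\<psi> n k x)\<^sup>2 \<partial>law)"
        unfolding \<xi>_def by (rule integral_law) measurable
      also have "\<dots> = (\<integral>x. (\<Sum>i=1..d. \<Sum>j=1..d. w n i k * w n j k * (?\<phi> i x * ?\<phi> j x)) \<partial>law)"
        unfolding \<psi>_def power2_eq_square sum_product by (simp add: mult_ac)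
      also have "\<dots> = (\<Sum>i=1..d. \<integral>x. (\<Sum>j=1..d. w n i k * w n j k * (?\<phi> i x * ?\<phi> j x)) \<partial>law)"
        by (rule Bochner_Integration.integral_sum)
           (intro Bochner_Integration.integrable_sum integrable_mult_right prod_int)
      also have "\<dots> = (\<Sum>i=1..d. \<Sum>j=1..d. \<integral>x. w n i k * w n j k * (?\<phi> i x * ?\<phi> j x) \<partial>law)"
        by (rule sum.cong[OF refl], rule Bochner_Integration.integral_sum)
           (intro integrable_mult_right prod_int)
      also have "\<dots> = (\<Sum>i=1..d. \<Sum>j=1..d. w n i k * w n j k * (\<integral>x. ?\<phi> i x * ?\<phi> j x \<partial>law))"
        by simp
      also have "\<dots> = (\<Sum>i=1..d. \<Sum>j=1..d. w n i k * w n j k * Ucov M d f X i j)"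
        by (intro sum.cong refl) (simp add: Ucov_eq[OF f _ _ int])
      finally show ?thesis .
    qed
    then have eq: "(\<Sum>k=1..n. \<integral>\<omega>. (\<xi> n k \<omega>)\<^sup>2 \<partial>M) / real n =
        (\<Sum>i=1..d. \<Sum>j=1..d. (\<Sum>k=1..n. w n i k * w n j k) / real n * Ucov M d f X i j)" for n
      by (simp add: sum_divide_distrib sum_distrib_right sum.swap[of _ "{1..d}" "{1..n}"])
    show ?thesis
      unfolding eq Usigma2_def
    proof (intro tendsto_sum tendsto_mult tendsto_const)
      fix i j assume ij: "i \<in> {1..d}" "j \<in> {1..d}"
      \<comment> \<open>With these exponents the Beta integral yields precisely the factorials of
        \<open>Usigma2\<close>; the truncated subtractions are harmless because i and j lie in
        {1..d}.\<close>
      have e: "(i - 1) + (j - 1) = i + j - 2" "(d - i) + (d - j) = 2 * d - i - j"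
        "i + j - 2 + (2 * d - i - j) + 1 = 2 * d - 1"
        using ij by auto
      from tendsto_mult[OF falling_ratio_product_limit[of "i - 1" "d - i" "j - 1" "d - j", unfolded e]
          tendsto_const[of "1 / (fact (i - 1) * fact (j - 1) * fact (d - i) * fact (d - j))"]]
      show "(\<lambda>n. (\<Sum>k=1..n. w n i k * w n j k) / real n) \<longlonglongrightarrow> ?L i j"
        by (simp add: w_def sum_divide_distrib mult_ac)
    qed
  qed
  have clt: "(\<lambda>n. char (distr M borel (\<lambda>\<omega>. (\<Sum>k=1..n. \<xi> n k \<omega>) / sqrt (real n))) t) \<longlonglongrightarrow> exp (- (t\<^sup>2 * Usigma2 M d f X / 2))"
  proof (rule triangular_clt[OF _ _ _ _ _ _ var])
    fix n k
    show "indep_vars (\<lambda>_. borel) (\<xi> n) {1..n}"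
      unfolding \<xi>_def[abs_def]
      by (rule indep_vars_compose2[OF indep_vars_subset[OF indep subset_UNIV]]) measurable
    assume k: "k \<in> {1..n}"
    note i3 = integral_law[of "\<lambda>x. \<bar>\<psi> n k x\<bar> ^ 3" k] and i2 = integral_law[of "\<lambda>x. (\<psi> n k x)\<^sup>2" k]
    show "integrable M (\<lambda>\<omega>. \<bar>\<xi> n k \<omega>\<bar> ^ 3)" "(\<integral>\<omega>. \<bar>\<xi> n k \<omega>\<bar> ^ 3 \<partial>M) \<le> (\<integral>x. \<Phi> x ^ 3 \<partial>law)"
      unfolding \<xi>_def using i3 \<psi>_int[OF k _ fin3] \<psi>_le[OF k _ fin3] by simp_all
    show "integrable M (\<lambda>\<omega>. (\<xi> n k \<omega>)\<^sup>2)" "(\<integral>\<omega>. (\<xi> n k \<omega>)\<^sup>2 \<partial>M) \<le> (\<integral>x. \<Phi> x ^ 2 \<partial>law)"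
      unfolding \<xi>_def using i2 \<psi>_int[OF k _ fin2] \<psi>_le[OF k _ fin2] by simp_all
    have "(\<integral>\<omega>. \<xi> n k \<omega> \<partial>M) = (\<integral>x. \<psi> n k x \<partial>law)"
      unfolding \<xi>_def by (rule integral_law) measurable
    also have "\<dots> = (\<Sum>j=1..d. w n j k * (\<integral>x. ?\<phi> j x \<partial>law))"
      unfolding \<psi>_def using p1 by simp
    also have "\<dots> = 0" using integral_proj[OF f _ int] by simp
    finally show "(\<integral>\<omega>. \<xi> n k \<omega> \<partial>M) = 0" .
  qed
  obtain C where C0: "0 \<le> C" and C: "\<And>n. abs_moment 2 (\<lambda>\<omega>. Udev d f n \<omega> - linear_part d (proj d f) n \<omega>)
      \<le> ennreal (C * real n ^ (2 * (d - 1))) * moment 2 d f"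
    using Udev_linear_part[of d] f fin2 by blast
  define A where "A = enn2real (moment 2 d f)"
  have A0: "0 \<le> A" and A: "moment 2 d f = ennreal A"
    using fin2 by (auto simp: A_def less_top)
  show ?thesis
  proof (rule char_slutsky[OF _ _ clt])
    show "(\<lambda>n. C * A / real n) \<longlonglongrightarrow> 0" using lim_const_over_n[of "C * A"] by simp
    show "(\<lambda>\<omega>. Udev d f n \<omega> / (real n ^ (d - 1) * sqrt (real n))) \<in> borel_measurable M" for n
      using f by measurable
    show "(\<lambda>\<omega>. (\<Sum>k=1..n. \<xi> n k \<omega>) / sqrt (real n)) \<in> borel_measurable M" for n
      unfolding \<xi>_def by measurable
    show "\<forall>\<^sub>F n in sequentially. abs_moment 2 (\<lambda>\<omega>. Udev d f n \<omega> / (real n ^ (d - 1) * sqrt (real n)) - (\<Sum>k=1..n. \<xi> n k \<omega>) / sqrt (real n))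
        \<le> ennreal (C * A / real n)"
      using eventually_gt_at_top[of 0]
    proof eventually_elim
      case (elim n)
      let ?s = "real n ^ (d - 1) * sqrt (real n)"
      have s2: "?s\<^sup>2 = real n ^ (2 * (d - 1)) * real n"
        using elim by (simp add: power_mult_distrib power_mult[symmetric] mult.commute)
      have s0: "0 < ?s" using elim by simp
      have lin: "(\<Sum>k=1..n. \<xi> n k \<omega>) / sqrt (real n) = linear_part d ?\<phi> n \<omega> / ?s" for \<omega>
      proof -
        have "w n j k = real ((k - 1) choose (j - 1)) * real ((n - k) choose (d - j)) / real n ^ (d - 1)" if "j \<in> {1..d}" for j k
        proof -
          have "d - 1 = (j - 1) + (d - j)" using that by auto
          then have "real n ^ (d - 1) = real n ^ (j - 1) * real n ^ (d - j)"
            by (simp only: power_add)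
          then show ?thesis
            by (simp add: w_def falling_ratio_def)
        qed
        then have "(\<Sum>k=1..n. \<xi> n k \<omega>) = (\<Sum>k=1..n. \<Sum>j=1..d. real ((k - 1) choose (j - 1)) * real ((n - k) choose (d - j)) * ?\<phi> j (X k \<omega>) / real n ^ (d - 1))"
          unfolding \<xi>_def \<psi>_def by (intro sum.cong refl) simp
        also have "\<dots> = linear_part d ?\<phi> n \<omega> / real n ^ (d - 1)"
          unfolding linear_part_def sum_divide_distrib by (rule sum.swap)
        finally show ?thesis by simp
      qed
      have "abs_moment 2 (\<lambda>\<omega>. Udev d f n \<omega> / ?s - (\<Sum>k=1..n. \<xi> n k \<omega>) / sqrt (real n))
        = (\<integral>\<^sup>+\<omega>. ennreal (1 / ?s\<^sup>2) * ennreal (\<bar>Udev d f n \<omega> - linear_part d ?\<phi> n \<omega>\<bar>\<^sup>2) \<partial>M)"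
        unfolding lin diff_divide_distrib[symmetric] abs_divide power_divide
        by (simp add: ennreal_mult[symmetric])
      also have "\<dots> = ennreal (1 / ?s\<^sup>2) * abs_moment 2 (\<lambda>\<omega>. Udev d f n \<omega> - linear_part d ?\<phi> n \<omega>)"
        using f measurable_linear_part[of d ?\<phi> n, OF measurable_proj[OF f]] by (intro nn_integral_cmult) measurable
      also have "\<dots> \<le> ennreal (1 / ?s\<^sup>2) * (ennreal (C * real n ^ (2 * (d - 1))) * moment 2 d f)"
        by (intro mult_left_mono C) simp
      also have "\<dots> = ennreal (1 / ?s\<^sup>2 * (C * real n ^ (2 * (d - 1)) * A))"
        unfolding A using C0 A0 by (simp add: ennreal_mult[symmetric])
      also have "1 / ?s\<^sup>2 * (C * real n ^ (2 * (d - 1)) * A) = C * A / real n"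
        unfolding s2 using elim by simp
      finally show ?case .
    qed
  qed
qed

end

section \<open>Maximal bounds\<close>

lemma sum_inverse_squares_le: "(\<Sum>j=1..n. 1 / (real j)\<^sup>2) \<le> 2"
proof -
  have "(\<Sum>j=1..n. 1 / (real j)\<^sup>2) \<le> 2 - 1 / real n" if "1 \<le> n"
    using that
  proof (induction n rule: nat_induct_at_least)
    case (Suc n)
    then have "1 / (real (Suc n))\<^sup>2 \<le> 1 / (real n * real (Suc n))"
      by (intro divide_left_mono) (auto simp: power2_eq_square)
    also have "\<dots> = 1 / real n - 1 / real (Suc n)"
      using Suc.hyps by (simp add: field_simps)
    finally show ?case using Suc.IH by simp
  qed simp
  then show ?thesis by (cases "n = 0") (auto intro: order_trans)
qed

lemma sum_inverse_square_distances_le: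
  "(\<Sum>k\<in>{..<N} - {n}. 1 / \<bar>real k - real n\<bar>\<^sup>2) \<le> 4"
proof -
  have "(\<Sum>k\<in>{..<N} - {n}. 1 / \<bar>real k - real n\<bar>\<^sup>2) \<le> (\<Sum>k\<in>{..<n} \<union> {n+1..n+N}. 1 / \<bar>real k - real n\<bar>\<^sup>2)"
    by (intro sum_mono2) auto
  also have "\<dots> = (\<Sum>k\<in>{..<n}. 1 / \<bar>real k - real n\<bar>\<^sup>2) + (\<Sum>k\<in>{n+1..n+N}. 1 / \<bar>real k - real n\<bar>\<^sup>2)"
    by (rule sum.union_disjoint) auto
  also have "(\<Sum>k\<in>{..<n}. 1 / \<bar>real k - real n\<bar>\<^sup>2) = (\<Sum>j=1..n. 1 / (real j)\<^sup>2)"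
    by (rule sum.reindex_bij_witness[of _ "\<lambda>j. n - j" "\<lambda>k. n - k"]) (auto simp: of_nat_diff power2_commute)
  also have "(\<Sum>k\<in>{n+1..n+N}. 1 / \<bar>real k - real n\<bar>\<^sup>2) = (\<Sum>j=1..N. 1 / (real j)\<^sup>2)"
    by (rule sum.reindex_bij_witness[of _ "\<lambda>j. n + j" "\<lambda>k. k - n"]) (auto simp: of_nat_diff)
  finally show ?thesis
    using sum_inverse_squares_le[of n] sum_inverse_squares_le[of N] by linarith
qed

context iid_sequence
begin

text \<open>Take a^(4r) to be the sum over k of |Z_k - Z_n|^(4r) divided by the 4r-th power of |k -
  n|^(3/4) max(k,n)^(d-1); it dominates every single term. The k-th term has mean O(|k - n|^(-r)),
  summable uniformly in n once r >= 2. The factor \<open>a\<close> may depend on n, but C may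
  not.\<close>

lemma increment_envelope:
  assumes f: "f \<in> kernels d" and d: "1 \<le> d" and r: "2 \<le> r" and fin: "moment (4 * r) d f < \<infinity>"
  shows "\<exists>C\<ge>0. \<forall>n. \<exists>a \<in> borel_measurable M. (\<forall>\<omega>. 0 \<le> a \<omega>) \<and>
    (\<integral>\<^sup>+\<omega>. ennreal (a \<omega> ^ (4 * r)) \<partial>M) \<le> ennreal C \<and>
    (AE \<omega> in M. \<forall>k. \<bar>Udev d f k \<omega> - Udev d f n \<omega>\<bar>
      \<le> a \<omega> * root 4 \<bar>real k - real n\<bar> ^ 3 * real (max k n) ^ (d - 1))"
proof -
  note [measurable] = measurable_Udev[OF f]
  have q: "1 \<le> 2 * r" "2 * (2 * r) = 4 * r" using r by auto
  obtain B where B0: "0 \<le> B" and B: "\<And>n m. n \<le> m \<Longrightarrow>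
    abs_moment (4 * r) (\<lambda>\<omega>. Udev d f m \<omega> - Udev d f n \<omega>)
      \<le> ennreal (B * real (m - n) ^ (2 * r) * real m ^ (4 * r * (d - 1))) * moment (4 * r) d f"
    using Udev_moment_bound[OF q(1), of d] f fin unfolding q(2) by blast
  define A where "A = enn2real (moment (4 * r) d f)"
  have A0: "0 \<le> A" and A: "moment (4 * r) d f = ennreal A"
    using fin by (auto simp: A_def less_top)
  show ?thesis
  proof (intro exI[of _ "4 * (B * A)"] conjI allI)
    show "0 \<le> 4 * (B * A)" using A0 B0 by simp
    fix n
    define s where "s k = \<bar>real k - real n\<bar>" for k
    define m where "m k = real (max k n)" for k
    \<comment> \<open>The 4r-th power of s^(3/4) m^(d-1), hence free of roots. At k = n it is 0, and
      so is the quotient by it.\<close>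
    define W where "W k = s k ^ (3 * r) * m k ^ (4 * r * (d - 1))" for k
    define \<Xi> where "\<Xi> \<omega> = (\<Sum>k. ennreal (\<bar>Udev d f k \<omega> - Udev d f n \<omega>\<bar> ^ (4 * r) / W k))" for \<omega>
    have W0: "0 \<le> W k" for k by (simp add: W_def s_def m_def)
    have [measurable]: "\<Xi> \<in> borel_measurable M"
      unfolding \<Xi>_def[abs_def] by measurable
    have incr: "abs_moment (4 * r) (\<lambda>\<omega>. Udev d f k \<omega> - Udev d f n \<omega>)
        \<le> ennreal (B * s k ^ (2 * r) * m k ^ (4 * r * (d - 1)) * A)" for k
    proof (cases "n \<le> k")
      case True
      have "abs_moment (4 * r) (\<lambda>\<omega>. Udev d f k \<omega> - Udev d f n \<omega>)
        \<le> ennreal (B * real (k - n) ^ (2 * r) * real k ^ (4 * r * (d - 1))) * moment (4 * r) d f"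
        by (rule B[OF True])
      then show ?thesis
        using True B0 A0 by (simp add: A ennreal_mult[symmetric] s_def m_def of_nat_diff max_def)
    next
      case False
      then have k: "k \<le> n" by simp
      have "abs_moment (4 * r) (\<lambda>\<omega>. Udev d f n \<omega> - Udev d f k \<omega>)
        \<le> ennreal (B * real (n - k) ^ (2 * r) * real n ^ (4 * r * (d - 1))) * moment (4 * r) d f"
        by (rule B[OF k])
      then show ?thesis
        using False B0 A0
        by (simp add: A ennreal_mult[symmetric] s_def m_def of_nat_diff max_def abs_minus_commute)
    qed
    have term_le: "(\<integral>\<^sup>+\<omega>. ennreal (\<bar>Udev d f k \<omega> - Udev d f n \<omega>\<bar> ^ (4 * r) / W k) \<partial>M)
        \<le> ennreal (if k = n then 0 else B * A * (1 / (s k)\<^sup>2))" for k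
    proof (cases "k = n")
      case True
      then show ?thesis using r by (simp add: power_0_left)
    next
      case False
      have s1: "1 \<le> s k" using False by (auto simp: s_def)
      have m1: "1 \<le> m k" using False by (auto simp: m_def)
      have W: "0 < W k" using s1 m1 by (simp add: W_def)
      have "(\<integral>\<^sup>+\<omega>. ennreal (\<bar>Udev d f k \<omega> - Udev d f n \<omega>\<bar> ^ (4 * r) / W k) \<partial>M)
        = (\<integral>\<^sup>+\<omega>. ennreal (1 / W k) * ennreal (\<bar>Udev d f k \<omega> - Udev d f n \<omega>\<bar> ^ (4 * r)) \<partial>M)"
        using W by (intro nn_integral_cong) (simp add: ennreal_mult[symmetric])
      also have "\<dots> = ennreal (1 / W k) * abs_moment (4 * r) (\<lambda>\<omega>. Udev d f k \<omega> - Udev d f n \<omega>)"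
        by (intro nn_integral_cmult) measurable
      also have "\<dots> \<le> ennreal (1 / W k) * ennreal (B * s k ^ (2 * r) * m k ^ (4 * r * (d - 1)) * A)"
        by (intro mult_left_mono incr) simp
      also have "\<dots> = ennreal (1 / W k * (B * s k ^ (2 * r) * m k ^ (4 * r * (d - 1)) * A))"
        using W by (subst ennreal_mult'[symmetric]) auto
      also have "1 / W k * (B * s k ^ (2 * r) * m k ^ (4 * r * (d - 1)) * A) = B * A * (1 / s k ^ r)"
      proof -
        have "s k ^ (3 * r) = s k ^ (2 * r) * s k ^ r" by (simp add: power_add[symmetric])
        then show ?thesis using s1 m1 by (simp add: W_def)
      qed
      also have "\<dots> \<le> B * A * (1 / (s k)\<^sup>2)"
        using s1 A0 B0 r by (intro mult_left_mono divide_left_mono power_increasing) auto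
      finally show ?thesis using False by (simp add: ennreal_leI)
    qed
    have \<Xi>_int: "(\<integral>\<^sup>+\<omega>. \<Xi> \<omega> \<partial>M) \<le> ennreal (4 * (B * A))"
    proof -
      have "(\<integral>\<^sup>+\<omega>. \<Xi> \<omega> \<partial>M) = (\<Sum>k. \<integral>\<^sup>+\<omega>. ennreal (\<bar>Udev d f k \<omega> - Udev d f n \<omega>\<bar> ^ (4 * r) / W k) \<partial>M)"
        unfolding \<Xi>_def by (intro nn_integral_suminf) measurable
      also have "\<dots> \<le> (\<Sum>k. ennreal (if k = n then 0 else B * A * (1 / (s k)\<^sup>2)))"
        by (intro suminf_le term_le) auto
      also have "\<dots> \<le> ennreal (4 * (B * A))"
      proof (rule suminf_le_const)
        fix N
        have "(\<Sum>k<N. ennreal (if k = n then 0 else B * A * (1 / (s k)\<^sup>2))) = ennreal (\<Sum>k<N. if k = n then 0 else B * A * (1 / (s k)\<^sup>2))"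
          using A0 B0 by (intro sum_ennreal) auto
        also have "(\<Sum>k<N. if k = n then 0 else B * A * (1 / (s k)\<^sup>2)) = (\<Sum>k\<in>{..<N} - {n}. B * A * (1 / (s k)\<^sup>2))"
          by (rule sum.mono_neutral_cong_right) auto
        also have "\<dots> = B * A * (\<Sum>k\<in>{..<N} - {n}. 1 / \<bar>real k - real n\<bar>\<^sup>2)"
          by (simp add: sum_distrib_left s_def)
        also have "\<dots> \<le> B * A * 4"
          using A0 B0 by (intro mult_left_mono sum_inverse_square_distances_le) auto
        finally show "(\<Sum>k<N. ennreal (if k = n then 0 else B * A * (1 / (s k)\<^sup>2))) \<le> ennreal (4 * (B * A))"
          by (simp add: ennreal_leI mult_ac)
      qed auto
      finally show ?thesis .
    qed
    \<comment> \<open>\<open>enn2real\<close> sends an infinite sum to 0; this affects only a null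
      set, because the expectation of the sum is finite.\<close>
    define a where "a \<omega> = root (4 * r) (enn2real (\<Xi> \<omega>))" for \<omega>
    have r4: "0 < 4 * r" using r by simp
    have a0: "0 \<le> a \<omega>" for \<omega> unfolding a_def using r4 by (intro real_root_ge_zero) auto
    have a_pow: "a \<omega> ^ (4 * r) = enn2real (\<Xi> \<omega>)" for \<omega>
      unfolding a_def using r4 by (intro real_root_pow_pos2) auto
    show "\<exists>a\<in>borel_measurable M. (\<forall>\<omega>. 0 \<le> a \<omega>) \<and>
      (\<integral>\<^sup>+\<omega>. ennreal (a \<omega> ^ (4 * r)) \<partial>M) \<le> ennreal (4 * (B * A)) \<and>
      (AE \<omega> in M. \<forall>k. \<bar>Udev d f k \<omega> - Udev d f n \<omega>\<bar>
        \<le> a \<omega> * root 4 \<bar>real k - real n\<bar> ^ 3 * real (max k n) ^ (d - 1))"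
    proof (intro bexI[of _ a] conjI allI a0)
      show "a \<in> borel_measurable M" unfolding a_def[abs_def] by measurable
      have "(\<integral>\<^sup>+\<omega>. ennreal (a \<omega> ^ (4 * r)) \<partial>M) \<le> (\<integral>\<^sup>+\<omega>. \<Xi> \<omega> \<partial>M)"
        unfolding a_pow by (intro nn_integral_mono) (simp add: ennreal_enn2real_if)
      with \<Xi>_int show "(\<integral>\<^sup>+\<omega>. ennreal (a \<omega> ^ (4 * r)) \<partial>M) \<le> ennreal (4 * (B * A))"
        by (rule order_trans[rotated])
      have "AE \<omega> in M. \<Xi> \<omega> \<noteq> \<infinity>"
        using le_less_trans[OF \<Xi>_int ennreal_less_top] by (intro nn_integral_PInf_AE) auto
      then show "AE \<omega> in M. \<forall>k. \<bar>Udev d f k \<omega> - Udev d f n \<omega>\<bar>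
        \<le> a \<omega> * root 4 \<bar>real k - real n\<bar> ^ 3 * real (max k n) ^ (d - 1)"
      proof eventually_elim
        case (elim \<omega>)
        show ?case
        proof
          fix k
          show "\<bar>Udev d f k \<omega> - Udev d f n \<omega>\<bar> \<le> a \<omega> * root 4 \<bar>real k - real n\<bar> ^ 3 * real (max k n) ^ (d - 1)"
          proof (cases "k = n")
            case False
            have s1: "1 \<le> s k" using False by (auto simp: s_def)
            have m1: "1 \<le> m k" using False by (auto simp: m_def)
            have W: "0 < W k" using s1 m1 by (simp add: W_def)
            have "ennreal (\<bar>Udev d f k \<omega> - Udev d f n \<omega>\<bar> ^ (4 * r) / W k) \<le> \<Xi> \<omega>"
              unfolding \<Xi>_def
              using sum_le_suminf[of "\<lambda>k. ennreal (\<bar>Udev d f k \<omega> - Udev d f n \<omega>\<bar> ^ (4 * r) / W k)" "{k}"] by simp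
            also have "\<Xi> \<omega> = ennreal (enn2real (\<Xi> \<omega>))" using elim by (simp add: less_top)
            finally have "\<bar>Udev d f k \<omega> - Udev d f n \<omega>\<bar> ^ (4 * r) / W k \<le> a \<omega> ^ (4 * r)"
              unfolding a_pow by simp
            then have "\<bar>Udev d f k \<omega> - Udev d f n \<omega>\<bar> ^ (4 * r) \<le> a \<omega> ^ (4 * r) * W k"
              using W by (simp add: divide_le_eq)
            also have "\<dots> = (a \<omega> * root 4 (s k) ^ 3 * m k ^ (d - 1)) ^ (4 * r)"
            proof -
              have "(root 4 (s k) ^ 3) ^ (4 * r) = (root 4 (s k) ^ 4) ^ (3 * r)"
                unfolding power_mult[symmetric] by (simp add: mult_ac)
              also have "root 4 (s k) ^ 4 = s k" using s1 by simp
              finally show ?thesis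
                by (simp add: W_def power_mult_distrib power_mult[symmetric] mult_ac)
            qed
            finally have "\<bar>Udev d f k \<omega> - Udev d f n \<omega>\<bar> ^ (4 * r) \<le> (a \<omega> * root 4 (s k) ^ 3 * m k ^ (d - 1)) ^ (4 * r)" .
            then have "\<bar>Udev d f k \<omega> - Udev d f n \<omega>\<bar> \<le> a \<omega> * root 4 (s k) ^ 3 * m k ^ (d - 1)"
              using a0 s1 m1 r4 by (subst (asm) power_mono_iff) auto
            then show ?thesis by (simp add: s_def m_def)
          qed simp
        qed
      qed
    qed
  qed
qed

text \<open>Z_n is its own increment from index 0, and the scale n^(d-1/2) matches the growth n^q
  n^(2q(d-1)) of the 2q-th moment bound.\<close>

lemma scaled_Udev_moment:
  assumes f: "f \<in> kernels d" and d: "1 \<le> d" and q: "1 \<le> q" and fin: "moment (2 * q) d f < \<infinity>"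
  shows "\<exists>C\<ge>0. \<forall>n\<ge>1. abs_moment (2 * q) (\<lambda>\<omega>. Udev d f n \<omega> / (real n ^ (d - 1) * sqrt (real n))) \<le> ennreal C"
proof -
  note [measurable] = measurable_Udev[OF f]
  obtain B where B0: "0 \<le> B" and B: "\<And>n m. n \<le> m \<Longrightarrow>
    abs_moment (2 * q) (\<lambda>\<omega>. Udev d f m \<omega> - Udev d f n \<omega>)
      \<le> ennreal (B * real (m - n) ^ q * real m ^ (2 * q * (d - 1))) * moment (2 * q) d f"
    using Udev_moment_bound[OF q, of d] f fin by blast
  define A where "A = enn2real (moment (2 * q) d f)"
  have A0: "0 \<le> A" and A: "moment (2 * q) d f = ennreal A"
    using fin by (auto simp: A_def less_top)
  show ?thesis
  proof (intro exI[of _ "B * A"] conjI allI impI)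
    show "0 \<le> B * A" using A0 B0 by simp
    fix n :: nat assume n: "1 \<le> n"
    let ?v = "real n ^ (d - 1) * sqrt (real n)"
    have v0: "0 < ?v" using n by simp
    have v: "?v ^ (2 * q) = real n ^ q * real n ^ (2 * q * (d - 1))"
    proof -
      have "?v ^ (2 * q) = real n ^ ((d - 1) * (2 * q)) * ((sqrt (real n))\<^sup>2) ^ q"
        by (simp only: power_mult_distrib power_mult[symmetric])
      then show ?thesis by (simp add: mult_ac)
    qed
    have "abs_moment (2 * q) (\<lambda>\<omega>. Udev d f n \<omega> / ?v)
      = (\<integral>\<^sup>+\<omega>. ennreal (1 / ?v ^ (2 * q)) * ennreal (\<bar>Udev d f n \<omega> - Udev d f 0 \<omega>\<bar> ^ (2 * q)) \<partial>M)"
      using v0 by (intro nn_integral_cong) (simp add: ennreal_mult[symmetric] Udev_at_0[OF d] abs_divide power_divide)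
    also have "\<dots> = ennreal (1 / ?v ^ (2 * q)) * abs_moment (2 * q) (\<lambda>\<omega>. Udev d f n \<omega> - Udev d f 0 \<omega>)"
      by (intro nn_integral_cmult) measurable
    also have "\<dots> \<le> ennreal (1 / ?v ^ (2 * q)) * (ennreal (B * real (n - 0) ^ q * real n ^ (2 * q * (d - 1))) * moment (2 * q) d f)"
      by (intro mult_left_mono B) auto
    also have "\<dots> = ennreal (1 / ?v ^ (2 * q) * (B * real n ^ q * real n ^ (2 * q * (d - 1)) * A))"
      using v0 A0 B0 by (simp add: A ennreal_mult[symmetric])
    also have "1 / ?v ^ (2 * q) * (B * real n ^ q * real n ^ (2 * q * (d - 1)) * A) = B * A"
      unfolding v using n by simp
    finally show "abs_moment (2 * q) (\<lambda>\<omega>. Udev d f n \<omega> / ?v) \<le> ennreal (B * A)" .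
  qed
qed

end

section \<open>Deterministic inversion\<close>

lemma power_diff_lower:
  fixes x y :: real
  assumes "0 \<le> y" "y \<le> x" "1 \<le> d"
  shows "(x - y) * x ^ (d - 1) \<le> x ^ d - y ^ d"
proof -
  obtain e where d: "d = Suc e" using assms(3) by (cases d) auto
  have "y * y ^ e \<le> y * x ^ e"
    using assms by (intro mult_left_mono power_mono) auto
  then show ?thesis by (simp add: d algebra_simps)
qed

lemma power_diff_upper:
  fixes x y :: real
  assumes "0 \<le> y" "y \<le> x" "1 \<le> d"
  shows "x ^ d - y ^ d \<le> real d * (x - y) * x ^ (d - 1)"
  using assms(3)
proof (induction d rule: nat_induct_at_least)
  case (Suc d)
  have "x ^ Suc d - y ^ Suc d = x * (x ^ d - y ^ d) + (x - y) * y ^ d"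
    by (simp add: algebra_simps)
  also have "\<dots> \<le> x * (real d * (x - y) * x ^ (d - 1)) + (x - y) * x ^ d"
    using Suc assms by (intro add_mono mult_left_mono power_mono) auto
  also have "\<dots> = real (Suc d) * (x - y) * x ^ d"
    using Suc.hyps by (cases d) (simp_all add: algebra_simps)
  finally show ?case by simp
qed simp

text \<open>A Taylor remainder, with recursion R_(d+1) = x R_d + d y^(d-1) (x - y)^2. The factor y
  on the left permits the exponent d - 1 in place of d - 2, which truncated subtraction would spoil
  at d = 1.\<close>

lemma power_diff_second_order:
  fixes x y M :: real
  assumes "0 \<le> x" "0 \<le> y" "x \<le> M" "y \<le> M" "1 \<le> d"
  shows "y * \<bar>x ^ d - y ^ d - real d * y ^ (d - 1) * (x - y)\<bar> \<le> (real d)\<^sup>2 * (x - y)\<^sup>2 * M ^ (d - 1)"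
  using assms(5)
proof (induction d rule: nat_induct_at_least)
  case (Suc d)
  let ?R = "x ^ d - y ^ d - real d * y ^ (d - 1) * (x - y)"
  have "x ^ Suc d - y ^ Suc d - real (Suc d) * y ^ d * (x - y) = x * ?R + real d * y ^ (d - 1) * (x - y)\<^sup>2"
    using Suc.hyps by (cases d) (simp_all add: algebra_simps power2_eq_square)
  then have "y * \<bar>x ^ Suc d - y ^ Suc d - real (Suc d) * y ^ d * (x - y)\<bar>
      \<le> y * (\<bar>x * ?R\<bar> + \<bar>real d * y ^ (d - 1) * (x - y)\<^sup>2\<bar>)"
    using assms(2) by (simp only:) (intro mult_left_mono abs_triangle_ineq)
  also have "\<dots> = x * (y * \<bar>?R\<bar>) + real d * (y * y ^ (d - 1)) * (x - y)\<^sup>2"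
  proof -
    have "\<bar>x * ?R\<bar> = x * \<bar>?R\<bar>" "\<bar>real d * y ^ (d - 1) * (x - y)\<^sup>2\<bar> = real d * y ^ (d - 1) * (x - y)\<^sup>2"
      using assms by (simp_all add: abs_mult)
    then show ?thesis by (simp only: distrib_left mult_ac)
  qed
  also have "y * y ^ (d - 1) = y ^ d"
    using Suc.hyps by (cases d) auto
  also have "x * (y * \<bar>?R\<bar>) + real d * y ^ d * (x - y)\<^sup>2
      \<le> M * ((real d)\<^sup>2 * (x - y)\<^sup>2 * M ^ (d - 1)) + real d * M ^ d * (x - y)\<^sup>2"
  proof (rule add_mono)
    show "x * (y * \<bar>?R\<bar>) \<le> M * ((real d)\<^sup>2 * (x - y)\<^sup>2 * M ^ (d - 1))"
      using assms by (intro mult_mono[OF _ Suc.IH]) auto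
    show "real d * y ^ d * (x - y)\<^sup>2 \<le> real d * M ^ d * (x - y)\<^sup>2"
      using assms by (intro mult_right_mono mult_left_mono power_mono) auto
  qed
  also have "\<dots> = ((real d)\<^sup>2 + real d) * ((x - y)\<^sup>2 * M ^ d)"
    using Suc.hyps by (cases d) (simp_all add: algebra_simps)
  also have "\<dots> \<le> (real (Suc d))\<^sup>2 * ((x - y)\<^sup>2 * M ^ d)"
  proof (rule mult_right_mono)
    show "(real d)\<^sup>2 + real d \<le> (real (Suc d))\<^sup>2"
      by (simp add: power2_eq_square algebra_simps)
    show "0 \<le> (x - y)\<^sup>2 * M ^ d" using assms by simp
  qed
  finally show ?case by (simp add: mult_ac)
qed simp

lemma choose_power_approx:
  assumes "1 \<le> d"
  shows "\<bar>fact d * real (m choose d) - real m ^ d\<bar> \<le> (real d)\<^sup>2 * real m ^ (d - 1)"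
proof (cases "m = 0")
  case True
  then show ?thesis using assms by (cases d) auto
next
  case False
  have "\<bar>fact d * real (m choose d) / real m ^ d - 1\<bar> \<le> real (d * d) / real m"
    using falling_ratio_power[of m m d] False by (simp add: falling_ratio_def)
  then have "\<bar>fact d * real (m choose d) / real m ^ d - 1\<bar> * real m ^ d \<le> real (d * d) / real m * real m ^ d"
    by (rule mult_right_mono) simp
  moreover have "\<bar>fact d * real (m choose d) / real m ^ d - 1\<bar> * real m ^ d = \<bar>(fact d * real (m choose d) / real m ^ d - 1) * real m ^ d\<bar>"
    by (simp add: abs_mult)
  moreover have "(fact d * real (m choose d) / real m ^ d - 1) * real m ^ d = fact d * real (m choose d) - real m ^ d"
    using False by (simp add: field_simps)
  moreover have "real (d * d) / real m * real m ^ d = (real d)\<^sup>2 * real m ^ (d - 1)"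
    using False assms by (cases d) (simp_all add: power2_eq_square field_simps)
  ultimately show ?thesis by simp
qed

text \<open>With r the fourth root of s + 1, where s is the distance to the crossing index: either r
  <= 2B, or B r^3 is at most half of r^4 and can be absorbed on the left.\<close>

lemma le_root_bootstrap:
  fixes r A B :: real
  assumes "0 \<le> r" "0 \<le> A" "0 \<le> B" "r ^ 4 \<le> A + B * r ^ 3"
  shows "r ^ 4 \<le> 2 * A + 16 * B ^ 4"
proof (cases "r \<le> 2 * B")
  case True
  then have "r ^ 4 \<le> (2 * B) ^ 4" using assms by (intro power_mono) auto
  then show ?thesis using assms by (simp add: power_mult_distrib)
next
  case False
  have "2 * (B * r ^ 3) \<le> r * r ^ 3"
    using False assms mult_right_mono[of "2 * B" r "r ^ 3"] by simp
  also have "r * r ^ 3 = r ^ 4" by (simp add: power4_eq_xxxx power3_eq_cube)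
  finally have "r ^ 4 \<le> 2 * A" using assms(4) by simp
  moreover have "0 \<le> 16 * B ^ 4" by simp
  ultimately show ?thesis by linarith
qed

text \<open>
  Here \<open>root 4 s ^ 3\<close> and \<open>root 8 n\<close> stand for \<open>s^(3/4)\<close> and \<open>n^(1/8)\<close>. A crude version of the estimate,
  bootstrapped from \<open>s \<le> A + B s^(3/4)\<close>, bounds \<open>m - n\<close> by \<open>O(\<surd>n)\<close>; a second-order expansion of the power
  then gives the sharp one.
\<close>

lemma crossing_estimate:
  fixes \<mu> :: real
  assumes d: "1 \<le> d" and \<mu>: "0 < \<mu>"
  defines "\<beta> \<equiv> \<mu> / fact d"
  shows "\<exists>K\<ge>1. \<forall>n m x Z a b. 1 \<le> n \<longrightarrow> 0 \<le> a \<longrightarrow> 0 \<le> b \<longrightarrow>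
    \<beta> * real n ^ d \<le> x \<longrightarrow> x \<le> \<beta> * (real n + 1) ^ d \<longrightarrow>
    \<mu> * real (m choose d) + Z m \<le> x \<longrightarrow> x \<le> \<mu> * real (Suc m choose d) + Z (Suc m) \<longrightarrow>
    (\<forall>k. \<bar>Z k - Z n\<bar> \<le> a * root 4 \<bar>real k - real n\<bar> ^ 3 * real (max k n) ^ (d - 1)) \<longrightarrow>
    \<bar>Z n\<bar> \<le> b * (real n ^ (d - 1) * sqrt (real n)) \<longrightarrow>
    \<bar>real m - real n\<bar> + 1 \<le> K * (1 + a + b) ^ 4 * sqrt (real n) \<and>
    \<bar>(real m - real n) / sqrt (real n) + Z n / (\<beta> * real d * (real n ^ (d - 1) * sqrt (real n)))\<bar>
      \<le> K * (1 + a + b) ^ (4 * d + 4) / root 8 (real n)"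
proof -
  have \<beta>: "0 < \<beta>" using \<mu> by (simp add: \<beta>_def)
  have d0: "0 < real d" using d by simp
  \<comment> \<open>In K2 the 1 pays for \<open>a\<close>, \<mu> for the jump from m to m + 1,
    \<beta> d^2 for replacing binomial coefficients by powers, and the last term for replacing x by
    \<beta> n^d. K3 is the constant of the inequality to be bootstrapped, K4 the outcome of the
    bootstrap, and K6 collects the second-order estimate.\<close>
  define K2 where "K2 = 1 + \<mu> + \<beta> * (real d)\<^sup>2 + \<beta> * (real d * 2 ^ (d - 1))"
  define K3 where "K3 = (2 ^ (d - 1) * (1 + K2) + \<beta>) / \<beta>"
  define K4 where "K4 = 2 * K3 + 16 * K3 ^ 4"
  define K6 where "K6 = (2 * K4) ^ (d - 1) * (K2 * K4 ^ 3 + \<beta> * (real d)\<^sup>2 * K4\<^sup>2) / (\<beta> * real d)"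
  have K2: "1 \<le> K2" using \<mu> \<beta> by (simp add: K2_def)
  have K3: "1 \<le> K3" using K2 \<beta> by (simp add: K3_def)
  have K4: "1 \<le> K4" using K3 one_le_power[OF K3, of 4] unfolding K4_def by linarith
  have K6: "0 \<le> K6" using K4 K2 \<beta> by (simp add: K6_def)
  show ?thesis
  proof (intro exI[of _ "max K4 K6"] conjI[of "1 \<le> max K4 K6"] allI impI)
    show "1 \<le> max K4 K6" using K4 by simp
    fix n m :: nat and x a b :: real and Z :: "nat \<Rightarrow> real"
    assume n: "1 \<le> n" and a: "0 \<le> a" and b: "0 \<le> b"
      and x1: "\<beta> * real n ^ d \<le> x" and x2: "x \<le> \<beta> * (real n + 1) ^ d"
      and m1: "\<mu> * real (m choose d) + Z m \<le> x" and m2: "x \<le> \<mu> * real (Suc m choose d) + Z (Suc m)"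
      and Z: "\<forall>k. \<bar>Z k - Z n\<bar> \<le> a * root 4 \<bar>real k - real n\<bar> ^ 3 * real (max k n) ^ (d - 1)"
      and Zn: "\<bar>Z n\<bar> \<le> b * (real n ^ (d - 1) * sqrt (real n))"
    define w where "w = 1 + a + b"
    define s where "s = \<bar>real m - real n\<bar>"
    \<comment> \<open>The added 1 makes y cover the distances of both m and m + 1 from n, and gives
      y >= 1; likewise \<open>M\<close> covers both indices.\<close>
    define y where "y = s + 1"
    define r where "r = root 4 y"
    define M where "M = real (max (Suc m) n)"
    define \<rho> where "\<rho> = root 8 (real n)"
    have w: "1 \<le> w" using a b by (simp add: w_def)
    have s0: "0 \<le> s" by (simp add: s_def)
    have y1: "1 \<le> y" using s0 by (simp add: y_def)
    have r1: "1 \<le> r" unfolding r_def using y1 by simp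
    have r4: "r ^ 4 = y" using y1 by (simp add: r_def)
    have M1: "1 \<le> M" and Mn: "real n \<le> M" and Mm: "real m \<le> M" by (auto simp: M_def)
    have Mp: "0 < M ^ (d - 1)" "1 \<le> M ^ (d - 1)" using M1 by auto
    have \<rho>1: "1 \<le> \<rho>" using n by (simp add: \<rho>_def)
    have \<rho>8: "\<rho> ^ 8 = real n" by (simp add: \<rho>_def)
    have \<rho>4: "\<rho> ^ 4 = sqrt (real n)"
      using \<rho>1 \<rho>8 by (intro real_sqrt_unique[symmetric]) (auto simp: power_mult[symmetric])
    have sn: "1 \<le> sqrt (real n)" using n by simp
    have r3: "1 \<le> r ^ 3" using r1 by (rule one_le_power)
    have Zm: "\<bar>Z m - Z n\<bar> \<le> a * r ^ 3 * M ^ (d - 1)"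
    proof -
      have "\<bar>Z m - Z n\<bar> \<le> a * root 4 s ^ 3 * real (max m n) ^ (d - 1)"
        using Z by (simp add: s_def)
      also have "\<dots> \<le> a * r ^ 3 * M ^ (d - 1)"
        using a s0 by (intro mult_mono mult_left_mono power_mono) (auto simp: r_def y_def M_def)
      finally show ?thesis .
    qed
    have ZSm: "\<bar>Z (Suc m) - Z n\<bar> \<le> a * r ^ 3 * M ^ (d - 1)"
    proof -
      have "\<bar>Z (Suc m) - Z n\<bar> \<le> a * root 4 \<bar>real (Suc m) - real n\<bar> ^ 3 * M ^ (d - 1)"
        using Z unfolding M_def by blast
      also have "\<dots> \<le> a * r ^ 3 * M ^ (d - 1)"
        using a M1 by (intro mult_mono mult_left_mono power_mono) (auto simp: r_def y_def s_def)
      finally show ?thesis .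
    qed
    have ch: "real (Suc m choose d) - real (m choose d) \<le> M ^ (d - 1)"
    proof -
      obtain e where e: "d = Suc e" using d by (cases d) auto
      have "real (m choose e) \<le> real (m ^ e)"
        using order_trans[OF mult_le_mono2[OF fact_ge_1[of e, where 'a=nat], of "m choose e"] binomial_fact_pow[of m e]]
        by (intro of_nat_mono) simp
      also have "\<dots> \<le> M ^ e" using Mm by (simp add: power_mono)
      finally show ?thesis by (simp add: e)
    qed
    have est: "\<bar>x - \<mu> * real (m choose d) - Z n\<bar> \<le> (\<mu> + a) * r ^ 3 * M ^ (d - 1)"
    proof -
      have "\<mu> * (real (Suc m choose d) - real (m choose d)) \<le> \<mu> * (r ^ 3 * M ^ (d - 1))"
        using ch \<mu> mult_right_mono[OF r3 less_imp_le[OF Mp(1)]] by (intro mult_left_mono) linarith+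
      moreover have "0 \<le> \<mu> * (r ^ 3 * M ^ (d - 1))"
        using \<mu> r1 Mp by (intro mult_nonneg_nonneg) auto
      ultimately show ?thesis
        using m1 m2 Zm ZSm by (simp add: algebra_simps abs_le_iff)
    qed
    have est2: "\<bar>\<mu> * real (m choose d) - \<beta> * real m ^ d\<bar> \<le> \<beta> * (real d)\<^sup>2 * (r ^ 3 * M ^ (d - 1))"
    proof -
      have "\<mu> * real (m choose d) - \<beta> * real m ^ d = \<beta> * (fact d * real (m choose d) - real m ^ d)"
        by (simp add: \<beta>_def field_simps)
      then have "\<bar>\<mu> * real (m choose d) - \<beta> * real m ^ d\<bar> \<le> \<beta> * ((real d)\<^sup>2 * real m ^ (d - 1))"
        using choose_power_approx[OF d, of m] \<beta> by (simp add: abs_mult)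
      also have "\<dots> \<le> \<beta> * ((real d)\<^sup>2 * (1 * M ^ (d - 1)))"
        using \<beta> Mm by (intro mult_left_mono) (auto intro: power_mono)
      also have "\<dots> \<le> \<beta> * ((real d)\<^sup>2 * (r ^ 3 * M ^ (d - 1)))"
        using \<beta> r3 Mp by (intro mult_left_mono mult_right_mono) auto
      finally show ?thesis by (simp add: mult_ac)
    qed
    have est3: "\<bar>x - \<beta> * real n ^ d\<bar> \<le> \<beta> * (real d * 2 ^ (d - 1)) * (r ^ 3 * M ^ (d - 1))"
    proof -
      have "\<bar>x - \<beta> * real n ^ d\<bar> \<le> \<beta> * ((real n + 1) ^ d - real n ^ d)"
        using x1 x2 by (simp add: algebra_simps)
      also have "\<dots> \<le> \<beta> * (real d * ((real n + 1) - real n) * (real n + 1) ^ (d - 1))"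
        using \<beta> by (intro mult_left_mono power_diff_upper d) auto
      also have "\<dots> \<le> \<beta> * (real d * 1 * (2 * M) ^ (d - 1))"
        using \<beta> n Mn by (intro mult_left_mono mult_mono power_mono) auto
      also have "\<dots> = \<beta> * (real d * 2 ^ (d - 1)) * (1 * M ^ (d - 1))"
        by (simp add: power_mult_distrib)
      also have "\<dots> \<le> \<beta> * (real d * 2 ^ (d - 1)) * (r ^ 3 * M ^ (d - 1))"
        using \<beta> r3 Mp by (intro mult_left_mono mult_right_mono) auto
      finally show ?thesis .
    qed
    \<comment> \<open>From here on x and the binomial coefficients are gone: the crossing enters
      only through this approximate equation for m.\<close>
    have main: "\<bar>\<beta> * (real n ^ d - real m ^ d) - Z n\<bar> \<le> K2 * (1 + a) * (r ^ 3 * M ^ (d - 1))"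
    proof -
      let ?P = "r ^ 3 * M ^ (d - 1)"
      have P: "0 \<le> ?P" using r1 Mp by (intro mult_nonneg_nonneg) auto
      have "\<bar>\<beta> * (real n ^ d - real m ^ d) - Z n\<bar> \<le> (\<mu> + a) * ?P + \<beta> * (real d)\<^sup>2 * ?P + \<beta> * (real d * 2 ^ (d - 1)) * ?P"
        using est est2 est3 by (simp add: algebra_simps abs_le_iff)
      also have "\<dots> = (\<mu> + a + \<beta> * (real d)\<^sup>2 + \<beta> * (real d * 2 ^ (d - 1))) * ?P"
        by (simp add: algebra_simps)
      also have "\<dots> \<le> (K2 * (1 + a)) * ?P"
      proof (rule mult_right_mono[OF _ P])
        have "K2 * (1 + a) = K2 + a * K2" by (simp add: algebra_simps)
        moreover have "a * 1 \<le> a * K2" using a K2 by (intro mult_left_mono) auto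
        ultimately show "\<mu> + a + \<beta> * (real d)\<^sup>2 + \<beta> * (real d * 2 ^ (d - 1)) \<le> K2 * (1 + a)"
          by (simp add: K2_def)
      qed
      finally show ?thesis .
    qed
    have "\<beta> * (s * M ^ (d - 1)) \<le> 2 ^ (d - 1) * (\<beta> * \<bar>real n ^ d - real m ^ d\<bar>)"
    proof -
      \<comment> \<open>The lower bound for the difference of powers involves max(m, n), while
        \<open>M\<close> involves m + 1. As n >= 1, they differ by a factor of at most 2, which
        costs 2^(d-1).\<close>
      define Mx where "Mx = real (max m n)"
      have Mx: "M \<le> 2 * Mx" using n by (auto simp: M_def Mx_def)
      have "s * Mx ^ (d - 1) \<le> \<bar>real n ^ d - real m ^ d\<bar>"
      proof (cases "m \<le> n")
        case True
        then show ?thesis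
          using power_diff_lower[of "real m" "real n" d] d by (simp add: s_def Mx_def max_def abs_le_iff)
      next
        case False
        then show ?thesis
          using power_diff_lower[of "real n" "real m" d] d by (simp add: s_def Mx_def max_def abs_le_iff)
      qed
      moreover have "s * M ^ (d - 1) \<le> s * (2 * Mx) ^ (d - 1)"
        using Mx M1 s0 by (intro mult_left_mono power_mono) auto
      moreover have "s * (2 * Mx) ^ (d - 1) = 2 ^ (d - 1) * (s * Mx ^ (d - 1))"
        by (simp add: power_mult_distrib)
      moreover have "2 ^ (d - 1) * u \<le> 2 ^ (d - 1) * v" if "u \<le> v" for u v :: real
        using that by simp
      ultimately have "s * M ^ (d - 1) \<le> 2 ^ (d - 1) * \<bar>real n ^ d - real m ^ d\<bar>"
        by (metis order_trans)
      then show ?thesis using \<beta> by (simp add: mult_left_mono mult.left_commute)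
    qed
    also have "\<beta> * \<bar>real n ^ d - real m ^ d\<bar> \<le> b * sqrt (real n) * M ^ (d - 1) + K2 * (1 + a) * r ^ 3 * M ^ (d - 1)"
    proof -
      have "\<beta> * \<bar>real n ^ d - real m ^ d\<bar> = \<bar>\<beta> * (real n ^ d - real m ^ d)\<bar>"
        using \<beta> by (simp add: abs_mult)
      also have "\<dots> \<le> \<bar>Z n\<bar> + K2 * (1 + a) * (r ^ 3 * M ^ (d - 1))" using main by linarith
      also have "\<bar>Z n\<bar> \<le> b * (M ^ (d - 1) * sqrt (real n))"
        using Zn b Mn by (elim order_trans) (intro mult_left_mono mult_right_mono power_mono, auto)
      finally show ?thesis by (simp add: mult_ac)
    qed
    finally have "\<beta> * s * M ^ (d - 1) \<le> (2 ^ (d - 1) * (b * sqrt (real n) + K2 * (1 + a) * r ^ 3)) * M ^ (d - 1)"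
      by (simp add: algebra_simps)
    then have s_le: "\<beta> * s \<le> 2 ^ (d - 1) * (b * sqrt (real n) + K2 * (1 + a) * r ^ 3)"
      using Mp(1) by (rule mult_right_le_imp_le)
    have "\<beta> * y \<le> (2 ^ (d - 1) * (1 + K2) + \<beta>) * (w * sqrt (real n) + w * r ^ 3)"
    proof -
      have "b * sqrt (real n) + K2 * (1 + a) * r ^ 3 \<le> (1 + K2) * (w * sqrt (real n) + w * r ^ 3)"
      proof -
        have "b * sqrt (real n) \<le> w * sqrt (real n)" using a sn by (intro mult_right_mono) (auto simp: w_def)
        moreover have "K2 * (1 + a) * r ^ 3 \<le> K2 * w * r ^ 3"
          using b K2 r3 r1 by (intro mult_right_mono mult_left_mono) (auto simp: w_def)
        moreover have "0 \<le> K2 * (w * sqrt (real n))" "0 \<le> w * r ^ 3" using K2 w sn r1 by auto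
        ultimately show ?thesis by (simp add: algebra_simps)
      qed
      then have "\<beta> * s \<le> 2 ^ (d - 1) * ((1 + K2) * (w * sqrt (real n) + w * r ^ 3))"
        using s_le by (elim order_trans) (rule mult_left_mono, auto)
      moreover have "\<beta> * 1 \<le> \<beta> * (w * sqrt (real n) + w * r ^ 3)"
      proof (rule mult_left_mono)
        have "1 * 1 \<le> w * sqrt (real n)" using w sn by (intro mult_mono) auto
        moreover have "0 \<le> w * r ^ 3" using w r1 by simp
        ultimately show "1 \<le> w * sqrt (real n) + w * r ^ 3" by simp
      qed (use \<beta> in simp)
      ultimately show ?thesis by (simp add: y_def algebra_simps)
    qed
    then have "y \<le> K3 * (w * sqrt (real n) + w * r ^ 3)"
      using \<beta> by (simp add: K3_def field_simps)
    then have "r ^ 4 \<le> K3 * w * sqrt (real n) + K3 * w * r ^ 3"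
      by (simp add: r4 algebra_simps)
    then have "r ^ 4 \<le> 2 * (K3 * w * sqrt (real n)) + 16 * (K3 * w) ^ 4"
      using r1 K3 w sn by (intro le_root_bootstrap) auto
    also have "\<dots> \<le> 2 * (K3 * w ^ 4 * sqrt (real n)) + 16 * (K3 ^ 4 * w ^ 4 * sqrt (real n))"
    proof (intro add_mono mult_left_mono)
      show "K3 * w * sqrt (real n) \<le> K3 * w ^ 4 * sqrt (real n)"
        using K3 w power_increasing[of 1 4 w] by (intro mult_right_mono mult_left_mono) auto
      show "(K3 * w) ^ 4 \<le> K3 ^ 4 * w ^ 4 * sqrt (real n)"
        using mult_left_mono[OF sn, of "K3 ^ 4 * w ^ 4"] by (simp add: power_mult_distrib)
    qed auto
    also have "\<dots> = K4 * w ^ 4 * sqrt (real n)"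
      by (simp add: K4_def algebra_simps)
    finally have y_le: "y \<le> K4 * w ^ 4 * sqrt (real n)" by (simp add: r4)
    have w4: "1 \<le> w ^ 4" using w by (rule one_le_power)
    have r_le: "r \<le> K4 * w * \<rho>"
    proof (rule power_le_imp_le_base)
      have "r ^ Suc 3 = y" using r4 by (simp add: numeral_eq_Suc)
      also have "y \<le> K4 ^ 1 * w ^ 4 * \<rho> ^ 4" using y_le by (simp add: \<rho>4)
      also have "\<dots> \<le> K4 ^ 4 * w ^ 4 * \<rho> ^ 4"
        using K4 w4 \<rho>1 by (intro mult_right_mono power_increasing) auto
      also have "\<dots> = (K4 * w * \<rho>) ^ Suc 3" by (simp add: power_mult_distrib numeral_eq_Suc)
      finally show "r ^ Suc 3 \<le> (K4 * w * \<rho>) ^ Suc 3" .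
    qed (use K4 w \<rho>1 in auto)
    \<comment> \<open>The origin of the rate: r = O(n^(1/8)), so r^3 over root n is
      O(n^(-1/8)).\<close>
    have r3_le: "r ^ 3 / sqrt (real n) \<le> K4 ^ 3 * w ^ 3 / \<rho>"
    proof -
      have "r ^ 3 \<le> (K4 * w * \<rho>) ^ 3" using r_le r1 by (intro power_mono) auto
      then have "r ^ 3 / \<rho> ^ 4 \<le> (K4 * w * \<rho>) ^ 3 / \<rho> ^ 4"
        using \<rho>1 by (intro divide_right_mono) auto
      also have "\<dots> = K4 ^ 3 * w ^ 3 / \<rho>"
        using \<rho>1 by (simp add: power_mult_distrib power4_eq_xxxx power3_eq_cube)
      finally show ?thesis by (simp add: \<rho>4)
    qed
    \<comment> \<open>The curvature term is in fact O(n^(-1/2)); it is weakened to the rate of the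
      other error.\<close>
    have s2_le: "s\<^sup>2 / real n / sqrt (real n) \<le> K4\<^sup>2 * w ^ 8 / \<rho>"
    proof -
      have "s\<^sup>2 \<le> (K4 * w ^ 4 * sqrt (real n))\<^sup>2"
        using y_le s0 by (intro power_mono) (auto simp: y_def)
      then have "s\<^sup>2 / real n \<le> K4\<^sup>2 * w ^ 8"
        using n by (simp add: power_mult_distrib power_mult[symmetric] divide_le_eq)
      then have "s\<^sup>2 / real n / sqrt (real n) \<le> K4\<^sup>2 * w ^ 8 / sqrt (real n)"
        by (intro divide_right_mono) auto
      also have "\<dots> \<le> K4\<^sup>2 * w ^ 8 / \<rho>"
        unfolding \<rho>4[symmetric] using \<rho>1 K4 w power_increasing[of 1 4 \<rho>] by (intro divide_left_mono) auto
      finally show ?thesis .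
    qed
    \<comment> \<open>The factor w^(4(d-1)) arising here and the w^8 of the curvature term combine
      to the exponent 4d + 4 of the claim.\<close>
    have M_le: "M ^ (d - 1) \<le> real n ^ (d - 1) * (2 * K4 * w ^ 4) ^ (d - 1)"
    proof -
      have "M \<le> real n + y" by (auto simp: M_def y_def s_def)
      also have "y \<le> K4 * w ^ 4 * real n"
        using y_le K4 w4 n real_le_rsqrt[of "sqrt (real n)" "real n"]
        by (elim order_trans) (intro mult_left_mono, auto simp: real_sqrt_le_iff' power2_eq_square)
      also have "real n + K4 * w ^ 4 * real n \<le> K4 * w ^ 4 * real n + K4 * w ^ 4 * real n"
        using mult_mono[OF K4 w4] K4 mult_right_mono[of 1 "K4 * w ^ 4" "real n"] by (simp add: mult_ac)
      finally have "M \<le> real n * (2 * K4 * w ^ 4)" by (simp add: algebra_simps)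
      then have "M ^ (d - 1) \<le> (real n * (2 * K4 * w ^ 4)) ^ (d - 1)"
        using M1 by (intro power_mono) auto
      then show ?thesis by (simp add: power_mult_distrib)
    qed
    let ?v = "\<beta> * real d * (real n ^ (d - 1) * sqrt (real n))"
    have v0: "0 < ?v" using \<beta> d0 n by simp
    have "\<bar>\<beta> * real d * real n ^ (d - 1) * (real m - real n) + Z n\<bar>
      \<le> K2 * w * (r ^ 3 * M ^ (d - 1)) + \<beta> * ((real d)\<^sup>2 * s\<^sup>2 * M ^ (d - 1) / real n)"
    proof -
      let ?R = "real m ^ d - real n ^ d - real d * real n ^ (d - 1) * (real m - real n)"
      have "real n * \<bar>?R\<bar> \<le> (real d)\<^sup>2 * (real m - real n)\<^sup>2 * M ^ (d - 1)"
        using Mn Mm d by (intro power_diff_second_order) auto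
      then have R: "\<bar>?R\<bar> \<le> (real d)\<^sup>2 * s\<^sup>2 * M ^ (d - 1) / real n"
        using n by (simp add: s_def field_simps)
      have "\<bar>\<beta> * real d * real n ^ (d - 1) * (real m - real n) + Z n\<bar> = \<bar>(\<beta> * (real n ^ d - real m ^ d) - Z n) + \<beta> * ?R\<bar>"
        by (subst abs_minus_cancel[symmetric]) (simp add: algebra_simps)
      also have "\<dots> \<le> \<bar>\<beta> * (real n ^ d - real m ^ d) - Z n\<bar> + \<beta> * \<bar>?R\<bar>"
        using \<beta> by (intro order_trans[OF abs_triangle_ineq]) (simp add: abs_mult)
      also have "\<dots> \<le> K2 * (1 + a) * (r ^ 3 * M ^ (d - 1)) + \<beta> * ((real d)\<^sup>2 * s\<^sup>2 * M ^ (d - 1) / real n)"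
        using main R \<beta> by (intro add_mono mult_left_mono) auto
      also have "K2 * (1 + a) * (r ^ 3 * M ^ (d - 1)) \<le> K2 * w * (r ^ 3 * M ^ (d - 1))"
        using K2 b r3 r1 Mp by (intro mult_right_mono mult_left_mono) (auto simp: w_def)
      finally show ?thesis by simp
    qed
    also have "\<dots> = M ^ (d - 1) * (K2 * w * r ^ 3 + \<beta> * (real d)\<^sup>2 * (s\<^sup>2 / real n))"
      by (simp add: algebra_simps)
    finally have "\<bar>\<beta> * real d * real n ^ (d - 1) * (real m - real n) + Z n\<bar> / ?v
      \<le> M ^ (d - 1) * (K2 * w * r ^ 3 + \<beta> * (real d)\<^sup>2 * (s\<^sup>2 / real n)) / ?v"
      using v0 by (intro divide_right_mono) auto
    also have "\<dots> = M ^ (d - 1) * (K2 * w * (r ^ 3 / sqrt (real n)) + \<beta> * (real d)\<^sup>2 * (s\<^sup>2 / real n / sqrt (real n))) / (\<beta> * real d * real n ^ (d - 1))"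
      by (simp add: add_divide_distrib algebra_simps)
    also have "\<dots> \<le> (real n ^ (d - 1) * (2 * K4 * w ^ 4) ^ (d - 1)) *
        (K2 * w * (K4 ^ 3 * w ^ 3 / \<rho>) + \<beta> * (real d)\<^sup>2 * (K4\<^sup>2 * w ^ 8 / \<rho>)) / (\<beta> * real d * real n ^ (d - 1))"
      using M_le r3_le s2_le \<beta> d0 K2 w Mp r3 r1 s0 K4 sn
      by (intro divide_right_mono mult_mono add_mono mult_left_mono) auto
    also have "\<dots> = (2 * K4) ^ (d - 1) * w ^ (4 * (d - 1)) * (K2 * K4 ^ 3 * w ^ 4 + \<beta> * (real d)\<^sup>2 * K4\<^sup>2 * w ^ 8) / (\<beta> * real d) / \<rho>"
    proof -
      have e1: "(2 * K4 * w ^ 4) ^ (d - 1) = (2 * K4) ^ (d - 1) * w ^ (4 * (d - 1))"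
        unfolding power_mult_distrib power_mult ..
      have e2: "K2 * w * (K4 ^ 3 * w ^ 3 / \<rho>) + \<beta> * (real d)\<^sup>2 * (K4\<^sup>2 * w ^ 8 / \<rho>)
          = (K2 * K4 ^ 3 * w ^ 4 + \<beta> * (real d)\<^sup>2 * K4\<^sup>2 * w ^ 8) / \<rho>"
        by (simp add: add_divide_distrib power4_eq_xxxx power3_eq_cube mult_ac)
      show ?thesis
        unfolding e1 e2 using n by (simp add: mult_ac)
    qed
    also have "\<dots> \<le> (2 * K4) ^ (d - 1) * w ^ (4 * (d - 1)) * ((K2 * K4 ^ 3 + \<beta> * (real d)\<^sup>2 * K4\<^sup>2) * w ^ 8) / (\<beta> * real d) / \<rho>"
    proof (intro divide_right_mono mult_left_mono)
      have "w ^ 4 \<le> w ^ 8" using w by (intro power_increasing) auto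
      then have "K2 * K4 ^ 3 * w ^ 4 \<le> K2 * K4 ^ 3 * w ^ 8" using K2 K4 by (intro mult_left_mono) auto
      then show "K2 * K4 ^ 3 * w ^ 4 + \<beta> * (real d)\<^sup>2 * K4\<^sup>2 * w ^ 8 \<le> (K2 * K4 ^ 3 + \<beta> * (real d)\<^sup>2 * K4\<^sup>2) * w ^ 8"
        by (simp add: algebra_simps)
    qed (use \<beta> d0 \<rho>1 K4 w in auto)
    also have "\<dots> = K6 * (w ^ (4 * (d - 1)) * w ^ 8) / \<rho>"
      by (simp add: K6_def mult_ac)
    also have "w ^ (4 * (d - 1)) * w ^ 8 = w ^ (4 * d + 4)"
      using d by (simp add: power_add[symmetric] algebra_simps)
    finally have "\<bar>\<beta> * real d * real n ^ (d - 1) * (real m - real n) + Z n\<bar> / ?v \<le> K6 * w ^ (4 * d + 4) / \<rho>" .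
    moreover have "\<bar>\<beta> * real d * real n ^ (d - 1) * (real m - real n) + Z n\<bar> / ?v
      = \<bar>(\<beta> * real d * real n ^ (d - 1) * (real m - real n) + Z n) / ?v\<bar>"
      using v0 by simp
    moreover have "(\<beta> * real d * real n ^ (d - 1) * (real m - real n) + Z n) / ?v = (real m - real n) / sqrt (real n) + Z n / ?v"
      using \<beta> d0 n by (simp add: add_divide_distrib)
    ultimately have c2: "\<bar>(real m - real n) / sqrt (real n) + Z n / ?v\<bar> \<le> K6 * w ^ (4 * d + 4) / \<rho>"
      by simp
    have "\<bar>real m - real n\<bar> + 1 \<le> max K4 K6 * (1 + a + b) ^ 4 * sqrt (real n)"
    proof -
      have "K4 * w ^ 4 * sqrt (real n) \<le> max K4 K6 * w ^ 4 * sqrt (real n)"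
        using w4 sn by (intro mult_right_mono) auto
      with y_le show ?thesis by (simp add: y_def s_def w_def)
    qed
    moreover have "\<bar>(real m - real n) / sqrt (real n) + Z n / ?v\<bar> \<le> max K4 K6 * (1 + a + b) ^ (4 * d + 4) / root 8 (real n)"
    proof -
      have "K6 * w ^ (4 * d + 4) / \<rho> \<le> max K4 K6 * w ^ (4 * d + 4) / \<rho>"
        using w \<rho>1 by (intro divide_right_mono mult_right_mono) auto
      with c2 show ?thesis by (simp add: w_def \<rho>_def)
    qed
    ultimately show "\<bar>real m - real n\<bar> + 1 \<le> max K4 K6 * (1 + a + b) ^ 4 * sqrt (real n) \<and>
        \<bar>(real m - real n) / sqrt (real n) + Z n / ?v\<bar> \<le> max K4 K6 * (1 + a + b) ^ (4 * d + 4) / root 8 (real n)"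
      by blast
  qed
qed

text \<open>Since U tends to infinity, the last index with U <= x and the first with U > x both
  exist. The former is itself the lower end of an upcrossing, the latter the upper end; the two
  crossings may differ, as U need not be monotone. U_0 = 0 < x makes the set behind the supremum
  nonempty and the first passage positive.\<close>

lemma passage_time_crossing:
  assumes U: "filterlim (\<lambda>n. Ustat d f X n \<omega>) at_top sequentially" and U0: "Ustat d f X 0 \<omega> = 0" and x: "0 < x"
    and N: "N = N_minus d f X \<or> N = N_plus d f X"
  shows "\<exists>m. Ustat d f X m \<omega> \<le> x \<and> x < Ustat d f X (Suc m) \<omega> \<and>
    (N x \<omega> = ereal (real m) \<or> N x \<omega> = ereal (real (Suc m)))"
proof -
  let ?U = "\<lambda>n. Ustat d f X n \<omega>"
  have "\<forall>\<^sub>F n in sequentially. x < ?U n"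
    using U by (simp add: filterlim_at_top_dense)
  then obtain n0 where n0: "\<And>n. n0 \<le> n \<Longrightarrow> x < ?U n"
    by (auto simp: eventually_sequentially)
  from N show ?thesis
  proof
    assume N: "N = N_minus d f X"
    let ?A = "{n. ?U n \<le> x}"
    define m where "m = Max ?A"
    have "?A \<subseteq> {..<n0}" using n0 by (auto simp: not_le[symmetric])
    then have fin: "finite ?A" by (rule finite_subset) simp
    have "0 \<in> ?A" using U0 x by simp
    then have m: "m \<in> ?A" unfolding m_def using fin by (intro Max_in) auto
    have max: "n \<le> m" if "n \<in> ?A" for n
      unfolding m_def using fin that by (rule Max_ge)
    have "Suc m \<notin> ?A" using max[of "Suc m"] by auto
    moreover have "N x \<omega> = ereal (real m)"
      unfolding N N_minus_def using m max by (intro antisym SUP_least SUP_upper2[of m]) auto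
    ultimately show ?thesis using m by (auto simp: not_le)
  next
    assume N: "N = N_plus d f X"
    define k where "k = (LEAST n. x < ?U n)"
    have k: "x < ?U k" unfolding k_def using n0[OF order_refl] by (rule LeastI)
    have least: "k \<le> n" if "x < ?U n" for n
      unfolding k_def using that by (rule Least_le)
    have "k \<noteq> 0" using k U0 x by (metis less_asym)
    then obtain m where m: "k = Suc m" by (cases k) auto
    have "?U m \<le> x" using least[of m] m by (auto simp: not_le[symmetric])
    moreover have "N x \<omega> = ereal (real k)"
      unfolding N N_plus_def using k least by (intro antisym INF_greatest INF_lower2[of k]) auto
    ultimately show ?thesis using k m by auto
  qed
qed

text \<open>x is squeezed between U at m and at m + 1, both asymptotic to \<beta> m^d, so x/m^d
  tends to \<beta>; this is then inverted, and N differs from m by at most 1.\<close>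

lemma crossing_ratio_limit:
  fixes U :: "nat \<Rightarrow> real" and m :: "real \<Rightarrow> nat" and N :: "real \<Rightarrow> real"
  assumes d: "1 \<le> d" and \<beta>: "0 < \<beta>" and U: "(\<lambda>n. U n / real n ^ d) \<longlonglongrightarrow> \<beta>"
    and m: "\<And>x. 0 < x \<Longrightarrow> U (m x) \<le> x" "\<And>x. 0 < x \<Longrightarrow> x < U (Suc (m x))"
    and N: "\<And>x. 0 < x \<Longrightarrow> \<bar>N x - real (m x)\<bar> \<le> 1"
  shows "((\<lambda>x. N x / x powr (1 / real d)) \<longlongrightarrow> (1 / \<beta>) powr (1 / real d)) at_top"
proof -
  have m_top: "filterlim m sequentially at_top"
    unfolding filterlim_at_top
  proof
    fix K
    have "\<forall>\<^sub>F x in at_top. Max (U ` {..K}) < x" "\<forall>\<^sub>F x in at_top. (0::real) < x"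
      by (rule eventually_gt_at_top)+
    then show "\<forall>\<^sub>F x in at_top. K \<le> m x"
    proof eventually_elim
      case (elim x)
      show ?case
      proof (rule ccontr)
        assume "\<not> K \<le> m x"
        \<comment> \<open>If m stayed below K, the value U_(m+1) > x would be one of finitely many,
          all of which x eventually exceeds.\<close>
        then have "U (Suc (m x)) \<le> Max (U ` {..K})" by (intro Max_ge) auto
        with elim m(2)[of x] show False by linarith
      qed
    qed
  qed
  have Sm_top: "filterlim (\<lambda>x. Suc (m x)) sequentially at_top"
    by (rule filterlim_compose[OF filterlim_Suc m_top])
  have pos: "\<forall>\<^sub>F x in at_top. 0 < x \<and> 0 < m x"
    using eventually_gt_at_top[of 0] m_top[THEN filterlim_at_top[THEN iffD1], rule_format, of 1]
    by eventually_elim auto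
  have q: "((\<lambda>x. x / real (m x) ^ d) \<longlongrightarrow> \<beta>) at_top"
  proof (rule tendsto_sandwich)
    show "((\<lambda>x. U (m x) / real (m x) ^ d) \<longlongrightarrow> \<beta>) at_top"
      by (rule filterlim_compose[OF U m_top])
    have "(\<lambda>n. real (Suc n) / real n) \<longlonglongrightarrow> 1" by (rule LIMSEQ_Suc_n_over_n)
    from filterlim_compose[OF this m_top]
    have "((\<lambda>x. U (Suc (m x)) / real (Suc (m x)) ^ d * (real (Suc (m x)) / real (m x)) ^ d) \<longlongrightarrow> \<beta> * 1 ^ d) at_top"
      by (intro tendsto_mult tendsto_power filterlim_compose[OF U Sm_top]) auto
    then show "((\<lambda>x. U (Suc (m x)) / real (Suc (m x)) ^ d * (real (Suc (m x)) / real (m x)) ^ d) \<longlongrightarrow> \<beta>) at_top"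
      by simp
    show "\<forall>\<^sub>F x in at_top. U (m x) / real (m x) ^ d \<le> x / real (m x) ^ d"
      using pos by eventually_elim (use m(1) in \<open>auto intro: divide_right_mono\<close>)
    show "\<forall>\<^sub>F x in at_top. x / real (m x) ^ d \<le> U (Suc (m x)) / real (Suc (m x)) ^ d * (real (Suc (m x)) / real (m x)) ^ d"
      using pos
    proof eventually_elim
      case (elim x)
      have "x / real (m x) ^ d \<le> U (Suc (m x)) / real (m x) ^ d"
        using m(2)[of x] elim by (intro divide_right_mono) auto
      also have "\<dots> = U (Suc (m x)) / real (Suc (m x)) ^ d * (real (Suc (m x)) / real (m x)) ^ d"
        by (simp add: power_divide del: of_nat_Suc)
      finally show ?case .
    qed
  qed
  have "((\<lambda>x. (x / real (m x) ^ d) powr (1 / real d)) \<longlongrightarrow> \<beta> powr (1 / real d)) at_top"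
    using \<beta> by (intro tendsto_powr q tendsto_const) auto
  then have "((\<lambda>x. inverse ((x / real (m x) ^ d) powr (1 / real d))) \<longlongrightarrow> inverse (\<beta> powr (1 / real d))) at_top"
    using \<beta> by (intro tendsto_inverse) auto
  then have m_lim: "((\<lambda>x. real (m x) / x powr (1 / real d)) \<longlongrightarrow> (1 / \<beta>) powr (1 / real d)) at_top"
  proof (rule Lim_transform_eventually[THEN tendsto_eq_rhs])
    show "\<forall>\<^sub>F x in at_top. inverse ((x / real (m x) ^ d) powr (1 / real d)) = real (m x) / x powr (1 / real d)"
      using pos
    proof eventually_elim
      case (elim x)
      have "(real (m x) ^ d) powr (1 / real d) = real (m x)"
        using elim d by (simp add: powr_realpow[symmetric] powr_powr)
      with elim show ?case by (simp add: powr_divide)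
    qed
    show "inverse (\<beta> powr (1 / real d)) = (1 / \<beta>) powr (1 / real d)"
      using \<beta> by (simp add: powr_divide inverse_eq_divide)
  qed
  have "((\<lambda>x. (N x - real (m x)) / x powr (1 / real d)) \<longlongrightarrow> 0) at_top"
  proof (rule Lim_null_comparison)
    show "\<forall>\<^sub>F x in at_top. norm ((N x - real (m x)) / x powr (1 / real d)) \<le> x powr - (1 / real d)"
      using eventually_gt_at_top[of 0]
      by eventually_elim (use N in \<open>auto simp: powr_minus divide_simps\<close>)
    show "((\<lambda>x. x powr - (1 / real d)) \<longlongrightarrow> 0) at_top"
      using d by (intro tendsto_neg_powr filterlim_ident) auto
  qed
  from tendsto_add[OF m_lim this] show ?thesis
    by (simp add: add_divide_distrib[symmetric])
qed

text \<open>Moves from centring n and scale root n to cT and root T. With V = (N - n)/root n, the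
  errors are V (root(n/T) - root c), root c (V + \<zeta>) and (n - cT)/root T. As 1/root T <= root c
  / n^(1/8), they contribute 1, 2 and 1 to the factor 4.\<close>

lemma scale_estimate:
  fixes c T N \<zeta> w K :: real
  assumes c: "0 < c" and T: "0 < T" and n: "1 \<le> n" and nT: "real n \<le> c * T" "c * T \<le> real n + 1"
    and N: "\<bar>N - real m\<bar> \<le> 1" and m: "\<bar>real m - real n\<bar> + 1 \<le> K * w ^ 4 * sqrt (real n)"
    and \<zeta>: "\<bar>(real m - real n) / sqrt (real n) + \<zeta>\<bar> \<le> K * w ^ D / root 8 (real n)"
    and w: "1 \<le> w" and K: "1 \<le> K" and D: "4 \<le> D"
  shows "\<bar>(N - c * T) / sqrt T + sqrt c * \<zeta>\<bar> \<le> 4 * sqrt c * K * w ^ D / root 8 (real n)"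
proof -
  define \<rho> where "\<rho> = root 8 (real n)"
  define V where "V = (N - real n) / sqrt (real n)"
  have \<rho>1: "1 \<le> \<rho>" using n by (simp add: \<rho>_def)
  have "\<rho> ^ 8 = real n" by (simp add: \<rho>_def)
  then have "\<rho> ^ 4 = sqrt (real n)"
    using \<rho>1 by (intro real_sqrt_unique[symmetric]) (auto simp: power_mult[symmetric])
  then have \<rho>n: "\<rho> \<le> sqrt (real n)" using power_increasing[of 1 4 \<rho>] \<rho>1 by simp
  have sn: "0 < sqrt (real n)" using n by simp
  have sT: "0 < sqrt T" using T by simp
  have invT: "1 / sqrt T \<le> sqrt c / \<rho>"
  proof -
    have "sqrt (real n) \<le> sqrt c * sqrt T" using nT(1) by (simp add: real_sqrt_mult[symmetric])
    with \<rho>n have "\<rho> \<le> sqrt c * sqrt T" by linarith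
    then show ?thesis using \<rho>1 sT by (simp add: field_simps)
  qed
  have diff: "\<bar>sqrt (real n) / sqrt T - sqrt c\<bar> \<le> 1 / sqrt T"
  proof -
    have "sqrt (c * T) \<le> sqrt (real n + 1)" using nT by simp
    also have "\<dots> \<le> sqrt (real n) + sqrt 1" by (rule sqrt_add_le_add_sqrt) auto
    finally have "sqrt (c * T) \<le> sqrt (real n) + 1" by simp
    moreover have "sqrt (real n) \<le> sqrt (c * T)" using nT by simp
    ultimately have "\<bar>sqrt (real n) - sqrt (c * T)\<bar> \<le> 1" by simp
    then have "\<bar>sqrt (real n) - sqrt (c * T)\<bar> / sqrt T \<le> 1 / sqrt T"
      using sT by (intro divide_right_mono) auto
    moreover have "sqrt (real n) / sqrt T - sqrt c = (sqrt (real n) - sqrt (c * T)) / sqrt T"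
      using sT by (simp add: real_sqrt_mult diff_divide_distrib)
    ultimately show ?thesis using sT by simp
  qed
  have wD: "1 \<le> w ^ D" "w ^ 4 \<le> w ^ D" using w D by (auto intro: power_increasing)
  have V: "\<bar>V\<bar> \<le> K * w ^ D"
  proof -
    have "\<bar>N - real n\<bar> \<le> K * w ^ 4 * sqrt (real n)" using N m by linarith
    then have "\<bar>V\<bar> \<le> K * w ^ 4" using sn by (simp add: V_def abs_divide pos_divide_le_eq)
    also have "\<dots> \<le> K * w ^ D" using wD K by (intro mult_left_mono) auto
    finally show ?thesis .
  qed
  have V\<zeta>: "\<bar>V + \<zeta>\<bar> \<le> 2 * K * w ^ D / \<rho>"
  proof -
    have "V + \<zeta> = ((real m - real n) / sqrt (real n) + \<zeta>) + (N - real m) / sqrt (real n)"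
      by (simp add: V_def diff_divide_distrib)
    also have "\<bar>\<dots>\<bar> \<le> K * w ^ D / \<rho> + 1 / \<rho>"
    proof (rule order_trans[OF abs_triangle_ineq], rule add_mono)
      show "\<bar>(real m - real n) / sqrt (real n) + \<zeta>\<bar> \<le> K * w ^ D / \<rho>" using \<zeta> by (simp add: \<rho>_def)
      have "\<bar>(N - real m) / sqrt (real n)\<bar> \<le> 1 / sqrt (real n)"
        using N sn by (simp add: abs_divide divide_right_mono)
      also have "\<dots> \<le> 1 / \<rho>" using \<rho>n \<rho>1 sn by (intro divide_left_mono) auto
      finally show "\<bar>(N - real m) / sqrt (real n)\<bar> \<le> 1 / \<rho>" .
    qed
    also have "\<dots> \<le> K * w ^ D / \<rho> + K * w ^ D / \<rho>"
      using mult_mono[OF K wD(1)] K \<rho>1 by (intro add_left_mono divide_right_mono) auto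
    finally show ?thesis by simp
  qed
  have "(N - c * T) / sqrt T + sqrt c * \<zeta> = V * (sqrt (real n) / sqrt T - sqrt c) + sqrt c * (V + \<zeta>) + (real n - c * T) / sqrt T"
  proof -
    have "V * sqrt (real n) = N - real n" using sn by (simp add: V_def)
    then have "V * (sqrt (real n) / sqrt T - sqrt c) = (N - real n) / sqrt T - V * sqrt c"
      by (simp add: right_diff_distrib)
    then show ?thesis by (simp add: algebra_simps diff_divide_distrib)
  qed
  also have "\<bar>\<dots>\<bar> \<le> \<bar>V\<bar> * \<bar>sqrt (real n) / sqrt T - sqrt c\<bar> + sqrt c * \<bar>V + \<zeta>\<bar> + \<bar>real n - c * T\<bar> / sqrt T"
    using c sT by (intro order_trans[OF abs_triangle_ineq] add_mono) (auto simp: abs_mult abs_divide intro: order_trans[OF abs_triangle_ineq])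
  also have "\<dots> \<le> (K * w ^ D) * (1 / sqrt T) + sqrt c * (2 * K * w ^ D / \<rho>) + 1 / sqrt T"
    using V diff V\<zeta> c sT nT K w by (intro add_mono mult_mono mult_left_mono divide_right_mono) auto
  also have "\<dots> \<le> (K * w ^ D) * (sqrt c / \<rho>) + sqrt c * (2 * K * w ^ D / \<rho>) + (K * w ^ D) * (sqrt c / \<rho>)"
  proof (intro add_mono mult_left_mono invT order_refl)
    have "1 / sqrt T \<le> 1 * (sqrt c / \<rho>)" using invT by simp
    also have "\<dots> \<le> (K * w ^ D) * (sqrt c / \<rho>)"
      using mult_mono[OF K wD(1)] K c \<rho>1 by (intro mult_right_mono) auto
    finally show "1 / sqrt T \<le> (K * w ^ D) * (sqrt c / \<rho>)" .
  qed (use K w c in auto)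
  also have "\<dots> = 4 * sqrt c * K * w ^ D / \<rho>"
    by (simp add: field_simps)
  finally show ?thesis by (simp add: \<rho>_def)
qed

text \<open>Separates a from b, so that in an expectation the two can be bounded by their individual
  moments.\<close>

lemma power_one_plus_le:
  fixes a b :: real
  assumes "0 \<le> a" "0 \<le> b" "k \<le> l"
  shows "(1 + a + b) ^ k \<le> 3 ^ l * (1 + a ^ l + b ^ l)"
proof -
  define m where "m = max 1 (max a b)"
  have "(1 + a + b) ^ k \<le> (1 + a + b) ^ l"
    using assms by (intro power_increasing) auto
  also have "\<dots> \<le> (3 * m) ^ l"
    using assms by (intro power_mono) (auto simp: m_def)
  also have "\<dots> = 3 ^ l * m ^ l" by (simp add: power_mult_distrib)
  also have "m ^ l \<le> 1 + a ^ l + b ^ l"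
    using assms by (auto simp: m_def max_def)
  finally show ?thesis by simp
qed

section \<open>Passage times\<close>

text \<open>The index set of a passage time depends on the sample point. As a supremum over all n,
  with bottom as filler, it becomes a countable supremum of measurable functions.\<close>

lemma SUP_filter_eq:
  "(SUP n\<in>{n. P n}. g n) = (SUP n. if P n then g n else (bot::'b::complete_lattice))"
proof (intro antisym SUP_least)
  show "g n \<le> (SUP n. if P n then g n else bot)" if "n \<in> {n. P n}" for n
    using that by (intro SUP_upper2[of n]) auto
qed (auto intro: SUP_upper)

lemma INF_filter_eq:
  "(INF n\<in>{n. P n}. g n) = (INF n. if P n then g n else (top::'b::complete_lattice))"
proof (intro antisym INF_greatest)
  show "(INF n. if P n then g n else top) \<le> g n" if "n \<in> {n. P n}" for n
    using that by (intro INF_lower2[of n]) auto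
qed (auto intro: INF_lower)

lemma normal_law_moments:
  assumes "0 \<le> v"
  shows "(\<integral>y. y \<partial>normal_law 0 v) = 0" "(\<integral>y. y\<^sup>2 \<partial>normal_law 0 v) = v"
proof -
  have "(\<integral>y. y \<partial>normal_law 0 v) = 0 \<and> (\<integral>y. y\<^sup>2 \<partial>normal_law 0 v) = v"
  proof (cases "v = 0")
    case True
    then show ?thesis by (simp add: normal_law_def integral_return)
  next
    case False
    with assms have v: "0 < sqrt v" by simp
    let ?P = "density lborel (\<lambda>y. ennreal (normal_density 0 (sqrt v) y))"
    interpret P: prob_space ?P by (rule prob_space_normal_density[OF v])
    have dist: "distributed ?P lborel (\<lambda>x. x) (\<lambda>x. ennreal (normal_density 0 (sqrt v) x))"
      by (simp add: distributed_def distr_id2)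
    have 1: "P.expectation (\<lambda>x. x) = 0"
      by (rule P.normal_distributed_expectation[OF v dist])
    have "P.variance (\<lambda>x. x) = (sqrt v)\<^sup>2"
      by (rule P.normal_distributed_variance[OF v dist])
    with 1 assms False show ?thesis by (simp add: normal_law_def)
  qed
  then show "(\<integral>y. y \<partial>normal_law 0 v) = 0" "(\<integral>y. y\<^sup>2 \<partial>normal_law 0 v) = v" by auto
qed

context iid_sequence
begin

lemma measurable_passage_time:
  assumes [measurable]: "f \<in> kernels d" and "N = N_minus d f X \<or> N = N_plus d f X"
  shows "N x \<in> borel_measurable M"
  using assms(2)
proof
  assume N: "N = N_minus d f X"
  show ?thesis unfolding N N_minus_def[abs_def] SUP_filter_eq by measurable
next
  assume N: "N = N_plus d f X"
  show ?thesis unfolding N N_plus_def[abs_def] INF_filter_eq by measurable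
qed

text \<open>The envelope around index 0 is already a strong law: |Z_k| <= a k^(3/4) k^(d-1), and
  division by k^d leaves a k^(-1/4). The eighth moment is the case r = 2.\<close>

lemma AE_Ustat_ratio:
  assumes f: "f \<in> kernels d" and d: "1 \<le> d" and fin: "moment 8 d f < \<infinity>"
  shows "AE \<omega> in M. (\<lambda>n. Ustat d f X n \<omega> / real n ^ d) \<longlonglongrightarrow> Umean M d f X / fact d"
proof -
  have r: "(2::nat) \<le> 2" by simp
  have fin': "moment (4 * 2) d f < \<infinity>" using fin by simp
  obtain a where a: "AE \<omega> in M. \<forall>k. \<bar>Udev d f k \<omega> - Udev d f 0 \<omega>\<bar>
      \<le> a \<omega> * root 4 \<bar>real k - real 0\<bar> ^ 3 * real (max k 0) ^ (d - 1)"
    using increment_envelope[OF f d r fin'] by blast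
  from a show ?thesis
  proof eventually_elim
    case (elim \<omega>)
    have "(\<lambda>n. Udev d f n \<omega> / real n ^ d) \<longlonglongrightarrow> 0"
    proof (rule Lim_null_comparison)
      show "\<forall>\<^sub>F n in sequentially. norm (Udev d f n \<omega> / real n ^ d) \<le> a \<omega> / root 4 (real n)"
        using eventually_gt_at_top[of 0]
      proof eventually_elim
        case n: (elim n)
        have r0: "0 < root 4 (real n)" using n by simp
        have "real n = root 4 (real n) ^ 4" by simp
        also have "\<dots> = root 4 (real n) * root 4 (real n) ^ 3" by (simp add: power4_eq_xxxx power3_eq_cube)
        finally have rn: "real n = root 4 (real n) * root 4 (real n) ^ 3" .
        have "\<bar>Udev d f n \<omega>\<bar> \<le> a \<omega> * root 4 (real n) ^ 3 * real n ^ (d - 1)"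
          using elim[rule_format, of n] by (simp add: Udev_at_0[OF d])
        then have "\<bar>Udev d f n \<omega>\<bar> / real n ^ d \<le> a \<omega> * root 4 (real n) ^ 3 * real n ^ (d - 1) / real n ^ d"
          by (intro divide_right_mono) auto
        also have "\<dots> = a \<omega> * root 4 (real n) ^ 3 / real n"
          using n d by (cases d) auto
        also have "\<dots> = a \<omega> * root 4 (real n) ^ 3 / (root 4 (real n) * root 4 (real n) ^ 3)"
          using rn by simp
        also have "\<dots> = a \<omega> / root 4 (real n)"
          using r0 by (subst nonzero_mult_divide_mult_cancel_right) auto
        finally show ?case by simp
      qed
      have "filterlim (\<lambda>n. root 4 (real n)) at_top sequentially"
        unfolding filterlim_at_top
      proof
        fix K :: real
        show "\<forall>\<^sub>F n in sequentially. K \<le> root 4 (real n)"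
          using filterlim_real_sequentially[unfolded filterlim_at_top, rule_format, of "\<bar>K\<bar> ^ 4"]
        proof eventually_elim
          case (elim n)
          have "\<bar>K\<bar> = root 4 (\<bar>K\<bar> ^ 4)" by (rule real_root_pos2[symmetric]) auto
          also have "\<dots> \<le> root 4 (real n)" by (rule real_root_le_mono[OF _ elim]) simp
          finally show ?case by simp
        qed
      qed
      then show "(\<lambda>n. a \<omega> / root 4 (real n)) \<longlonglongrightarrow> 0"
        by (intro tendsto_divide_0[OF tendsto_const] filterlim_at_top_imp_at_infinity)
    qed
    moreover have "(\<lambda>n. Umean M d f X / fact d * falling_ratio n d n) \<longlonglongrightarrow> Umean M d f X / fact d * 1"
      by (intro tendsto_mult tendsto_const falling_ratio_diagonal)
    ultimately have "(\<lambda>n. Udev d f n \<omega> / real n ^ d + Umean M d f X / fact d * falling_ratio n d n) \<longlonglongrightarrow> 0 + Umean M d f X / fact d * 1"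
      by (rule tendsto_add)
    moreover have "Udev d f n \<omega> / real n ^ d + Umean M d f X / fact d * falling_ratio n d n = Ustat d f X n \<omega> / real n ^ d" for n
      by (simp add: Udev_def falling_ratio_def diff_divide_distrib)
    ultimately show ?case by simp
  qed
qed

lemma Ustat_at_top:
  assumes d: "1 \<le> d" and \<beta>: "0 < \<beta>" and lim: "(\<lambda>n. Ustat d f X n \<omega> / real n ^ d) \<longlonglongrightarrow> \<beta>"
  shows "filterlim (\<lambda>n. Ustat d f X n \<omega>) at_top sequentially"
proof (rule filterlim_at_top_mono)
  show "filterlim (\<lambda>n. \<beta> / 2 * real n) at_top sequentially"
    using \<beta> by (intro filterlim_tendsto_pos_mult_at_top[OF tendsto_const] filterlim_real_sequentially) auto
  have "\<forall>\<^sub>F n in sequentially. \<beta> / 2 < Ustat d f X n \<omega> / real n ^ d"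
    using \<beta> by (intro order_tendstoD(1)[OF lim]) auto
  then show "\<forall>\<^sub>F n in sequentially. \<beta> / 2 * real n \<le> Ustat d f X n \<omega>"
    using eventually_gt_at_top[of 0]
  proof eventually_elim
    case (elim n)
    have "\<beta> / 2 * real n ^ 1 \<le> \<beta> / 2 * real n ^ d"
      using \<beta> elim d by (intro mult_left_mono power_increasing) auto
    also have "\<dots> \<le> Ustat d f X n \<omega>" using elim by (simp add: pos_less_divide_eq)
    finally show ?case by simp
  qed
qed

text \<open>The sign is not visible in the formula. It follows from the limit theorem:
  exp(-\<sigma>^2/2) is a limit of characteristic functions at 1 and so has modulus at most
  1.\<close>

lemma Usigma2_nonneg:
  assumes f: "f \<in> kernels d" and d: "1 \<le> d" and fin: "moment 2 d f < \<infinity>" "moment 3 d f < \<infinity>"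
  shows "0 \<le> Usigma2 M d f X"
proof -
  have rd: "real_distribution (distr M borel (\<lambda>\<omega>. Udev d f n \<omega> / (real n ^ (d - 1) * sqrt (real n))))" for n
    by (intro real_distribution_distr borel_measurable_divide measurable_Udev[OF f] borel_measurable_const)
  have "norm (complex_of_real (exp (- (1\<^sup>2 * Usigma2 M d f X / 2)))) \<le> 1"
  proof (rule tendsto_upperbound[OF tendsto_norm[OF char_Udev[OF f d fin, of 1]]])
    show "\<forall>\<^sub>F n in sequentially. norm (char (distr M borel (\<lambda>\<omega>. Udev d f n \<omega> / (real n ^ (d - 1) * sqrt (real n)))) 1) \<le> 1"
      by (intro always_eventually allI real_distribution.cmod_char_le_1 rd)
  qed simp
  then show ?thesis by simp
qed

text \<open>Apart from measurability, a passage time enters only through a crossing index m with |N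
  - m| <= 1, so both signs share one argument.\<close>

lemma passage_time_limits:
  fixes N :: "real \<Rightarrow> 'a \<Rightarrow> ereal" and Nr :: "real \<Rightarrow> 'a \<Rightarrow> real"
  assumes f: "f \<in> kernels d" and d: "1 \<le> d" and fin: "\<And>p. moment p d f < \<infinity>"
    and \<mu>: "\<mu> = Umean M d f X" "0 < \<mu>"
    and c_def: "c = (fact d / \<mu>) powr (1 / real d)"
    and v_def: "v = (fact d / \<mu>) powr (2 + 1 / real d) / (real d)\<^sup>2 * Usigma2 M d f X"
    and N: "N = N_minus d f X \<or> N = N_plus d f X"
    and Nr: "Nr = (\<lambda>x \<omega>. real_of_ereal (N x \<omega>))"
  shows "AE \<omega> in M. \<forall>x>0. \<bar>N x \<omega>\<bar> \<noteq> \<infinity>"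
    and "AE \<omega> in M. ((\<lambda>x. Nr x \<omega> / x powr (1 / real d)) \<longlongrightarrow> c) at_top"
    and "conv_moments M (\<lambda>x \<omega>. Nr x \<omega> / x powr (1 / real d)) (return borel c)"
    and "conv_in_distr M (\<lambda>x \<omega>. (Nr x \<omega> - c * x powr (1 / real d)) / x powr (1 / (2 * real d))) (normal_law 0 v)"
    and "conv_moments M (\<lambda>x \<omega>. (Nr x \<omega> - c * x powr (1 / real d)) / x powr (1 / (2 * real d))) (normal_law 0 v)"
    and "((\<lambda>x. (\<integral>\<omega>. Nr x \<omega> \<partial>M) / x powr (1 / real d)) \<longlongrightarrow> c) at_top"
    and "((\<lambda>x. covar M (Nr x) (Nr x) / x powr (1 / real d)) \<longlongrightarrow> v) at_top"
proof -
  define \<beta> where "\<beta> = \<mu> / fact d"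
  have \<beta>: "0 < \<beta>" using \<mu>(2) by (simp add: \<beta>_def)
  have c_eq: "c = (1 / \<beta>) powr (1 / real d)" by (simp add: c_def \<beta>_def)
  have c0: "0 < c" using \<beta> by (simp add: c_eq)
  have d0: "0 < real d" using d by simp
  have cd: "\<beta> * c ^ d = 1"
    using \<beta> d0 unfolding c_eq by (simp add: powr_realpow[symmetric] powr_powr)
  define T where "T x = x powr (1 / real d)" for x :: real
  have T0: "0 < T x" if "0 < x" for x using that by (simp add: T_def)
  have Td: "T x ^ d = x" if "0 < x" for x
    using that d0 by (simp add: T_def powr_realpow[symmetric] powr_powr)
  have sqrtT: "x powr (1 / (2 * real d)) = sqrt (T x)" if "0 < x" for x
    using that by (simp add: T_def powr_half_sqrt[symmetric] powr_powr mult.commute)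
  have T_top: "filterlim T at_top at_top"
    unfolding T_def using d0 by (intro real_powr_at_top) simp
  \<comment> \<open>The deterministic passage time: \<beta> (c T)^d = x, so rounding c T down puts x
    between \<beta> n^d and \<beta> (n + 1)^d.\<close>
  define n where "n x = nat \<lfloor>c * T x\<rfloor>" for x
  have n_top: "filterlim n sequentially at_top"
  proof -
    have "filterlim (\<lambda>x. c * T x) at_top at_top"
      by (intro filterlim_tendsto_pos_mult_at_top[OF tendsto_const c0] T_top)
    then show ?thesis
      unfolding n_def by (intro filterlim_compose[OF filterlim_nat_sequentially]
          filterlim_compose[OF filterlim_floor_sequentially])
  qed
  have n_bounds: "real (n x) \<le> c * T x" "c * T x \<le> real (n x) + 1" if "0 < x" for x
  proof -
    have "0 \<le> c * T x" using c0 T0[OF that] by simp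
    then show "real (n x) \<le> c * T x" "c * T x \<le> real (n x) + 1"
      by (simp_all add: n_def of_nat_nat)
  qed
  have n1: "\<forall>\<^sub>F x in at_top. 0 < x \<and> 1 \<le> n x"
    using eventually_gt_at_top[of 0] n_top[THEN filterlim_at_top[THEN iffD1], rule_format, of 1]
    by eventually_elim auto
  have x_bounds: "\<beta> * real (n x) ^ d \<le> x" "x \<le> \<beta> * (real (n x) + 1) ^ d" if "0 < x" for x
  proof -
    have x: "x = \<beta> * (c * T x) ^ d"
      using cd Td[OF that] by (simp add: power_mult_distrib mult.assoc[symmetric])
    have "\<beta> * real (n x) ^ d \<le> \<beta> * (c * T x) ^ d"
      using \<beta> by (intro mult_left_mono power_mono n_bounds(1)[OF that]) simp_all
    then show "\<beta> * real (n x) ^ d \<le> x" by (simp only: x[symmetric])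
    have "\<beta> * (c * T x) ^ d \<le> \<beta> * (real (n x) + 1) ^ d"
      using \<beta> c0 T0[OF that] by (intro mult_left_mono power_mono n_bounds(2)[OF that]) simp_all
    then show "x \<le> \<beta> * (real (n x) + 1) ^ d" by (simp only: x[symmetric])
  qed
  have N_meas [measurable]: "N x \<in> borel_measurable M" for x
    by (rule measurable_passage_time[OF f N])
  have [measurable]: "Nr x \<in> borel_measurable M" for x
    unfolding Nr by measurable
  note [measurable] = measurable_Udev[OF f]

  have ratio: "AE \<omega> in M. (\<lambda>n. Ustat d f X n \<omega> / real n ^ d) \<longlonglongrightarrow> \<beta>"
    using AE_Ustat_ratio[OF f d fin] by (simp add: \<beta>_def \<mu>)
  define cross where "cross \<omega> m x \<longleftrightarrow> Ustat d f X m \<omega> \<le> x \<and> x < Ustat d f X (Suc m) \<omega> \<and>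
      (N x \<omega> = ereal (real m) \<or> N x \<omega> = ereal (real (Suc m)))" for \<omega> m x
  have U0: "Ustat d f X 0 \<omega> = 0" for \<omega>
    using d by (cases d) (simp_all add: Ustat_Suc One_nat_def)
  have crossing: "AE \<omega> in M. \<forall>x>0. \<exists>m. cross \<omega> m x"
    using ratio
  proof eventually_elim
    case (elim \<omega>)
    show ?case
      unfolding cross_def using passage_time_crossing[OF Ustat_at_top[OF d \<beta> elim] U0 _ N] by blast
  qed
  have cross_N: "\<bar>Nr x \<omega> - real m\<bar> \<le> 1" if "cross \<omega> m x" for \<omega> m x
    using that by (auto simp: cross_def Nr)

  have cross_finite: "\<bar>N x \<omega>\<bar> \<noteq> \<infinity>" if "cross \<omega> m x" for \<omega> m x
    using that by (auto simp: cross_def)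
  show "AE \<omega> in M. \<forall>x>0. \<bar>N x \<omega>\<bar> \<noteq> \<infinity>"
    using crossing
  proof eventually_elim
    case (elim \<omega>)
    show ?case
    proof (intro allI impI)
      fix x :: real assume "0 < x"
      with elim obtain m where "cross \<omega> m x" by auto
      then show "\<bar>N x \<omega>\<bar> \<noteq> \<infinity>" by (rule cross_finite)
    qed
  qed

  show "AE \<omega> in M. ((\<lambda>x. Nr x \<omega> / x powr (1 / real d)) \<longlongrightarrow> c) at_top"
    using crossing ratio
  proof eventually_elim
    case (elim \<omega>)
    then obtain m where m: "\<And>x. 0 < x \<Longrightarrow> cross \<omega> (m x) x" by metis
    show ?case unfolding c_eq
      by (rule crossing_ratio_limit[OF d \<beta> elim(2), of m]) (use m cross_N in \<open>auto simp: cross_def\<close>)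
  qed

  define \<zeta> where "\<zeta> k \<omega> = Udev d f k \<omega> / (\<beta> * real d * (real k ^ (d - 1) * sqrt (real k)))" for k \<omega>
  define Y where "Y x \<omega> = (Nr x \<omega> - c * x powr (1 / real d)) / x powr (1 / (2 * real d))" for x \<omega>
  \<comment> \<open>A surplus of U at the deterministic index makes the passage earlier, hence the
    minus sign.\<close>
  define G where "G x \<omega> = - sqrt c * \<zeta> (n x) \<omega>" for x \<omega>
  have [measurable]: "\<zeta> k \<in> borel_measurable M" for k
    unfolding \<zeta>_def[abs_def] by measurable
  have Y_meas [measurable]: "Y x \<in> borel_measurable M" for x
    unfolding Y_def[abs_def] by measurable
  have G_meas [measurable]: "G x \<in> borel_measurable M" for x
    unfolding G_def[abs_def] by measurable
  have \<zeta>_eq: "\<zeta> k \<omega> = (1 / (\<beta> * real d)) * (Udev d f k \<omega> / (real k ^ (d - 1) * sqrt (real k)))" for k \<omega>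
    by (simp add: \<zeta>_def)

  obtain K where K: "1 \<le> K" and est: "\<And>n m x Z a b. 1 \<le> n \<Longrightarrow> 0 \<le> a \<Longrightarrow> 0 \<le> b \<Longrightarrow>
    \<beta> * real n ^ d \<le> x \<Longrightarrow> x \<le> \<beta> * (real n + 1) ^ d \<Longrightarrow>
    \<mu> * real (m choose d) + Z m \<le> x \<Longrightarrow> x \<le> \<mu> * real (Suc m choose d) + Z (Suc m) \<Longrightarrow>
    (\<forall>k. \<bar>Z k - Z n\<bar> \<le> a * root 4 \<bar>real k - real n\<bar> ^ 3 * real (max k n) ^ (d - 1)) \<Longrightarrow>
    \<bar>Z n\<bar> \<le> b * (real n ^ (d - 1) * sqrt (real n)) \<Longrightarrow>
    \<bar>real m - real n\<bar> + 1 \<le> K * (1 + a + b) ^ 4 * sqrt (real n) \<and>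
    \<bar>(real m - real n) / sqrt (real n) + Z n / (\<beta> * real d * (real n ^ (d - 1) * sqrt (real n)))\<bar>
      \<le> K * (1 + a + b) ^ (4 * d + 4) / root 8 (real n)"
    using crossing_estimate[OF d \<mu>(2), folded \<beta>_def] by metis

  \<comment> \<open>\<open>G\<close> involves only the deterministic index n x, so the randomness of
    the passage time is confined to an error that vanishes in every L^p.\<close>
  have close: "\<exists>C\<ge>0. \<forall>\<^sub>F x in at_top. abs_moment p (\<lambda>\<omega>. Y x \<omega> - G x \<omega>)
      \<le> ennreal (C / root 8 (real (n x)) ^ p)" for p :: nat
  proof -
    \<comment> \<open>The pointwise error has degree 4d + 4 in a and b, and its p-th power must be
      controlled by moments of order 4r; the summand 2 secures r >= 2 for the envelope.\<close>
    define r where "r = (4 * d + 4) * p + 2"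
    have r2: "2 \<le> r" and r1: "1 \<le> 2 * r" by (auto simp: r_def)
    have Dp: "(4 * d + 4) * p \<le> 4 * r" by (simp add: r_def)
    obtain C1 where C1: "0 \<le> C1" and env: "\<And>n. \<exists>a \<in> borel_measurable M. (\<forall>\<omega>. 0 \<le> a \<omega>) \<and>
      (\<integral>\<^sup>+\<omega>. ennreal (a \<omega> ^ (4 * r)) \<partial>M) \<le> ennreal C1 \<and>
      (AE \<omega> in M. \<forall>k. \<bar>Udev d f k \<omega> - Udev d f n \<omega>\<bar>
        \<le> a \<omega> * root 4 \<bar>real k - real n\<bar> ^ 3 * real (max k n) ^ (d - 1))"
      using increment_envelope[OF f d r2 fin] by blast
    obtain C2 where C2: "0 \<le> C2" and bb: "\<And>n. 1 \<le> n \<Longrightarrow>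
      (\<integral>\<^sup>+\<omega>. ennreal (\<bar>Udev d f n \<omega> / (real n ^ (d - 1) * sqrt (real n))\<bar> ^ (2 * (2 * r))) \<partial>M) \<le> ennreal C2"
      using scaled_Udev_moment[OF f d r1 fin] by blast
    \<comment> \<open>The first factor is the constant of \<open>scale_estimate\<close> to the power
      p, the second comes from \<open>power_one_plus_le\<close>.\<close>
    define L where "L = (4 * sqrt c * K) ^ p * 3 ^ (4 * r)"
    have L0: "0 \<le> L" using c0 K by (simp add: L_def)
    show ?thesis
    proof (intro exI[of _ "L * (1 + C1 + C2)"] conjI)
      show "0 \<le> L * (1 + C1 + C2)" using L0 C1 C2 by simp
      show "\<forall>\<^sub>F x in at_top. abs_moment p (\<lambda>\<omega>. Y x \<omega> - G x \<omega>)
        \<le> ennreal (L * (1 + C1 + C2) / root 8 (real (n x)) ^ p)"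
        using n1
      proof eventually_elim
        case (elim x)
        then have x: "0 < x" and n: "1 \<le> n x" by auto
        define \<rho> where "\<rho> = root 8 (real (n x))"
        have \<rho>: "0 < \<rho>" using n by (simp add: \<rho>_def)
        obtain a where [measurable]: "a \<in> borel_measurable M" and a0: "\<And>\<omega>. 0 \<le> a \<omega>"
          and a_int: "(\<integral>\<^sup>+\<omega>. ennreal (a \<omega> ^ (4 * r)) \<partial>M) \<le> ennreal C1"
          and a_env: "AE \<omega> in M. \<forall>k. \<bar>Udev d f k \<omega> - Udev d f (n x) \<omega>\<bar>
            \<le> a \<omega> * root 4 \<bar>real k - real (n x)\<bar> ^ 3 * real (max k (n x)) ^ (d - 1)"
          using env[of "n x"] by blast
        define b where "b \<omega> = \<bar>Udev d f (n x) \<omega> / (real (n x) ^ (d - 1) * sqrt (real (n x)))\<bar>" for \<omega>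
        have [measurable]: "b \<in> borel_measurable M" unfolding b_def[abs_def] by measurable
        have b0: "0 \<le> b \<omega>" for \<omega> by (simp add: b_def)
        have b_int: "(\<integral>\<^sup>+\<omega>. ennreal (b \<omega> ^ (4 * r)) \<partial>M) \<le> ennreal C2"
          using bb[OF n] by (simp add: b_def)
        have b_eq: "\<bar>Udev d f (n x) \<omega>\<bar> \<le> b \<omega> * (real (n x) ^ (d - 1) * sqrt (real (n x)))" for \<omega>
          using n by (simp add: b_def abs_divide abs_mult)
        have le: "AE \<omega> in M. \<bar>Y x \<omega> - G x \<omega>\<bar> ^ p \<le> L / \<rho> ^ p * (1 + a \<omega> ^ (4 * r) + b \<omega> ^ (4 * r))"
          using a_env crossing
        proof eventually_elim
          case (elim \<omega>)
          from elim(2) x obtain m where m: "cross \<omega> m x" by blast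
          have U: "\<mu> * real (j choose d) + Udev d f j \<omega> = Ustat d f X j \<omega>" for j
            by (simp add: Udev_def \<mu>)
          have e: "\<bar>real m - real (n x)\<bar> + 1 \<le> K * (1 + a \<omega> + b \<omega>) ^ 4 * sqrt (real (n x))"
            "\<bar>(real m - real (n x)) / sqrt (real (n x)) + \<zeta> (n x) \<omega>\<bar> \<le> K * (1 + a \<omega> + b \<omega>) ^ (4 * d + 4) / root 8 (real (n x))"
            using est[OF n a0[of \<omega>] b0[of \<omega>] x_bounds[OF x], of m "\<lambda>j. Udev d f j \<omega>"] m elim(1) b_eq
            unfolding U cross_def \<zeta>_def by auto
          have "\<bar>(Nr x \<omega> - c * T x) / sqrt (T x) + sqrt c * \<zeta> (n x) \<omega>\<bar> \<le> 4 * sqrt c * K * (1 + a \<omega> + b \<omega>) ^ (4 * d + 4) / \<rho>"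
            unfolding \<rho>_def
            by (rule scale_estimate[OF c0 T0[OF x] n n_bounds[OF x] cross_N[OF m] e _ K])
               (use a0 b0 in auto)
          then have "\<bar>Y x \<omega> - G x \<omega>\<bar> \<le> (4 * sqrt c * K) * (1 + a \<omega> + b \<omega>) ^ (4 * d + 4) / \<rho>"
            by (simp add: Y_def G_def sqrtT[OF x] T_def[symmetric])
          then have "\<bar>Y x \<omega> - G x \<omega>\<bar> ^ p \<le> ((4 * sqrt c * K) * (1 + a \<omega> + b \<omega>) ^ (4 * d + 4) / \<rho>) ^ p"
            by (rule power_mono) simp
          also have "\<dots> = (4 * sqrt c * K) ^ p / \<rho> ^ p * (1 + a \<omega> + b \<omega>) ^ ((4 * d + 4) * p)"
            unfolding power_divide power_mult_distrib power_mult by simp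
          also have "\<dots> \<le> (4 * sqrt c * K) ^ p / \<rho> ^ p * (3 ^ (4 * r) * (1 + a \<omega> ^ (4 * r) + b \<omega> ^ (4 * r)))"
            using \<rho> c0 K by (intro mult_left_mono power_one_plus_le a0 b0 Dp) auto
          also have "\<dots> = L / \<rho> ^ p * (1 + a \<omega> ^ (4 * r) + b \<omega> ^ (4 * r))"
            by (simp add: L_def)
          finally show ?case .
        qed
        have mult_distr: "ennreal (u * (1 + s + t)) = ennreal u * (1 + ennreal s + ennreal t)"
          if "0 \<le> u" "0 \<le> s" "0 \<le> t" for u s t
          using that by (simp add: ennreal_mult ennreal_plus)
        have "abs_moment p (\<lambda>\<omega>. Y x \<omega> - G x \<omega>)
          \<le> (\<integral>\<^sup>+\<omega>. ennreal (L / \<rho> ^ p) * (1 + ennreal (a \<omega> ^ (4 * r)) + ennreal (b \<omega> ^ (4 * r))) \<partial>M)"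
        proof (rule nn_integral_mono_AE)
          show "AE \<omega> in M. ennreal (\<bar>Y x \<omega> - G x \<omega>\<bar> ^ p)
            \<le> ennreal (L / \<rho> ^ p) * (1 + ennreal (a \<omega> ^ (4 * r)) + ennreal (b \<omega> ^ (4 * r)))"
            using le
          proof eventually_elim
            case (elim \<omega>)
            have "ennreal (L / \<rho> ^ p * (1 + a \<omega> ^ (4 * r) + b \<omega> ^ (4 * r)))
              = ennreal (L / \<rho> ^ p) * (1 + ennreal (a \<omega> ^ (4 * r)) + ennreal (b \<omega> ^ (4 * r)))"
              using a0 b0 L0 \<rho> by (intro mult_distr) auto
            with elim show ?case by (metis ennreal_leI)
          qed
        qed
        also have "\<dots> = ennreal (L / \<rho> ^ p) * (1 + (\<integral>\<^sup>+\<omega>. ennreal (a \<omega> ^ (4 * r)) \<partial>M) + (\<integral>\<^sup>+\<omega>. ennreal (b \<omega> ^ (4 * r)) \<partial>M))"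
          by (subst nn_integral_cmult, measurable) (simp add: nn_integral_add emeasure_space_1)
        also have "\<dots> \<le> ennreal (L / \<rho> ^ p) * (1 + ennreal C1 + ennreal C2)"
          by (intro mult_left_mono add_mono a_int b_int order_refl) simp
        also have "\<dots> = ennreal (L / \<rho> ^ p * (1 + C1 + C2))"
          using C1 C2 L0 \<rho> by (intro mult_distr[symmetric]) auto
        finally show ?case by (simp add: \<rho>_def)
      qed
    qed
  qed

  have G_mom: "\<exists>C\<ge>0. \<forall>\<^sub>F x in at_top. abs_moment (2 * p) (G x) \<le> ennreal C" if p: "1 \<le> p" for p
  proof -
    obtain C2 where C2: "0 \<le> C2" and bb: "\<And>n. 1 \<le> n \<Longrightarrow>
      abs_moment (2 * p) (\<lambda>\<omega>. Udev d f n \<omega> / (real n ^ (d - 1) * sqrt (real n))) \<le> ennreal C2"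
      using scaled_Udev_moment[OF f d p fin] by blast
    define L where "L = \<bar>sqrt c * (1 / (\<beta> * real d))\<bar> ^ (2 * p)"
    have "\<forall>\<^sub>F x in at_top. abs_moment (2 * p) (G x) \<le> ennreal (L * C2)"
      using n1
    proof eventually_elim
      case (elim x)
      have "abs_moment (2 * p) (G x)
        = (\<integral>\<^sup>+\<omega>. ennreal L * ennreal (\<bar>Udev d f (n x) \<omega> / (real (n x) ^ (d - 1) * sqrt (real (n x)))\<bar> ^ (2 * p)) \<partial>M)"
      proof (intro nn_integral_cong)
        fix \<omega>
        let ?V = "Udev d f (n x) \<omega> / (real (n x) ^ (d - 1) * sqrt (real (n x)))"
        have "G x \<omega> = - (sqrt c * (1 / (\<beta> * real d)) * ?V)"
          unfolding G_def \<zeta>_eq by (simp only: mult_minus_left mult.assoc)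
        then have "\<bar>G x \<omega>\<bar> ^ (2 * p) = L * \<bar>?V\<bar> ^ (2 * p)"
          by (simp only: abs_minus_cancel abs_mult[of _ ?V] power_mult_distrib L_def)
        then show "ennreal (\<bar>G x \<omega>\<bar> ^ (2 * p)) = ennreal L * ennreal (\<bar>?V\<bar> ^ (2 * p))"
          by (simp only: ennreal_mult'' zero_le_power abs_ge_zero)
      qed
      also have "\<dots> = ennreal L * abs_moment (2 * p) (\<lambda>\<omega>. Udev d f (n x) \<omega> / (real (n x) ^ (d - 1) * sqrt (real (n x))))"
        by (intro nn_integral_cmult) measurable
      also have "\<dots> \<le> ennreal L * ennreal C2"
        using elim by (intro mult_left_mono bb) auto
      also have "\<dots> = ennreal (L * C2)" using C2 by (simp add: L_def ennreal_mult)
      finally show ?case .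
    qed
    then show ?thesis using C2 by (intro exI[of _ "L * C2"]) (simp add: L_def)
  qed

  have small: "((\<lambda>x. C / root 8 (real (n x)) ^ 2) \<longlongrightarrow> 0) at_top" for C
  proof -
    have "filterlim (\<lambda>x. root 8 (real (n x)) ^ 2) at_top at_top"
      unfolding filterlim_at_top
    proof
      fix B :: real
      show "\<forall>\<^sub>F x in at_top. B \<le> root 8 (real (n x)) ^ 2"
        using n_top[THEN filterlim_at_top[THEN iffD1], rule_format, of "nat \<lceil>(1 + \<bar>B\<bar>) ^ 8\<rceil>"]
      proof eventually_elim
        case (elim x)
        then have "(1 + \<bar>B\<bar>) ^ 8 \<le> real (n x)" by linarith
        then have "root 8 ((1 + \<bar>B\<bar>) ^ 8) \<le> root 8 (real (n x))" by (rule real_root_le_mono[rotated]) simp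
        then have r: "1 + \<bar>B\<bar> \<le> root 8 (real (n x))" using real_root_pos2[of 8 "1 + \<bar>B\<bar>"] by simp
        have "1 \<le> root 8 (real (n x))" using r by linarith
        then have "root 8 (real (n x)) ^ 1 \<le> root 8 (real (n x)) ^ 2"
          by (intro power_increasing) simp_all
        with r show ?case by simp
      qed
    qed
    then show ?thesis
      by (intro tendsto_divide_0[OF tendsto_const] filterlim_at_top_imp_at_infinity)
  qed

  \<comment> \<open>\<open>G\<close> is \<kappa> times the normalised deviation. Thus the limit
    variance is \<kappa>^2 \<sigma>^2 = c \<sigma>^2/(\<beta> d)^2, and c = (1/\<beta>)^(1/d)
    explains the exponent 2 + 1/d.\<close>
  define \<kappa> where "\<kappa> = - sqrt c / (\<beta> * real d)"
  have \<sigma>0: "0 \<le> Usigma2 M d f X" by (rule Usigma2_nonneg[OF f d fin fin])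
  have v0: "0 \<le> v" unfolding v_def using \<sigma>0 by simp
  have v_eq: "v = \<kappa>\<^sup>2 * Usigma2 M d f X"
  proof -
    have "(1 / \<beta>) powr (2 + 1 / real d) = (1 / \<beta>)\<^sup>2 * c"
      using \<beta> by (simp add: powr_add c_eq)
    then show ?thesis
      unfolding v_def \<kappa>_def using c0 by (simp add: \<beta>_def power_divide power_mult_distrib)
  qed
  have charG: "((\<lambda>x. char (distr M borel (G x)) t) \<longlongrightarrow> char (normal_law 0 v) t) at_top" for t
  proof -
    have "char (distr M borel (G x)) t = char (distr M borel (\<lambda>\<omega>. Udev d f (n x) \<omega> / (real (n x) ^ (d - 1) * sqrt (real (n x))))) (\<kappa> * t)" for x
      unfolding char_def by (subst (1 2) integral_distr) (simp_all add: G_def \<zeta>_eq \<kappa>_def mult_ac)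
    moreover have "((\<lambda>x. char (distr M borel (\<lambda>\<omega>. Udev d f (n x) \<omega> / (real (n x) ^ (d - 1) * sqrt (real (n x))))) (\<kappa> * t)) \<longlongrightarrow> complex_of_real (exp (- ((\<kappa> * t)\<^sup>2 * Usigma2 M d f X / 2)))) at_top"
      using filterlim_compose[OF char_Udev[OF f d fin fin, of "\<kappa> * t"] n_top] by simp
    ultimately show ?thesis
      unfolding char_normal_law[OF v0] unfolding v_eq by (simp add: power_mult_distrib mult_ac)
  qed
  have charY: "((\<lambda>x. char (distr M borel (Y x)) t) \<longlongrightarrow> char (normal_law 0 v) t) at_top" for t
  proof -
    obtain C where C: "\<forall>\<^sub>F x in at_top. abs_moment 2 (\<lambda>\<omega>. Y x \<omega> - G x \<omega>)
      \<le> ennreal (C / root 8 (real (n x)) ^ 2)"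
      using close[of 2] by blast
    show ?thesis by (rule char_slutsky[OF Y_meas G_meas charG small C])
  qed
  have Y_even: "\<exists>B. \<forall>\<^sub>F x in at_top. abs_moment (2 * p) (Y x) \<le> ennreal B" if p: "1 \<le> p" for p
  proof -
    obtain C where C0: "0 \<le> C" and C: "\<forall>\<^sub>F x in at_top. abs_moment (2 * p) (\<lambda>\<omega>. Y x \<omega> - G x \<omega>)
      \<le> ennreal (C / root 8 (real (n x)) ^ (2 * p))"
      using close[of "2 * p"] by blast
    obtain C' where C'0: "0 \<le> C'" and C': "\<forall>\<^sub>F x in at_top. abs_moment (2 * p) (G x) \<le> ennreal C'"
      using G_mom[OF p] by blast
    have "\<forall>\<^sub>F x in at_top. abs_moment (2 * p) (Y x) \<le> ennreal (2 ^ (2 * p) * (C + C'))"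
      using C C' n1
    proof eventually_elim
      case (elim x)
      have "1 \<le> root 8 (real (n x))" using elim by simp
      then have "1 \<le> root 8 (real (n x)) ^ (2 * p)" by (rule one_le_power)
      then have "C / root 8 (real (n x)) ^ (2 * p) \<le> C / 1"
        using C0 by (intro divide_left_mono) auto
      then have "abs_moment (2 * p) (\<lambda>\<omega>. Y x \<omega> - G x \<omega>) \<le> ennreal C"
        using elim(1) by (elim order_trans) (simp add: ennreal_leI)
      from add_moment_bound[OF _ G_meas C0 C'0 this elim(2)]
      show ?case by simp
    qed
    then show ?thesis by blast
  qed
  \<comment> \<open>The order 2(p + 1) is even, positive and larger than p, and so dominates order p
    up to an added 1, p = 0 included.\<close>
  have Y_mom: "\<exists>B. \<forall>\<^sub>F x in at_top. abs_moment p (Y x) \<le> ennreal B" for p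
  proof -
    obtain B where B: "\<forall>\<^sub>F x in at_top. abs_moment (2 * Suc p) (Y x) \<le> ennreal B"
      using Y_even[of "Suc p"] by auto
    have "\<forall>\<^sub>F x in at_top. abs_moment p (Y x) \<le> ennreal (1 + max 0 B)"
      using B
    proof eventually_elim
      case (elim x)
      have le: "u ^ p \<le> 1 + u ^ (2 * Suc p)" if "0 \<le> u" for u :: real
      proof (cases "u \<le> 1")
        case True
        then show ?thesis using that power_le_one[of u p] by (intro add_increasing2) auto
      next
        case False
        then have "u ^ p \<le> u ^ (2 * Suc p)" by (intro power_increasing) auto
        then show ?thesis by simp
      qed
      have "abs_moment p (Y x) \<le> (\<integral>\<^sup>+\<omega>. 1 + ennreal (\<bar>Y x \<omega>\<bar> ^ (2 * Suc p)) \<partial>M)"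
        using le by (intro nn_integral_mono) (simp add: ennreal_leI ennreal_1[symmetric] ennreal_plus[symmetric] del: ennreal_1 ennreal_plus power_Suc mult_Suc_right)
      also have "\<dots> = 1 + abs_moment (2 * Suc p) (Y x)"
        by (subst nn_integral_add) (auto simp: emeasure_space_1)
      also have "\<dots> \<le> 1 + ennreal (max 0 B)"
        using elim by (intro add_left_mono) (auto intro: order_trans ennreal_leI)
      also have "\<dots> = ennreal (1 + max 0 B)" by (simp add: ennreal_plus)
      finally show ?case .
    qed
    then show ?thesis by blast
  qed
  note Y_conv = convergence_from_char[OF Y_meas real_distribution_normal_law[OF v0] charY Y_mom]
  show "conv_in_distr M (\<lambda>x \<omega>. (Nr x \<omega> - c * x powr (1 / real d)) / x powr (1 / (2 * real d))) (normal_law 0 v)"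
    using Y_conv(1) by (simp add: Y_def[abs_def])
  show Ymom: "conv_moments M (\<lambda>x \<omega>. (Nr x \<omega> - c * x powr (1 / real d)) / x powr (1 / (2 * real d))) (normal_law 0 v)"
    using Y_conv(2) by (simp add: Y_def[abs_def])

  define W where "W x \<omega> = Nr x \<omega> / x powr (1 / real d)" for x \<omega>
  have W_meas [measurable]: "W x \<in> borel_measurable M" for x
    unfolding W_def[abs_def] by measurable
  have NrY: "Nr x \<omega> = c * T x + sqrt (T x) * Y x \<omega>" if "0 < x" for x \<omega>
    using T0[OF that] by (simp add: Y_def sqrtT[OF that] T_def[symmetric])
  \<comment> \<open>The law-of-large-numbers scale is the normal scale with a further division by
    root T. Bounded moments of \<open>Y\<close> therefore give both the concentration of
    \<open>W\<close> at c and its moment bounds.\<close>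
  have WY: "W x \<omega> - c = Y x \<omega> / sqrt (T x)" if "0 < x" for x \<omega>
    using T0[OF that] real_sqrt_mult_self[of "T x"]
    by (simp add: W_def T_def[symmetric] NrY[OF that] field_simps)
  have T1: "\<forall>\<^sub>F x in at_top. 0 < x \<and> 1 \<le> T x"
    using eventually_gt_at_top[of 0] T_top[THEN filterlim_at_top[THEN iffD1], rule_format, of 1]
    by eventually_elim auto
  have rd_return: "real_distribution (return borel c)"
    by (auto simp: real_distribution_def real_distribution_axioms_def intro: prob_space_return)
  have charW: "((\<lambda>x. char (distr M borel (W x)) t) \<longlongrightarrow> char (return borel c) t) at_top" for t
  proof -
    obtain B where B: "\<forall>\<^sub>F x in at_top. abs_moment 2 (Y x) \<le> ennreal B"
      using Y_mom[of 2] by blast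
    have "distr M borel (\<lambda>_. c) = return borel c"
      by (rule distr_const) simp
    then have lim: "((\<lambda>x::real. char (distr M borel (\<lambda>_. c)) t) \<longlongrightarrow> char (return borel c) t) at_top"
      by simp
    have "\<forall>\<^sub>F x in at_top. abs_moment 2 (\<lambda>\<omega>. W x \<omega> - c) \<le> ennreal (max 0 B / T x)"
      using B T1
    proof eventually_elim
      case (elim x)
      then have x: "0 < x" by simp
      have "abs_moment 2 (\<lambda>\<omega>. W x \<omega> - c) = (\<integral>\<^sup>+\<omega>. ennreal (1 / T x) * ennreal (\<bar>Y x \<omega>\<bar>\<^sup>2) \<partial>M)"
        unfolding WY[OF x] using T0[OF x]
        by (intro nn_integral_cong) (simp add: ennreal_mult[symmetric] power_divide)
      also have "\<dots> = ennreal (1 / T x) * abs_moment 2 (Y x)"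
        by (intro nn_integral_cmult) measurable
      also have "\<dots> \<le> ennreal (1 / T x) * ennreal (max 0 B)"
        using elim by (intro mult_left_mono) (auto intro: order_trans ennreal_leI)
      also have "\<dots> = ennreal (max 0 B / T x)"
        using T0[OF x] by (subst ennreal_mult[symmetric]) auto
      finally show ?case .
    qed
    moreover have "((\<lambda>x. max 0 B / T x) \<longlongrightarrow> 0) at_top"
      by (intro tendsto_divide_0[OF tendsto_const] filterlim_at_top_imp_at_infinity T_top)
    ultimately show ?thesis
      by (intro char_slutsky[OF W_meas _ lim]) auto
  qed
  have W_mom: "\<exists>B. \<forall>\<^sub>F x in at_top. abs_moment p (W x) \<le> ennreal B" for p
  proof -
    obtain B where B: "\<forall>\<^sub>F x in at_top. abs_moment p (Y x) \<le> ennreal B"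
      using Y_mom[of p] by blast
    have "\<forall>\<^sub>F x in at_top. abs_moment p (W x) \<le> ennreal (2 ^ p * (max 0 B + c ^ p))"
      using B T1
    proof eventually_elim
      case (elim x)
      then have x: "0 < x" by simp
      have "abs_moment p (\<lambda>\<omega>. W x \<omega> - c) \<le> abs_moment p (Y x)"
      proof (intro nn_integral_mono ennreal_leI power_mono)
        fix \<omega>
        have "\<bar>Y x \<omega>\<bar> / sqrt (T x) \<le> \<bar>Y x \<omega>\<bar> / 1"
          using elim by (intro divide_left_mono) auto
        then show "\<bar>W x \<omega> - c\<bar> \<le> \<bar>Y x \<omega>\<bar>"
          unfolding WY[OF x] using T0[OF x] by (simp add: abs_divide)
      qed simp
      also have "\<dots> \<le> ennreal (max 0 B)"
        using elim by (auto intro: order_trans ennreal_leI)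
      finally have 1: "abs_moment p (\<lambda>\<omega>. W x \<omega> - c) \<le> ennreal (max 0 B)" .
      have 2: "abs_moment p (\<lambda>\<omega>. c) \<le> ennreal (c ^ p)"
        using c0 by (simp add: emeasure_space_1)
      show ?case
        using add_moment_bound[OF _ _ _ _ 1 2] c0 by simp
    qed
    then show ?thesis by blast
  qed
  have Wmom: "conv_moments M W (return borel c)"
    by (rule convergence_from_char[OF W_meas rd_return charW W_mom])
  then show "conv_moments M (\<lambda>x \<omega>. Nr x \<omega> / x powr (1 / real d)) (return borel c)"
    by (simp add: W_def[abs_def])

  show "((\<lambda>x. (\<integral>\<omega>. Nr x \<omega> \<partial>M) / x powr (1 / real d)) \<longlongrightarrow> c) at_top"
  proof -
    have "((\<lambda>x. \<integral>\<omega>. W x \<omega> ^ 1 \<partial>M) \<longlongrightarrow> (\<integral>y. y ^ 1 \<partial>return borel c)) at_top"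
      using Wmom unfolding conv_moments_def by blast
    then show ?thesis by (simp add: W_def integral_return)
  qed

  \<comment> \<open>Variance ignores the centring and scales by T, so for large x, where
    \<open>Y x\<close> has two moments, the ratio equals the variance of \<open>Y x\<close>; the
    first two moments of \<open>Y x\<close> tend to 0 and v.\<close>
  show "((\<lambda>x. covar M (Nr x) (Nr x) / x powr (1 / real d)) \<longlongrightarrow> v) at_top"
  proof -
    have mom: "(\<forall>\<^sub>F x in at_top. integrable M (\<lambda>\<omega>. Y x \<omega> ^ k)) \<and>
        ((\<lambda>x. \<integral>\<omega>. Y x \<omega> ^ k \<partial>M) \<longlongrightarrow> (\<integral>y. y ^ k \<partial>normal_law 0 v)) at_top" if "1 \<le> k" for k
      using Y_conv(2) that unfolding conv_moments_def by blast
    have lim1: "((\<lambda>x. \<integral>\<omega>. Y x \<omega> \<partial>M) \<longlongrightarrow> 0) at_top"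
      using mom[of 1] normal_law_moments[OF v0] by simp
    have lim2: "((\<lambda>x. \<integral>\<omega>. (Y x \<omega>)\<^sup>2 \<partial>M) \<longlongrightarrow> v) at_top"
      using mom[of 2] normal_law_moments[OF v0] by simp
    have "((\<lambda>x. (\<integral>\<omega>. (Y x \<omega>)\<^sup>2 \<partial>M) - (\<integral>\<omega>. Y x \<omega> \<partial>M)\<^sup>2) \<longlongrightarrow> v - 0\<^sup>2) at_top"
      by (intro tendsto_intros lim1 lim2)
    then have lim: "((\<lambda>x. (\<integral>\<omega>. (Y x \<omega>)\<^sup>2 \<partial>M) - (\<integral>\<omega>. Y x \<omega> \<partial>M)\<^sup>2) \<longlongrightarrow> v) at_top"
      by simp
    have int: "\<forall>\<^sub>F x in at_top. integrable M (Y x)" "\<forall>\<^sub>F x in at_top. integrable M (\<lambda>\<omega>. (Y x \<omega>)\<^sup>2)"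
      using mom[of 1] mom[of 2] by simp_all
    show ?thesis
    proof (rule Lim_transform_eventually[OF lim])
      show "\<forall>\<^sub>F x in at_top. (\<integral>\<omega>. (Y x \<omega>)\<^sup>2 \<partial>M) - (\<integral>\<omega>. Y x \<omega> \<partial>M)\<^sup>2 = covar M (Nr x) (Nr x) / x powr (1 / real d)"
        using int eventually_gt_at_top[of 0]
      proof eventually_elim
        case (elim x)
        define e where "e = (\<integral>\<omega>. Y x \<omega> \<partial>M)"
        have Tx: "0 < T x" by (rule T0[OF elim(3)])
        have "(\<integral>\<omega>. Nr x \<omega> \<partial>M) = c * T x + sqrt (T x) * e"
          unfolding NrY[OF elim(3)] using elim(1) by (simp add: e_def prob_space)
        then have "covar M (Nr x) (Nr x) = (\<integral>\<omega>. T x * (Y x \<omega> - e)\<^sup>2 \<partial>M)"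
          unfolding covar_def NrY[OF elim(3)]
        proof (intro Bochner_Integration.integral_cong refl, goal_cases)
          case (1 \<omega>)
          have "(sqrt (T x) * (Y x \<omega> - e)) * (sqrt (T x) * (Y x \<omega> - e)) = T x * (Y x \<omega> - e)\<^sup>2"
            using Tx by (simp add: power2_eq_square mult_ac)
          with 1 show ?case by (simp add: right_diff_distrib)
        qed
        also have "\<dots> = T x * (\<integral>\<omega>. (Y x \<omega> - e)\<^sup>2 \<partial>M)" by simp
        also have "(\<integral>\<omega>. (Y x \<omega> - e)\<^sup>2 \<partial>M) = (\<integral>\<omega>. (Y x \<omega>)\<^sup>2 \<partial>M) - e\<^sup>2"
          unfolding e_def by (rule variance_eq) (use elim in auto)
        finally show ?case using Tx by (simp add: e_def T_def[symmetric])
      qed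
    qed
  qed
qed

end

theorem theorem3p16:
  fixes M :: "'a measure" and S :: "'s measure"
    and X :: "nat \<Rightarrow> 'a \<Rightarrow> 's" and f :: "(nat \<Rightarrow> 's) \<Rightarrow> real"
    and d :: nat and \<mu> \<sigma>2 c v :: real
    and N :: "real \<Rightarrow> 'a \<Rightarrow> ereal" and Nr :: "real \<Rightarrow> 'a \<Rightarrow> real"
  assumes "prob_space M"
    and "iid M S X"
    and "1 \<le> d"
    and "f \<in> borel_measurable (Pi\<^sub>M {1..d} (\<lambda>_. S))"
    and "\<And>p::real. 0 < p \<Longrightarrow> integrable M (\<lambda>\<omega>. \<bar>f (\<lambda>k\<in>{1..d}. X k \<omega>)\<bar> powr p)"
    and "\<mu> = Umean M d f X"
    and "0 < \<mu>"
    and "\<sigma>2 = Usigma2 M d f X"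
    and "c = (fact d / \<mu>) powr (1 / real d)"
    and "v = (fact d / \<mu>) powr (2 + 1 / real d) / (real d)\<^sup>2 * \<sigma>2"
    and "N = N_minus d f X \<or> N = N_plus d f X"
    and "Nr = (\<lambda>x \<omega>. real_of_ereal (N x \<omega>))"
  shows "(AE \<omega> in M. \<forall>x>0. \<bar>N x \<omega>\<bar> \<noteq> \<infinity>)
    \<and> (AE \<omega> in M. ((\<lambda>x. Nr x \<omega> / x powr (1 / real d)) \<longlongrightarrow> c) at_top)
    \<and> conv_moments M (\<lambda>x \<omega>. Nr x \<omega> / x powr (1 / real d)) (return borel c)
    \<and> conv_in_distr M
        (\<lambda>x \<omega>. (Nr x \<omega> - c * x powr (1 / real d)) / x powr (1 / (2 * real d)))
        (normal_law 0 v)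
    \<and> conv_moments M
        (\<lambda>x \<omega>. (Nr x \<omega> - c * x powr (1 / real d)) / x powr (1 / (2 * real d)))
        (normal_law 0 v)
    \<and> ((\<lambda>x. (\<integral>\<omega>. Nr x \<omega> \<partial>M) / x powr (1 / real d)) \<longlongrightarrow> c) at_top
    \<and> ((\<lambda>x. covar M (Nr x) (Nr x) / x powr (1 / real d)) \<longlongrightarrow> v) at_top"
proof -
  interpret prob_space M by fact
  interpret iid_sequence M S X by unfold_locales fact
  \<comment> \<open>The integrability hypothesis concerns positive real exponents, so p = 0 is
    treated separately.\<close>
  have fin: "moment p d f < \<infinity>" for p
  proof (cases "p = 0")
    case True
    then show ?thesis by (simp add: moment_def emeasure_space_1)
  next
    case False
    have eq: "\<bar>f (past {1..d} \<omega>)\<bar> powr real p = \<bar>f (past {1..d} \<omega>)\<bar> ^ p" for \<omega>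
      using False by (simp add: powr_realpow')
    have "integrable M (\<lambda>\<omega>. \<bar>f (past {1..d} \<omega>)\<bar> ^ p)"
      using assms(5)[of "real p"] False unfolding eq[symmetric] by (simp add: past_def)
    then show ?thesis
      unfolding integrable_iff_bounded moment_def by simp
  qed
  show ?thesis
    using passage_time_limits[OF assms(4,3) fin assms(6,7,9) assms(10)[unfolded assms(8)] assms(11,12)]
    by blast
qed

end
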